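(* Let $n \ge 1$ and $n-1 \le k \le 2n-3$, and let $X$ be the set of non-crossing connected graphs on $n$ vertices with $k$ edges. Let $$c(n,k;q) = \frac{1}{[n-1]_q}{3n-3 \brack n+k}_q {k-1 \brack n-2}_q,$$ which is a polynomial in $q$. If $d \ge 1$ divides $n$ and $\omega$ is a primitive $d$-th root of unity, then $$c(n,k;\omega) = s_d(n,k),$$ where $s_d(n,k)$ is the number of $x \in X$ that are fixed under rotation by $\frac{2\pi}{d}$.
   Context: A non-crossing graph on $\{1,\ldots,n\}$ is a simple graph whose vertices $1,\ldots,n$ are placed in this order around a circle, edges drawn as straight chords, such that no two edges cross. Rotation by $\frac{2\pi}{d}$ (for $d \mid n$) sends vertex $i$ to vertex $i + n/d$ (indices taken modulo $n$ in $\{1,\ldots,n\}$), acting on edges accordingly. Notation: $[m]_q = 1+q+\cdots+q^{m-1}$, $[m]!_q = [m]_q[m-1]_q\cdots[1]_q$, and ${a \brack b}_q = \frac{[a]!_q}{[b]!_q[a-b]!_q}$ for $0\le b\le a$, and ${a \brack b}_q=0$ otherwise. *)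

theory Defs
  imports
    "HOL-Analysis.Analysis"
    "HOL-Computational_Algebra.Polynomial_Factorial"
begin

definition q_int :: "nat \<Rightarrow> 'a::field \<Rightarrow> 'a" where
  "q_int m q = (\<Sum>i<m. q ^ i)"

definition q_fact :: "nat \<Rightarrow> 'a::field \<Rightarrow> 'a" where
  "q_fact m q = (\<Prod>i=1..m. q_int i q)"

definition q_binomial :: "nat \<Rightarrow> nat \<Rightarrow> 'a::field \<Rightarrow> 'a" where
  "q_binomial a b q =
     (if b \<le> a then q_fact a q / (q_fact b q * q_fact (a - b) q) else 0)"

text \<open>
  The quotient \<open>c(n,k;q)\<close> is taken in the field of rational functions in the indeterminate \<open>q\<close>,
  that is, the fraction field of the integer polynomials. It cannot be computed directly at a
  root of unity, where the denominators may vanish and Isabelle's division would return 0.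
\<close>

definition c_rat :: "nat \<Rightarrow> nat \<Rightarrow> int poly fract" where
  "c_rat n k =
     (let q = to_fract [:0, 1:]
      in 1 / q_int (n - 1) q * q_binomial (3 * n - 3) (n + k) q * q_binomial (k - 1) (n - 2) q)"

definition primitive_root_of_unity :: "nat \<Rightarrow> complex \<Rightarrow> bool" where
  "primitive_root_of_unity d w \<longleftrightarrow> d \<ge> 1 \<and> w ^ d = 1 \<and> (\<forall>j. 1 \<le> j \<and> j < d \<longrightarrow> w ^ j \<noteq> 1)"

text \<open>
  A simple graph on the vertices \<open>1, \<dots>, n\<close> is given by its set of edges, each edge being a
  two-element set of vertices.
\<close>

definition simple_graph :: "nat \<Rightarrow> nat set set \<Rightarrow> bool" where
  "simple_graph n E \<longleftrightarrow> (\<forall>e\<in>E. e \<subseteq> {1..n} \<and> card e = 2)"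

definition connected_graph :: "nat \<Rightarrow> nat set set \<Rightarrow> bool" where
  "connected_graph n E \<longleftrightarrow> (\<forall>u\<in>{1..n}. \<forall>v\<in>{1..n}. (u, v) \<in> {(x, y). {x, y} \<in> E}\<^sup>*)"

definition circle_point :: "nat \<Rightarrow> nat \<Rightarrow> complex" where
  "circle_point n i = cis (2 * pi * real i / real n)"

text \<open>
  Endpoints are excluded from the chords, so that two edges with a common vertex do not cross.
\<close>

definition edges_cross :: "nat \<Rightarrow> nat set \<Rightarrow> nat set \<Rightarrow> bool" where
  "edges_cross n e f \<longleftrightarrow> e \<noteq> f \<and>
     (\<exists>a b c d. e = {a, b} \<and> f = {c, d} \<and>
        open_segment (circle_point n a) (circle_point n b) \<inter>
        open_segment (circle_point n c) (circle_point n d) \<noteq> {})"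

definition noncrossing_graph :: "nat \<Rightarrow> nat set set \<Rightarrow> bool" where
  "noncrossing_graph n E \<longleftrightarrow> simple_graph n E \<and> (\<forall>e\<in>E. \<forall>f\<in>E. \<not> edges_cross n e f)"

definition noncrossing_connected_graphs :: "nat \<Rightarrow> nat \<Rightarrow> nat set set set" where
  "noncrossing_connected_graphs n k =
     {E. noncrossing_graph n E \<and> connected_graph n E \<and> card E = k}"

text \<open>
  The shift by 1 before and after reducing modulo \<open>n\<close> keeps the representatives in \<open>{1..n}\<close>.
\<close>

definition rotate_vertex :: "nat \<Rightarrow> nat \<Rightarrow> nat \<Rightarrow> nat" where
  "rotate_vertex n d i = (i + n div d - 1) mod n + 1"

definition rotate_graph :: "nat \<Rightarrow> nat \<Rightarrow> nat set set \<Rightarrow> nat set set" where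
  "rotate_graph n d E = (\<lambda>e. rotate_vertex n d ` e) ` E"

definition num_fixed :: "nat \<Rightarrow> nat \<Rightarrow> nat \<Rightarrow> nat" where
  "num_fixed d n k = card {E \<in> noncrossing_connected_graphs n k. rotate_graph n d E = E}"

end

theory Submission
  imports Defs "HOL-Computational_Algebra.Formal_Power_Series"
begin

text \<open>
  Cutting a connected non-crossing graph at the farthest neighbour of its first vertex, and removing
  the edge between its first and last vertices, gives two equations for the generating functions \<open>T\<close> of
  all such graphs and \<open>R\<close> of those containing that edge (\<open>x\<close> marks all vertices but one, \<open>y\<close> marks edges):
  \<open>T = R (1 + T)\<close> and \<open>R = y (T - R) + x y (1 + T)\<^sup>2\<close>. Hence \<open>T = x \<phi>(T)\<close> with
  \<open>\<phi>(t) = y (1 + t)\<^sup>3 / (1 - y t)\<close>, and Lagrange inversion gives the count for \<open>d = 1\<close>.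

  Let \<open>d \<ge> 2\<close> and \<open>n = d m\<close>. A graph invariant under rotation consists of \<open>d\<close> copies of one connected
  graph on consecutive vertices \<open>i, \<dots>, i + m\<close>, glued at their end points. The block becomes unique if
  its first vertex \<open>i \<le> m\<close> is required to have a neighbour beyond \<open>m\<close>, so the number of invariant
  graphs is the sum over all blocks of the distance from the first vertex to its farthest neighbour, which
  is again given by Lagrange inversion. For \<open>d = 2\<close> a block with an edge joining its end points gives
  a diameter, which is counted once instead of twice. The values of \<open>c(n,k;q)\<close> at roots of unity
  follow from a \<open>q\<close>-analogue of Lucas' theorem.
\<close>

unbundle no vec_syntax
unbundle fps_syntax

section \<open>Gaussian binomial coefficients at roots of unity\<close>

text \<open>No quotient is ever evaluated at \<omega>: \<open>c\<close> enters only through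
  \<open>[n-1] c = A B\<close>, where the Gaussian binomials \<open>A\<close>, \<open>B\<close> come
  from the Pascal recursion and make sense at every \<open>q\<close>. This determines
  \<open>c(\<omega>)\<close>, since \<open>[n-1]\<close> is nonzero there: it is
  \<open>n - 1\<close> at 1, and it equals \<open>[d-1]\<close> for \<open>d \<ge> 2\<close>
  dividing \<open>n\<close>. The variable \<open>y\<close> is a positive real number, so power
  series in \<open>x\<close> alone suffice; coefficients in \<open>y\<close> are recovered because
  polynomials that agree for all \<open>y > 0\<close> coincide. As \<open>R = T/(1+T)\<close>, the
  three series needed, \<open>T'\<close>, \<open>R'(1+T)\<close> and \<open>R'\<close>, are
  \<open>T'/(1+T)^e\<close> for \<open>e = 0, 1, 2\<close>. This is the origin of the upper entries
  \<open>3m\<close>, \<open>3m-1\<close>, \<open>3m-2\<close>. Invariant graphs are studied on the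
  integer line, which covers the cycle: crossing becomes interleaving of integers, and every edge
  lifts to arcs of length at most \<open>m\<close>. The exception that shapes the statements is the
  diameter for \<open>d = 2\<close>: it is the only edge whose short lifts are not all translates by
  multiples of \<open>n\<close>.\<close>

fun gauss_binomial :: "nat \<Rightarrow> nat \<Rightarrow> 'a::comm_ring_1 \<Rightarrow> 'a" where
  "gauss_binomial n 0 q = 1"
| "gauss_binomial 0 (Suc k) q = 0"
| "gauss_binomial (Suc n) (Suc k) q = gauss_binomial n k q + q ^ Suc k * gauss_binomial n (Suc k) q"

text \<open>Agrees with \<open>q_int\<close>, but over commutative rings: like
  \<open>gauss_binomial\<close> it is needed in the ring of integer polynomials, where divisibility
  by \<open>[n-1]\<close> is shown.\<close>

definition q_number :: "nat \<Rightarrow> 'a::comm_ring_1 \<Rightarrow> 'a" where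
  "q_number m q = (\<Sum>i<m. q ^ i)"

lemma q_number_0 [simp]: "q_number 0 q = 0"
  and q_number_Suc: "q_number (Suc m) q = q_number m q + q ^ m"
  by (simp_all add: q_number_def)

lemma q_number_Suc': "q_number (Suc m) q = 1 + q * q_number m q"
  by (simp add: q_number_def sum.lessThan_Suc_shift sum_distrib_left del: sum.lessThan_Suc)

lemma q_number_add: "q_number (a + b) q = q_number a q + q ^ a * q_number b q"
  by (induction b) (simp_all add: q_number_Suc algebra_simps power_add)

lemma q_number_one: "q_number m (1::'a::comm_ring_1) = of_nat m"
  by (simp add: q_number_def)

lemma q_number_dvd_mult: "q_number a q dvd q_number (c * a) q"
  by (induction c) (simp_all add: q_number_add)

lemma gauss_binomial_eq_0: "n < k \<Longrightarrow> gauss_binomial n k q = 0"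
  by (induction n k q rule: gauss_binomial.induct) auto

lemma gauss_binomial_self [simp]: "gauss_binomial n n q = 1"
  by (induction n) (auto simp: gauss_binomial_eq_0)

lemma gauss_binomial_one: "gauss_binomial n k (1::'a::comm_ring_1) = of_nat (n choose k)"
  by (induction n k "1::'a" rule: gauss_binomial.induct) auto

text \<open>The q-analogue of absorption is the only bridge from the Pascal recursion to factorials,
  to divisibility by \<open>[N]\<close> and to vanishing at roots of unity.\<close>

lemma gauss_binomial_absorb:
  "q_number (Suc k) q * gauss_binomial (Suc n) (Suc k) q = q_number (Suc n) q * gauss_binomial n k q"
proof (induction n arbitrary: k)
  case 0
  show ?case by (cases k) (simp_all add: q_number_Suc)
next
  case (Suc n)
  show ?case
  proof (cases k)
    case 0
    have "q_number (Suc 0) q * gauss_binomial (Suc n) (Suc 0) q = q_number (Suc n) q * gauss_binomial n 0 q"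
      by (rule Suc.IH)
    then have "gauss_binomial (Suc n) (Suc 0) q = q_number (Suc n) q"
      by (simp add: q_number_Suc)
    then show ?thesis using 0
      by (simp add: q_number_Suc' [of "Suc n"] q_number_Suc [of 0] del: gauss_binomial.simps(3))
         (simp)
  next
    case (Suc j)
    have "q_number (Suc k) q * gauss_binomial (Suc (Suc n)) (Suc k) q
      = q_number (Suc k) q * gauss_binomial (Suc n) k q
        + q ^ Suc k * (q_number (Suc k) q * gauss_binomial (Suc n) (Suc k) q)"
      by (subst gauss_binomial.simps(3)) (simp only: algebra_simps)
    \<comment> \<open>Writing \<open>[k+1] = 1 + q [k]\<close> in the first term only lets the
      induction hypothesis for \<open>k - 1\<close> apply there; the two resulting multiples of
      \<open>q [n+1]\<close> recombine by the Pascal rule.\<close>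
    also have "\<dots> = gauss_binomial (Suc n) k q + q * (q_number k q * gauss_binomial (Suc n) k q)
        + q ^ Suc k * (q_number (Suc n) q * gauss_binomial n k q)"
      using Suc.IH [of k] by (simp add: q_number_Suc' [of k] algebra_simps del: gauss_binomial.simps)
    also have "\<dots> = gauss_binomial (Suc n) k q + q * (q_number (Suc n) q * gauss_binomial n j q)
        + q ^ Suc k * (q_number (Suc n) q * gauss_binomial n k q)"
      using Suc.IH [of j] by (simp only: Suc)
    also have "\<dots> = gauss_binomial (Suc n) k q + q * q_number (Suc n) q * gauss_binomial (Suc n) k q"
      by (simp add: Suc algebra_simps)
    also have "\<dots> = q_number (Suc (Suc n)) q * gauss_binomial (Suc n) k q"
      by (simp add: q_number_Suc' [of "Suc n"] algebra_simps)
    finally show ?thesis .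
  qed
qed

lemma gauss_binomial_mult_q_fact:
  fixes q :: "'a::field"
  assumes "k \<le> n"
  shows "gauss_binomial n k q * (q_fact k q * q_fact (n - k) q) = q_fact n q"
  using assms
proof (induction k arbitrary: n)
  case 0
  then show ?case by (simp add: q_fact_def)
next
  case (Suc k)
  then obtain m where n: "n = Suc m" by (cases n) auto
  have *: "q_fact (Suc j) q = q_number (Suc j) q * q_fact j q" for j
    by (simp add: q_fact_def q_number_def q_int_def prod.nat_ivl_Suc' mult.commute)
  have "gauss_binomial n (Suc k) q * (q_fact (Suc k) q * q_fact (n - Suc k) q)
     = (q_number (Suc k) q * gauss_binomial (Suc m) (Suc k) q) * (q_fact k q * q_fact (m - k) q)"
    by (simp add: n * algebra_simps del: gauss_binomial.simps(3))
  also have "\<dots> = q_number (Suc m) q * (gauss_binomial m k q * (q_fact k q * q_fact (m - k) q))"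
    by (simp add: gauss_binomial_absorb algebra_simps del: gauss_binomial.simps(3))
  also have "\<dots> = q_fact n q"
    using Suc.IH [of m] Suc.prems by (simp add: n *)
  finally show ?case .
qed

text \<open>Meant for the indeterminate in the fraction field. At a nontrivial root of unity the
  hypothesis fails, and only \<open>gauss_binomial\<close> keeps the right value.\<close>

lemma q_binomial_eq_gauss_binomial:
  fixes q :: "'a::field"
  assumes "\<And>m. m \<ge> 1 \<Longrightarrow> q_int m q \<noteq> 0"
  shows "q_binomial a b q = gauss_binomial a b q"
proof (cases "b \<le> a")
  case True
  have "q_fact m q \<noteq> 0" for m
    using assms by (simp add: q_fact_def)
  then show ?thesis
    using gauss_binomial_mult_q_fact [OF True, of q] True
    by (simp add: q_binomial_def divide_eq_eq)
next
  case False
  then show ?thesis by (simp add: q_binomial_def gauss_binomial_eq_0)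
qed

lemma to_fract_power: "to_fract (x ^ j) = to_fract x ^ j"
  by (induction j) simp_all

lemma to_fract_gauss_binomial: "to_fract (gauss_binomial a b q) = gauss_binomial a b (to_fract q)"
  by (induction a b q rule: gauss_binomial.induct) (simp_all add: to_fract_power)

lemma to_fract_q_number: "to_fract (q_number m q) = q_number m (to_fract q)"
  by (induction m) (simp_all add: q_number_Suc to_fract_power)

lemma q_number_monom_nonzero:
  assumes "m \<ge> 1" shows "q_number m [:0, 1::int:] \<noteq> 0"
proof -
  have "poly (q_number m [:0, 1::int:]) 1 = int m"
    by (simp add: q_number_def poly_sum poly_power)
  with assms show ?thesis by auto
qed

text \<open>
  With \<open>N = n - 1\<close>: absorption shows that \<open>[N]\<close> divides both \<open>[N + k + 1] A B\<close> and \<open>[k] A B\<close>,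
  and modulo \<open>[N]\<close> one has \<open>[N + k + 1] = [k + 1] = 1 + q [k]\<close>.
\<close>
lemma q_number_dvd_gauss_binomials:
  fixes q :: "'a::comm_ring_1"
  assumes "N \<ge> 1" and "k \<ge> 1"
  shows "q_number N q dvd
    gauss_binomial (3 * N) (N + k + 1) q * gauss_binomial (k - 1) (N - 1) q"
proof -
  define A where "A = gauss_binomial (3 * N) (N + k + 1) q"
  define B where "B = gauss_binomial (k - 1) (N - 1) q"
  obtain M where M: "3 * N = Suc M" using assms by (cases "3 * N") auto
  obtain N' where N': "N = Suc N'" using assms by (cases N) auto
  obtain k' where k': "k = Suc k'" using assms by (cases k) auto
  have "q_number (N + k + 1) q * A = q_number (3 * N) q * gauss_binomial M (N + k) q"
    using gauss_binomial_absorb [of "N + k" q M] by (simp add: A_def M)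
  then have 1: "q_number N q dvd q_number (N + k + 1) q * A * B"
    using q_number_dvd_mult [of N q 3] by (metis dvd_mult2)
  have "q_number k q * B = q_number N q * gauss_binomial k N q"
    using gauss_binomial_absorb [of N' q k'] by (simp add: B_def N' k')
  then have 2: "q_number N q dvd q_number k q * B * (q * A)"
    by (metis dvd_mult2 dvd_triv_left)
  have "q_number (N + k + 1) q = 1 + q * q_number k q + q ^ Suc k * q_number N q"
    using q_number_add [of "Suc k" N q] by (simp add: q_number_Suc' [of k] algebra_simps)
  then have "A * B = q_number (N + k + 1) q * A * B - q_number k q * B * (q * A)
      - q_number N q * (q ^ Suc k * A * B)"
    by (simp add: algebra_simps)
  then have "q_number N q dvd A * B"
    using 1 2 by (metis dvd_diff dvd_triv_left)
  then show ?thesis by (simp add: A_def B_def)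
qed

section \<open>The q-analogue of Lucas' theorem at a primitive root of unity\<close>

lemma primitive_root_power_mod:
  assumes "primitive_root_of_unity d w" shows "w ^ (d * a + r) = w ^ r"
  using assms by (simp add: primitive_root_of_unity_def power_add power_mult)

lemma q_number_primitive_root:
  assumes "primitive_root_of_unity d w" and "d \<ge> 2"
  shows "w \<noteq> 1" and "(w - 1) * q_number j w = w ^ j - 1"
proof -
  show "w \<noteq> 1"
    using assms unfolding primitive_root_of_unity_def
    by (metis le_refl one_le_numeral order_less_le_trans one_less_numeral_iff power_one_right semiring_norm(76))
  show "(w - 1) * q_number j w = w ^ j - 1"
    by (simp add: q_number_def power_diff_1_eq)
qed

lemma q_number_primitive_root_eq_0_iff:
  assumes "primitive_root_of_unity d w" and "d \<ge> 2"
  shows "0 < j \<Longrightarrow> j < d \<Longrightarrow> q_number j w \<noteq> 0" and "q_number d w = 0"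
  using q_number_primitive_root [OF assms] assms(1)
  unfolding primitive_root_of_unity_def
  by (metis One_nat_def Suc_leI eq_iff_diff_eq_0 mult_zero_right, metis eq_iff_diff_eq_0 mult_eq_0_iff)

text \<open>Analogue of \<open>p\<close> dividing the inner entries of row \<open>p\<close>: in the
  absorption identity \<open>[d]\<close> vanishes while \<open>[k]\<close> does not for
  \<open>0 < k < d\<close>.\<close>

lemma gauss_binomial_primitive_root_order:
  assumes "primitive_root_of_unity d w" and "d \<ge> 2"
  shows "gauss_binomial d k w = (if k = 0 \<or> k = d then 1 else 0)"
proof (cases "k = 0 \<or> k \<ge> d")
  case True
  then show ?thesis by (auto simp: gauss_binomial_eq_0)
next
  case False
  then obtain j d' where jd: "k = Suc j" "d = Suc d'" by (cases k; cases d) auto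
  have "q_number k w * gauss_binomial d k w = q_number d w * gauss_binomial d' j w"
    unfolding jd by (rule gauss_binomial_absorb)
  then show ?thesis
    using q_number_primitive_root_eq_0_iff [OF assms] False by auto
qed

text \<open>Row \<open>d\<close> has only its two outer entries left, so advancing by
  \<open>d\<close> rows acts like the factor \<open>1 + X^d\<close>. The recursion is compatible
  with this because \<open>w ^ k\<close> depends only on \<open>k\<close> modulo
  \<open>d\<close>.\<close>

lemma gauss_binomial_add_order:
  assumes "primitive_root_of_unity d w" and "d \<ge> 2"
  shows "gauss_binomial (n + d) k w =
    gauss_binomial n k w + (if k \<ge> d then gauss_binomial n (k - d) w else 0)"
proof (induction n arbitrary: k)
  case 0
  show ?case
    using gauss_binomial_primitive_root_order [OF assms, of k] assms(2)
    by (cases k) (auto simp: gauss_binomial_eq_0)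
next
  case (Suc n)
  show ?case
  proof (cases k)
    case 0
    then show ?thesis using assms(2) by simp
  next
    case (Suc j)
    have IH: "gauss_binomial (n + d) i w =
        gauss_binomial n i w + (if i \<ge> d then gauss_binomial n (i - d) w else 0)" for i
      by (rule Suc.IH)
    consider "Suc j < d" | "Suc j = d" | "j \<ge> d" by linarith
    then show ?thesis
    proof cases
      case 1
      then show ?thesis by (simp add: Suc IH)
    next
      \<comment> \<open>At \<open>k = d\<close> the shifted term comes only from the upper summand,
        where it is \<open>w ^ d\<close> times the entry at 0; \<open>w ^ d = 1\<close> makes it the
        required 1.\<close>
      case 2
      moreover have "w ^ Suc j = 1"
        using assms(1) unfolding primitive_root_of_unity_def 2 by simp
      ultimately show ?thesis
        using IH [of "Suc j"] IH [of j] gauss_binomial.simps(3) [of "n + d" j w]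
          gauss_binomial.simps(3) [of n j w]
        by (simp add: Suc gauss_binomial_eq_0 del: power_Suc gauss_binomial.simps(3))
    next
      case 3
      then obtain i where i: "j = d + i" using le_Suc_ex by blast
      have "w ^ Suc j = w ^ Suc i"
        using primitive_root_power_mod [OF assms(1), of 1 "Suc i"] i by simp
      moreover have "Suc j - d = Suc i" using i by simp
      ultimately show ?thesis
        using 3 i IH [of "Suc j"] IH [of j]
        by (simp add: Suc algebra_simps del: power_Suc)
    qed
  qed
qed

text \<open>Each advance by \<open>d\<close> rows combines the entries at \<open>k\<close> and
  \<open>k - d\<close>, which is one ordinary Pascal step in the quotients \<open>a\<close>,
  \<open>b\<close> with the remainders unchanged.\<close>

lemma gauss_binomial_lucas:
  assumes "primitive_root_of_unity d w" and "d \<ge> 2" and "r < d" and "s < d"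
  shows "gauss_binomial (d * a + r) (d * b + s) w = of_nat (a choose b) * gauss_binomial r s w"
proof (induction a arbitrary: b)
  case 0
  show ?case
    using assms by (cases b) (auto intro!: gauss_binomial_eq_0)
next
  case (Suc a)
  have eq: "d * Suc a + r = (d * a + r) + d" by simp
  show ?case
  proof (cases b)
    case 0
    then show ?thesis
      unfolding eq gauss_binomial_add_order [OF assms(1,2)]
      using Suc.IH [of 0] assms(4) by simp
  next
    case (Suc c)
    have "d * Suc c + s - d = d * c + s" "d * Suc c + s \<ge> d" by simp_all
    then show ?thesis
      unfolding eq gauss_binomial_add_order [OF assms(1,2)]
      by (simp only: Suc Suc.IH if_True) (simp add: algebra_simps)
  qed
qed

section \<open>Evaluation of integer polynomials at complex numbers\<close>

definition eval_int_poly :: "int poly \<Rightarrow> complex \<Rightarrow> complex" where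
  "eval_int_poly p w = poly (map_poly of_int p) w"

lemma eval_int_poly_pCons: "eval_int_poly (pCons a p) w = of_int a + w * eval_int_poly p w"
  by (simp add: eval_int_poly_def map_poly_pCons)

lemma eval_int_poly_0 [simp]: "eval_int_poly 0 w = 0"
  by (simp add: eval_int_poly_def)

lemma eval_int_poly_1 [simp]: "eval_int_poly 1 w = 1"
  by (simp add: eval_int_poly_def)

lemma eval_int_poly_add: "eval_int_poly (p + r) w = eval_int_poly p w + eval_int_poly r w"
  by (induction p r rule: poly_induct2) (simp_all add: eval_int_poly_pCons algebra_simps)

lemma eval_int_poly_smult: "eval_int_poly (smult a p) w = of_int a * eval_int_poly p w"
  by (induction p) (simp_all add: eval_int_poly_pCons algebra_simps)

lemma eval_int_poly_mult: "eval_int_poly (p * r) w = eval_int_poly p w * eval_int_poly r w"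
  by (induction p)
     (simp_all add: eval_int_poly_pCons eval_int_poly_add eval_int_poly_smult algebra_simps)

lemma eval_int_poly_power: "eval_int_poly (p ^ j) w = eval_int_poly p w ^ j"
  by (induction j) (simp_all add: eval_int_poly_mult)

lemma eval_int_poly_gauss_binomial:
  "eval_int_poly (gauss_binomial a b [:0, 1:]) w = gauss_binomial a b w"
proof -
  have X: "eval_int_poly [:0, 1:] w = w" by (simp add: eval_int_poly_pCons)
  show ?thesis
    by (induction a b w rule: gauss_binomial.induct)
       (simp_all add: eval_int_poly_add eval_int_poly_mult eval_int_poly_power X eval_int_poly_pCons del: mult_pCons_left)
qed

lemma eval_int_poly_q_number: "eval_int_poly (q_number m [:0, 1:]) w = q_number m w"
proof -
  have X: "eval_int_poly [:0, 1:] w = w" by (simp add: eval_int_poly_pCons)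
  show ?thesis
    by (induction m) (simp_all add: q_number_Suc eval_int_poly_add eval_int_poly_power X)
qed

text \<open>The second conclusion is free of division and therefore survives evaluation where
  q-factorials vanish; it fixes the value of \<open>c\<close> wherever \<open>[n-1]\<close> is
  nonzero.\<close>

lemma c_rat_polynomial:
  assumes "n \<ge> 2" and "k \<ge> 1"
  obtains c :: "int poly" where "to_fract c = c_rat n k"
    and "\<And>w. q_number (n - 1) w * eval_int_poly c w
          = gauss_binomial (3 * n - 3) (n + k) w * gauss_binomial (k - 1) (n - 2) w"
proof -
  define X :: "int poly" where "X = [:0, 1:]"
  have "q_number (n - 1) X dvd
    gauss_binomial (3 * (n - 1)) (n - 1 + k + 1) X * gauss_binomial (k - 1) (n - 1 - 1) X"
    using assms by (intro q_number_dvd_gauss_binomials) auto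
  moreover have "3 * (n - 1) = 3 * n - 3" "n - 1 + k + 1 = n + k" "n - 1 - 1 = n - 2"
    using assms by auto
  ultimately obtain c where
    c: "gauss_binomial (3 * n - 3) (n + k) X * gauss_binomial (k - 1) (n - 2) X
        = q_number (n - 1) X * c"
    by (auto elim: dvdE)
  have int_eq: "q_int m (to_fract X) = to_fract (q_number m X)" for m
    by (simp add: to_fract_q_number) (simp add: q_int_def q_number_def)
  have nz: "q_int m (to_fract X) \<noteq> 0" if "m \<ge> 1" for m
    using q_number_monom_nonzero [OF that] by (simp add: int_eq flip: X_def)
  have "to_fract (q_number (n - 1) X) \<noteq> 0"
    using nz [of "n - 1"] assms(1) int_eq by simp
  then have "to_fract c = c_rat n k"
    using c [THEN arg_cong, of to_fract]
    by (simp add: c_rat_def Let_def q_binomial_eq_gauss_binomial [OF nz] int_eq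
        flip: X_def to_fract_gauss_binomial)
  moreover have "q_number (n - 1) w * eval_int_poly c w
          = gauss_binomial (3 * n - 3) (n + k) w * gauss_binomial (k - 1) (n - 2) w" for w
    using c [THEN arg_cong, of "\<lambda>p. eval_int_poly p w"]
    by (simp add: eval_int_poly_mult X_def eval_int_poly_gauss_binomial eval_int_poly_q_number)
  ultimately show ?thesis using that by blast
qed

section \<open>Lagrange inversion\<close>

lemma fps_compose_mult_nth:
  fixes g T Q :: "'a::comm_ring_1 fps"
  assumes "T $ 0 = 0"
  shows "((g oo T) * Q) $ N = (\<Sum>k\<le>N. g $ k * (T ^ k * Q) $ N)"
proof -
  have "((g oo T) * Q) $ N = (\<Sum>i\<le>N. \<Sum>k\<le>i. g $ k * (T ^ k $ i) * Q $ (N - i))"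
    by (simp add: fps_mult_nth fps_compose_nth sum_distrib_right atLeast0AtMost)
  \<comment> \<open>\<open>T ^ k\<close> has no coefficient below degree \<open>k\<close>, so the
    range of \<open>k\<close> may be made independent of \<open>i\<close> before the sums are
    swapped.\<close>
  also have "\<dots> = (\<Sum>i\<le>N. \<Sum>k\<le>N. g $ k * (T ^ k $ i) * Q $ (N - i))"
    by (intro sum.cong refl sum.mono_neutral_left)
       (auto simp: startsby_zero_power_prefix [OF assms])
  also have "\<dots> = (\<Sum>k\<le>N. \<Sum>i\<le>N. g $ k * (T ^ k $ i) * Q $ (N - i))"
    by (rule sum.swap)
  also have "\<dots> = (\<Sum>k\<le>N. g $ k * (T ^ k * Q) $ N)"
    by (simp add: fps_mult_nth sum_distrib_left mult.assoc atLeast0AtMost)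
  finally show ?thesis .
qed

text \<open>With \<open>U = x/T\<close>, this coefficient is the residue of
  \<open>T'/T^(j+1)\<close>, which for \<open>j > 0\<close> is the derivative of a Laurent series.
  Without Laurent series: \<open>U T' = 1 - T U'\<close> turns it into
  \<open>[x^j] U^j - [x^(j-1)] U^(j-1) U'\<close>, and this vanishes by comparison with the
  derivative of \<open>U^j\<close>.\<close>

lemma fps_X_power_mult_deriv_nth:
  fixes T U :: "'a::field_char_0 fps"
  assumes TU: "T * U = fps_X" and T0: "T $ 0 = 0"
  shows "(U ^ Suc j * fps_deriv T) $ j = (if j = 0 then 1 else 0)"
proof -
  have "fps_deriv T * U + T * fps_deriv U = 1"
    using TU [THEN arg_cong, of fps_deriv] by (simp add: mult.commute add.commute)
  then have dT: "U * fps_deriv T = 1 - T * fps_deriv U"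
    by (simp add: algebra_simps)
  show ?thesis
  proof (cases j)
    case 0
    then show ?thesis using dT T0 by simp
  next
    case (Suc i)
    have "U ^ Suc j * fps_deriv T = U ^ j * (U * fps_deriv T)"
      by (simp add: mult_ac)
    also have "\<dots> = U ^ j - U ^ i * (T * U) * fps_deriv U"
      unfolding dT by (simp add: Suc algebra_simps)
    also have "\<dots> = U ^ j - fps_X * (U ^ i * fps_deriv U)"
      unfolding TU by (simp add: mult_ac)
    finally have eq: "U ^ Suc j * fps_deriv T = U ^ j - fps_X * (U ^ i * fps_deriv U)" .
    have "fps_deriv (U ^ j) = of_nat j * (U ^ i * fps_deriv U)"
      by (simp only: Suc fps_deriv_power' diff_Suc_1 mult_ac)
    then have "fps_deriv (U ^ j) $ i = of_nat j * (U ^ i * fps_deriv U) $ i"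
      by (metis fps_mult_of_nat_nth(1))
    then have "of_nat j * (U ^ j) $ j = of_nat j * (U ^ i * fps_deriv U) $ i"
      by (simp add: Suc del: power_Suc of_nat_Suc)
    then have "(U ^ j) $ j = (U ^ i * fps_deriv U) $ i"
      by (simp add: Suc del: power_Suc of_nat_Suc)
    then show ?thesis
      unfolding eq by (simp add: Suc)
  qed
qed

text \<open>
  By linearity only \<open>h = t\<^sup>k / \<phi>\<^sup>m\<close> has to be considered.
\<close>
theorem fps_lagrange_inversion:
  fixes T \<phi> \<psi> h :: "'a::field_char_0 fps"
  assumes TU: "T * (\<psi> oo T) = fps_X" and T0: "T $ 0 = 0" and inv: "\<phi> * \<psi> = 1"
  shows "((h oo T) * fps_deriv T) $ m = (h * \<phi> ^ Suc m) $ m"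
proof -
  \<comment> \<open>The hypothesis \<open>TU\<close> is \<open>T = x \<phi>(T)\<close> without
    division: \<open>\<psi> = 1/\<phi>\<close>, so \<open>U\<close> plays the role of
    \<open>x/T\<close>.\<close>
  define U where "U = \<psi> oo T"
  define g where "g = h * \<phi> ^ Suc m"
  have "g * \<psi> ^ Suc m = h * (\<phi> * \<psi>) ^ Suc m"
    by (simp add: g_def power_mult_distrib mult_ac del: power_Suc)
  then have h: "h = g * \<psi> ^ Suc m" by (simp add: inv)
  have "h oo T = (g oo T) * U ^ Suc m"
    unfolding h U_def by (simp add: fps_compose_mult_distrib fps_compose_power T0 del: power_Suc)
  then have "((h oo T) * fps_deriv T) $ m = ((g oo T) * (U ^ Suc m * fps_deriv T)) $ m"
    by (simp add: mult_ac)
  also have "\<dots> = (\<Sum>k\<le>m. g $ k * (T ^ k * (U ^ Suc m * fps_deriv T)) $ m)"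
    by (rule fps_compose_mult_nth) fact
  also have "\<dots> = (\<Sum>k\<le>m. g $ k * (if k = m then 1 else 0))"
  proof (intro sum.cong refl arg_cong2 [where f = "(*)"])
    fix k assume "k \<in> {..m}"
    then obtain j where j: "m = k + j" by (auto simp: le_iff_add)
    have "T ^ k * (U ^ Suc m * fps_deriv T) = (T * U) ^ k * (U ^ Suc j * fps_deriv T)"
      by (simp add: j power_add power_mult_distrib mult_ac)
    also have "T * U = fps_X" using TU by (simp add: U_def)
    finally have eq: "T ^ k * (U ^ Suc m * fps_deriv T) = fps_X ^ k * (U ^ Suc j * fps_deriv T)" .
    have "(T ^ k * (U ^ Suc m * fps_deriv T)) $ m = (U ^ Suc j * fps_deriv T) $ j"
      unfolding eq by (simp add: j fps_X_power_mult_nth del: power_Suc)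
    also have "\<dots> = (if j = 0 then 1 else 0)"
      by (rule fps_X_power_mult_deriv_nth) (use TU T0 in \<open>simp_all add: U_def\<close>)
    finally show "(T ^ k * (U ^ Suc m * fps_deriv T)) $ m = (if k = m then 1 else 0)"
      by (simp add: j)
  qed
  also have "\<dots> = g $ m" by (simp add: if_distrib [of "\<lambda>x. _ * x"] cong: if_cong)
  finally show ?thesis by (simp add: g_def)
qed

lemma one_plus_X_power_div_nth:
  fixes y :: "'a::field_char_0"
  shows "((1 + fps_X) ^ N * inverse (1 - fps_const y * fps_X) ^ Suc m) $ m
    = (\<Sum>j\<le>m. of_nat (N choose (m - j)) * of_nat ((m + j) choose j) * y ^ j)"
proof -
  have "inverse (1 - fps_const y * fps_X) ^ Suc m
      = Abs_fps (\<lambda>k. of_nat ((m + k) choose k) * y ^ k)"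
    using one_minus_const_fps_X_neg_power' [of "Suc m" y] by (simp add: fps_inverse_power del: power_Suc)
  moreover have "(1 + fps_X) ^ N $ k = (of_nat (N choose k) :: 'a)" for k
    by (simp add: binomial_gbinomial flip: fps_binomial_of_nat)
  ultimately show ?thesis
    unfolding mult.commute [of "(1 + fps_X) ^ N"] fps_mult_nth atLeast0AtMost
    by (intro sum.cong refl) (simp add: mult_ac del: power_Suc)
qed

text \<open>The coefficient of \<open>t^(m-1)\<close> in \<open>(1 + t)^N (y / (1 - y t))^m\<close>.
  In the application \<open>j\<close> is the number of edges beyond those of a spanning tree on
  \<open>m + 1\<close> vertices.\<close>

definition lagrange_sum :: "nat \<Rightarrow> nat \<Rightarrow> real \<Rightarrow> real" where
  "lagrange_sum N m y =
    (\<Sum>j<m. real (N choose (m - 1 - j)) * real ((m - 1 + j) choose j) * y ^ (m + j))"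

text \<open>The second hypothesis says \<open>h = (1 + t)^(-e)\<close>; the power of \<phi>
  contributes three factors \<open>1 + t\<close> for each exponent, of which \<open>h\<close>
  cancels \<open>e\<close>.\<close>

lemma lagrange_sum_fps:
  assumes "\<phi> = fps_const y * (1 + fps_X) ^ 3 * inverse (1 - fps_const y * fps_X)"
    and "h * (1 + fps_X) ^ e = 1" and "e \<le> 3"
  shows "(h * \<phi> ^ Suc m) $ m = lagrange_sum (3 * Suc m - e) (Suc m) y"
proof -
  have "(1 + fps_X) ^ (3 * Suc m) = ((1 + fps_X) ^ (3 * Suc m - e) * (1 + fps_X) ^ e :: real fps)"
    using assms(3) by (simp flip: power_add)
  then have "h * \<phi> ^ Suc m = fps_const (y ^ Suc m) *
    ((1 + fps_X) ^ (3 * Suc m - e) * inverse (1 - fps_const y * fps_X) ^ Suc m) * (h * (1 + fps_X) ^ e)"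
    unfolding assms(1) by (simp only: power_mult_distrib power_mult [symmetric] fps_const_power mult_ac)
  then have "(h * \<phi> ^ Suc m) $ m = y ^ Suc m * 
      ((1 + fps_X) ^ (3 * Suc m - e) * inverse (1 - fps_const y * fps_X) ^ Suc m) $ m"
    by (simp only: assms(2) mult_1_right fps_mult_left_const_nth)
  also have "\<dots> = lagrange_sum (3 * Suc m - e) (Suc m) y"
    unfolding one_plus_X_power_div_nth lagrange_sum_def sum_distrib_left lessThan_Suc_atMost
    by (intro sum.cong refl) (simp add: power_add)
  finally show ?thesis .
qed

text \<open>The three left-hand sides are coefficients of \<open>T'\<close>, \<open>R'\<close> and
  \<open>R' C\<close> with \<open>C = 1 + T\<close>, that is, of \<open>T'/C^e\<close> with
  \<open>e = 0, 2, 1\<close>, so one inversion with \<open>h = (1 + t)^(-e)\<close> serves all of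
  them. Positivity of \<open>y\<close> makes \<phi> invertible.\<close>

lemma connected_rooted_recurrence_solution:
  fixes c r :: "nat \<Rightarrow> real"
  assumes y: "y > 0" and c0: "c 0 = 1" and r0: "r 0 = 0"
    and c_rec: "\<And>s. s \<ge> 1 \<Longrightarrow> c s = (\<Sum>l=1..s. r l * c (s - l))"
    and r_rec: "\<And>s. s \<ge> 1 \<Longrightarrow> r s = y * (c s - r s) + y * (\<Sum>i<s. c i * c (s - 1 - i))"
    and m: "m \<ge> 1"
  shows "real m * c m = lagrange_sum (3 * m) m y"
    and "real m * r m = lagrange_sum (3 * m - 2) m y"
    and "(\<Sum>l=1..m. real l * r l * c (m - l)) = lagrange_sum (3 * m - 1) m y"
proof -
  define C where "C = Abs_fps c"
  define R where "R = Abs_fps r"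
  define T where "T = C - 1"
  have T0: "T $ 0 = 0" by (simp add: T_def C_def c0)
  have C_eq: "C = 1 + R * C"
  proof (rule fps_ext)
    fix s show "C $ s = (1 + R * C) $ s"
    proof (cases s)
      case 0
      then show ?thesis by (simp add: C_def R_def c0 r0)
    next
      case (Suc s')
      have "(\<Sum>l=0..s. r l * c (s - l)) = (\<Sum>l=1..s. r l * c (s - l))"
        by (simp add: sum.atLeast_Suc_atMost r0)
      then show ?thesis using c_rec [of s] by (simp add: C_def R_def fps_mult_nth Suc)
    qed
  qed
  have R_eq: "R = fps_const y * (T - R) + fps_const y * fps_X * C ^ 2"
  proof (rule fps_ext)
    fix s show "R $ s = (fps_const y * (T - R) + fps_const y * fps_X * C ^ 2) $ s"
    proof (cases s)
      case 0
      then show ?thesis by (simp add: T_def C_def R_def c0 r0)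
    next
      case (Suc s')
      have "(C ^ 2) $ s' = (\<Sum>i<s. c i * c (s - 1 - i))"
        by (simp add: power2_eq_square fps_mult_nth C_def Suc lessThan_Suc_atMost atLeast0AtMost)
      then show ?thesis using r_rec [of s] Suc
        by (simp add: T_def C_def R_def mult.assoc)
    qed
  qed
  have C: "C = 1 + T" by (simp add: T_def)
  have Ci: "C * inverse C = 1"
    using c0 by (simp add: C_def inverse_mult_eq_1')
  have RC: "R * C = T" using C_eq C by (simp add: algebra_simps)
  have "C * R = C * (fps_const y * (T - R) + fps_const y * fps_X * C ^ 2)"
    using R_eq by simp
  also have "\<dots> = fps_const y * (C * T - R * C) + fps_const y * fps_X * C ^ 3"
    by (simp add: algebra_simps power2_eq_square power3_eq_cube)
  finally have "T = fps_const y * (C * T - T) + fps_const y * fps_X * C ^ 3"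
    using RC by (simp add: mult.commute)
  \<comment> \<open>This is \<open>T = x \<phi>(T)\<close> with the denominator
    \<open>1 - y T\<close> cleared.\<close>
  then have fun_eq: "T * (1 - fps_const y * T) = fps_X * (fps_const y * C ^ 3)"
    by (simp add: C algebra_simps)
  define L where "L = 1 - fps_const y * (fps_X :: real fps)"
  define \<phi> where "\<phi> = fps_const y * (1 + fps_X) ^ 3 * inverse L"
  define \<psi> where "\<psi> = fps_const (inverse y) * inverse (1 + fps_X) ^ 3 * L"
  define J where "J = (inverse (1 + fps_X) :: real fps)"
  have L: "L * inverse L = 1" by (simp add: L_def inverse_mult_eq_1')
  have J: "J * (1 + fps_X) = 1" by (simp add: J_def inverse_mult_eq_1)
  have yy: "fps_const y * fps_const (inverse y) = 1" using y by simp
  have inv: "\<phi> * \<psi> = 1"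
  proof -
    have "\<phi> * \<psi> = (fps_const y * fps_const (inverse y)) * (J * (1 + fps_X)) ^ 3 * (L * inverse L)"
      by (simp only: \<phi>_def \<psi>_def J_def power_mult_distrib mult_ac)
    then show ?thesis by (simp only: L J yy) simp
  qed
  have X_comp: "(1 + fps_X) oo T = C"
    by (simp add: fps_compose_add_distrib C T0)
  have "(J oo T) * ((1 + fps_X) oo T) = 1"
    using J by (simp add: T0 flip: fps_compose_mult_distrib)
  then have "(J oo T) * (C * inverse C) = inverse C"
    by (simp add: X_comp mult.assoc [symmetric])
  then have J_comp: "J oo T = inverse C" by (simp add: Ci)
  have L_comp: "L oo T = 1 - fps_const y * T"
    by (simp add: L_def fps_compose_sub_distrib fps_compose_mult_distrib T0)
  have TU: "T * (\<psi> oo T) = fps_X"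
  proof -
    have "T * (\<psi> oo T) = fps_const (inverse y) * inverse C ^ 3 * (T * (1 - fps_const y * T))"
      using J_comp
      by (simp add: \<psi>_def J_def fps_compose_mult_distrib fps_compose_power [symmetric] T0 L_comp mult_ac)
    also have "\<dots> = fps_X * (fps_const y * fps_const (inverse y)) * (C * inverse C) ^ 3"
      unfolding fun_eq by (simp only: power_mult_distrib mult_ac)
    finally show ?thesis by (simp only: Ci yy) simp
  qed
  have dC: "fps_deriv C = fps_deriv T" by (simp add: T_def)
  \<comment> \<open>Quotient-free differentiation of \<open>R = T/C\<close>; the aim is
    \<open>R' C^2 = T'\<close>.\<close>
  have "fps_deriv R * C + R * fps_deriv T = fps_deriv T"
    using RC [THEN arg_cong, of fps_deriv] dC by (simp add: algebra_simps)
  then have "(fps_deriv R * C + R * fps_deriv T) * C = fps_deriv T * C" by simp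
  then have "fps_deriv R * C * C = fps_deriv T * C - (R * C) * fps_deriv T"
    by (simp add: algebra_simps)
  also have "\<dots> = fps_deriv T" unfolding RC by (simp add: C algebra_simps)
  finally have dR: "fps_deriv R * C * C = fps_deriv T" .
  have "inverse C * fps_deriv T = fps_deriv R * C * (C * inverse C)"
    by (simp add: dR [symmetric] mult_ac)
  then have dRC: "inverse C * fps_deriv T = fps_deriv R * C" by (simp add: Ci)
  have "inverse C ^ 2 * fps_deriv T = fps_deriv R * (C * inverse C)"
    using dRC by (simp add: power2_eq_square mult_ac)
  then have dR': "inverse C ^ 2 * fps_deriv T = fps_deriv R" by (simp add: Ci)
  obtain m' where m': "m = Suc m'" using m by (cases m) auto
  note \<phi>' = \<phi>_def [unfolded L_def]
  note lagr = fps_lagrange_inversion [OF TU T0 inv, where m = m']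
  show "real m * c m = lagrange_sum (3 * m) m y"
    using lagr [of 1] lagrange_sum_fps [OF \<phi>', of 1 0 m']
    by (simp add: m' T_def C_def del: power_Suc)
  have "(J\<^sup>2 oo T) = inverse C ^ 2" by (simp add: fps_compose_power [symmetric] T0 J_comp)
  moreover have "J\<^sup>2 * (1 + fps_X)\<^sup>2 = 1" using J by (simp flip: power_mult_distrib)
  ultimately show "real m * r m = lagrange_sum (3 * m - 2) m y"
    using lagr [of "J\<^sup>2"] lagrange_sum_fps [OF \<phi>', of "J\<^sup>2" 2 m']
    by (simp add: m' dR' R_def del: power_Suc)
  have "(\<Sum>l=1..m. real l * r l * c (m - l)) = (fps_deriv R * C) $ m'"
    by (simp add: m' fps_mult_nth R_def C_def sum.atLeast1_atMost_eq atLeast0AtMost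
        lessThan_Suc_atMost del: sum.lessThan_Suc sum.cl_ivl_Suc)
  then show "(\<Sum>l=1..m. real l * r l * c (m - l)) = lagrange_sum (3 * m - 1) m y"
    using lagr [of J] lagrange_sum_fps [OF \<phi>', of J 1 m'] J
    by (simp add: m' dRC J_comp del: power_Suc)
qed

section \<open>Connected non-crossing sets of arcs\<close>

text \<open>
  An edge with end points \<open>u < v\<close> on the integer line is the pair \<open>(u, v)\<close>. Connectedness is
  expressed by two-colourings: a graph is connected iff every colouring that is constant on its edges
  is constant.
\<close>

definition arc_pairs :: "int \<Rightarrow> int \<Rightarrow> (int \<times> int) set" where
  "arc_pairs a b = {(u, v). a \<le> u \<and> u < v \<and> v \<le> b}"

definition noncrossing_arcs :: "(int \<times> int) set \<Rightarrow> bool" where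
  "noncrossing_arcs A \<longleftrightarrow> (\<forall>u v x y. (u, v) \<in> A \<longrightarrow> (x, y) \<in> A \<longrightarrow> \<not> (u < x \<and> x < v \<and> v < y))"

definition constant_on_arcs :: "(int \<Rightarrow> bool) \<Rightarrow> (int \<times> int) set \<Rightarrow> bool" where
  "constant_on_arcs f A \<longleftrightarrow> (\<forall>u v. (u, v) \<in> A \<longrightarrow> f u = f v)"

definition connected_arcs :: "int \<Rightarrow> int \<Rightarrow> (int \<times> int) set \<Rightarrow> bool" where
  "connected_arcs a b A \<longleftrightarrow> (\<forall>f. constant_on_arcs f A \<longrightarrow> (\<forall>w. a \<le> w \<and> w \<le> b \<longrightarrow> f w = f a))"

definition arc_graphs :: "int \<Rightarrow> int \<Rightarrow> (int \<times> int) set set" where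
  "arc_graphs a b = {A. A \<subseteq> arc_pairs a b \<and> noncrossing_arcs A \<and> connected_arcs a b A}"

definition rooted_arc_graphs :: "int \<Rightarrow> int \<Rightarrow> (int \<times> int) set set" where
  "rooted_arc_graphs a b = {A \<in> arc_graphs a b. (a, b) \<in> A}"

text \<open>\<open>Max\<close> is meaningful only if \<open>a\<close> has a neighbour to its right;
  \<open>reach_props\<close> guarantees this for connected graphs on more than one vertex.\<close>

definition reach :: "int \<Rightarrow> (int \<times> int) set \<Rightarrow> int" where
  "reach a A = Max {v. (a, v) \<in> A}"

lemma arc_pairs_iff [simp]: "(u, v) \<in> arc_pairs a b \<longleftrightarrow> a \<le> u \<and> u < v \<and> v \<le> b"
  by (simp add: arc_pairs_def)

lemma finite_arc_pairs [simp]: "finite (arc_pairs a b)"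
  by (rule finite_subset [of _ "{a..b} \<times> {a..b}"]) auto

lemma finite_arc_graphs [simp]: "finite (arc_graphs a b)"
  by (rule finite_subset [of _ "Pow (arc_pairs a b)"]) (auto simp: arc_graphs_def)

lemma finite_rooted_arc_graphs [simp]: "finite (rooted_arc_graphs a b)"
  by (simp add: rooted_arc_graphs_def)

lemma arc_graphs_finite: "A \<in> arc_graphs a b \<Longrightarrow> finite A"
  by (auto simp: arc_graphs_def intro: finite_subset [OF _ finite_arc_pairs])

lemma arc_graphs_arcD: "A \<in> arc_graphs a b \<Longrightarrow> (u, v) \<in> A \<Longrightarrow> a \<le> u \<and> u < v \<and> v \<le> b"
  by (auto simp: arc_graphs_def)

lemma arc_graphs_sub: "A \<in> arc_graphs a b \<Longrightarrow> A \<subseteq> arc_pairs a b"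
  by (simp add: arc_graphs_def)

lemma arc_pairs_disjoint: "l \<le> l' \<Longrightarrow> arc_pairs a l \<inter> arc_pairs l' b = {}"
  by (auto simp: arc_pairs_def)

lemma arc_pairs_mono: "a' \<le> a \<Longrightarrow> b \<le> b' \<Longrightarrow> arc_pairs a b \<subseteq> arc_pairs a' b'"
  by (auto simp: arc_pairs_def)

text \<open>Arcs in intervals that share at most an end point cannot coincide, so both parts can be
  read off from the union. The case \<open>l = l'\<close> is gluing at a vertex;
  \<open>l' = l + 1\<close> is the case of two separate components.\<close>

lemma arc_graphs_Un_Int:
  assumes "A \<in> arc_graphs a l" and "B \<in> arc_graphs l' b" and "l \<le> l'"
  shows "(A \<union> B) \<inter> arc_pairs a l = A" and "(A \<union> B) \<inter> arc_pairs l' b = B" and "A \<inter> B = {}"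
  using arc_graphs_sub [OF assms(1)] arc_graphs_sub [OF assms(2)] arc_pairs_disjoint [OF assms(3), of a b] by blast+

lemma noncrossing_arcsD: "noncrossing_arcs A \<Longrightarrow> (u, v) \<in> A \<Longrightarrow> (x, y) \<in> A \<Longrightarrow> u < x \<Longrightarrow> x < v \<Longrightarrow> v < y \<Longrightarrow> False"
  by (auto simp: noncrossing_arcs_def)

lemma noncrossing_arcs_mono: "noncrossing_arcs A \<Longrightarrow> B \<subseteq> A \<Longrightarrow> noncrossing_arcs B"
  unfolding noncrossing_arcs_def by blast

lemma noncrossing_arcs_Un:
  assumes "noncrossing_arcs A" and "noncrossing_arcs B" and "A \<subseteq> arc_pairs a l" and "B \<subseteq> arc_pairs l' b" and "l \<le> l'"
  shows "noncrossing_arcs (A \<union> B)"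
  unfolding noncrossing_arcs_def
proof (intro allI impI notI)
  fix u v x y
  assume uv: "(u, v) \<in> A \<union> B" and xy: "(x, y) \<in> A \<union> B" and *: "u < x \<and> x < v \<and> v < y"
  have A: "p < q \<and> q \<le> l" if "(p, q) \<in> A" for p q using that assms(3) by auto
  have B: "p < q \<and> l' \<le> p" if "(p, q) \<in> B" for p q using that assms(4) by auto
  from uv xy consider "(u, v) \<in> A" "(x, y) \<in> A" | "(u, v) \<in> A" "(x, y) \<in> B"
    | "(u, v) \<in> B" "(x, y) \<in> A" | "(u, v) \<in> B" "(x, y) \<in> B" by blast
  then show False
  proof cases
    case 1 then show ?thesis using noncrossing_arcsD [OF assms(1)] * by blast
  next
    case 2 then show ?thesis using A [of u v] B [of x y] * assms(5) by linarith
  next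
    case 3 then show ?thesis using B [of u v] A [of x y] * assms(5) by linarith
  next
    case 4 then show ?thesis using noncrossing_arcsD [OF assms(2)] * by blast
  qed
qed

lemma noncrossing_arcs_insert_top_arc:
  assumes "noncrossing_arcs A" and "A \<subseteq> arc_pairs a b"
  shows "noncrossing_arcs (insert (a, b) A)"
  unfolding noncrossing_arcs_def
proof (intro allI impI notI)
  fix u v x y
  assume uv: "(u, v) \<in> insert (a, b) A" and xy: "(x, y) \<in> insert (a, b) A"
    and *: "u < x \<and> x < v \<and> v < y"
  have A: "p < q \<and> a \<le> p \<and> q \<le> b" if "(p, q) \<in> A" for p q using that assms(2) by auto
  from uv xy consider "(u, v) \<in> A" "(x, y) \<in> A" | "u = a" "v = b" "(x, y) \<in> insert (a, b) A"
    | "(u, v) \<in> A" "x = a" "y = b" by blast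
  then show False
  proof cases
    case 1 then show ?thesis using noncrossing_arcsD [OF assms(1)] * by blast
  next
    case 2 then show ?thesis using A [of x y] * by auto
  next
    case 3 then show ?thesis using A [of u v] * by auto
  qed
qed

section \<open>Connectedness under cutting and gluing\<close>

lemma connected_arcsD: "connected_arcs a b A \<Longrightarrow> constant_on_arcs f A \<Longrightarrow> a \<le> w \<Longrightarrow> w \<le> b \<Longrightarrow> f w = f a"
  by (simp add: connected_arcs_def)

lemma constant_on_arcs_Un [simp]: "constant_on_arcs f (A \<union> B) \<longleftrightarrow> constant_on_arcs f A \<and> constant_on_arcs f B"
  by (auto simp: constant_on_arcs_def)

lemma constant_on_arcs_mono: "constant_on_arcs f B \<Longrightarrow> A \<subseteq> B \<Longrightarrow> constant_on_arcs f A"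
  unfolding constant_on_arcs_def by blast

lemma connected_arcs_mono: "connected_arcs a b A \<Longrightarrow> A \<subseteq> B \<Longrightarrow> connected_arcs a b B"
  unfolding connected_arcs_def
proof (intro allI impI)
  fix f w
  assume conn: "\<forall>f. constant_on_arcs f A \<longrightarrow> (\<forall>w. a \<le> w \<and> w \<le> b \<longrightarrow> f w = f a)"
    and "A \<subseteq> B" and f: "constant_on_arcs f B" and w: "a \<le> w \<and> w \<le> b"
  have "constant_on_arcs f A" by (rule constant_on_arcs_mono) fact+
  then show "f w = f a" using conn [rule_format, of f w] w by simp
qed

lemma connected_arcs_glue:
  assumes "connected_arcs a l A" and "connected_arcs l b B" and "a \<le> l" and "l \<le> b"
  shows "connected_arcs a b (A \<union> B)"
  unfolding connected_arcs_def
proof (intro allI impI)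
  fix f w assume "constant_on_arcs f (A \<union> B)" and w: "a \<le> w \<and> w \<le> b"
  then have f: "constant_on_arcs f A" "constant_on_arcs f B" by auto
  show "f w = f a"
  proof (cases "w \<le> l")
    case True
    then show ?thesis using connected_arcsD [OF assms(1) f(1), of w] w by simp
  next
    case False
    then show ?thesis
      using connected_arcsD [OF assms(1) f(1), of l] connected_arcsD [OF assms(2) f(2), of w] w assms(3) by simp
  qed
qed

text \<open>A colouring of one side is extended by collapsing the other side to the cut vertex
  \<open>l\<close> (through \<open>min\<close> or \<open>max\<close>). No arc passes over
  \<open>l\<close>, so every arc is either kept or collapsed to a point.\<close>

lemma connected_arcs_restrict:
  assumes A: "A \<subseteq> arc_pairs a b" and conn: "connected_arcs a b A" and l: "a \<le> l" "l \<le> b"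
    and cut: "\<And>u v. (u, v) \<in> A \<Longrightarrow> v \<le> l \<or> l \<le> u"
  shows "connected_arcs a l (A \<inter> arc_pairs a l)" and "connected_arcs l b (A \<inter> arc_pairs l b)"
proof -
  show "connected_arcs a l (A \<inter> arc_pairs a l)"
    unfolding connected_arcs_def
  proof (intro allI impI)
    fix f w assume f: "constant_on_arcs f (A \<inter> arc_pairs a l)" and w: "a \<le> w \<and> w \<le> l"
    have "constant_on_arcs (\<lambda>w. f (min w l)) A"
      unfolding constant_on_arcs_def
    proof (intro allI impI)
      fix u v assume uv: "(u, v) \<in> A"
      then have "a \<le> u" "u < v" using A by auto
      consider "v \<le> l" | "l \<le> u" using cut [OF uv] by auto
      then show "f (min u l) = f (min v l)"
      proof cases
        case 1
        then have "f u = f v"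
          using f uv \<open>a \<le> u\<close> \<open>u < v\<close> by (simp add: constant_on_arcs_def)
        then show ?thesis using 1 \<open>u < v\<close> by (simp add: min_def)
      qed (use \<open>u < v\<close> in \<open>simp add: min_def\<close>)
    qed
    from connected_arcsD [OF conn this, of w] w l show "f w = f a" by (simp add: min_def split: if_splits)
  qed
  show "connected_arcs l b (A \<inter> arc_pairs l b)"
    unfolding connected_arcs_def
  proof (intro allI impI)
    fix f w assume f: "constant_on_arcs f (A \<inter> arc_pairs l b)" and w: "l \<le> w \<and> w \<le> b"
    have "constant_on_arcs (\<lambda>w. f (max w l)) A"
      unfolding constant_on_arcs_def
    proof (intro allI impI)
      fix u v assume uv: "(u, v) \<in> A"
      then have "v \<le> b" "u < v" using A by auto
      consider "v \<le> l" | "l \<le> u" using cut [OF uv] by auto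
      then show "f (max u l) = f (max v l)"
      proof cases
        case 2
        then have "f u = f v"
          using f uv \<open>v \<le> b\<close> \<open>u < v\<close> by (simp add: constant_on_arcs_def)
        then show ?thesis using 2 \<open>u < v\<close> by (simp add: max_def)
      qed (use \<open>u < v\<close> in \<open>simp add: max_def\<close>)
    qed
    from connected_arcsD [OF conn this, of w] w l show "f w = f l" by (simp add: max_def split: if_splits)
  qed
qed

lemma arc_graphs_restrict:
  assumes A: "A \<in> arc_graphs a b" and l: "a \<le> l" "l \<le> b"
    and cut: "\<And>u v. (u, v) \<in> A \<Longrightarrow> v \<le> l \<or> l \<le> u"
  shows "A \<inter> arc_pairs a l \<in> arc_graphs a l" and "A \<inter> arc_pairs l b \<in> arc_graphs l b"
    and "A = (A \<inter> arc_pairs a l) \<union> (A \<inter> arc_pairs l b)"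
proof -
  from A have *: "A \<subseteq> arc_pairs a b" "noncrossing_arcs A" "connected_arcs a b A" by (auto simp: arc_graphs_def)
  show "A \<inter> arc_pairs a l \<in> arc_graphs a l"
    using connected_arcs_restrict(1) [OF *(1,3) l cut] noncrossing_arcs_mono [OF *(2)] by (auto simp: arc_graphs_def)
  show "A \<inter> arc_pairs l b \<in> arc_graphs l b"
    using connected_arcs_restrict(2) [OF *(1,3) l cut] noncrossing_arcs_mono [OF *(2)] by (auto simp: arc_graphs_def)
  show "A = (A \<inter> arc_pairs a l) \<union> (A \<inter> arc_pairs l b)"
  proof (rule equalityI)
    show "A \<subseteq> A \<inter> arc_pairs a l \<union> A \<inter> arc_pairs l b"
    proof
      fix e assume e: "e \<in> A"
      then have "a \<le> fst e" "fst e < snd e" "snd e \<le> b" using arc_graphs_arcD [OF A, of "fst e" "snd e"] by auto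
      then show "e \<in> A \<inter> arc_pairs a l \<union> A \<inter> arc_pairs l b"
        using e cut [of "fst e" "snd e"] by (cases e) auto
    qed
  qed blast
qed

lemma arc_graphs_glue:
  assumes "A \<in> arc_graphs a l" and "B \<in> arc_graphs l b" and "a \<le> l" and "l \<le> b"
  shows "A \<union> B \<in> arc_graphs a b"
proof -
  have "noncrossing_arcs (A \<union> B)"
    using assms by (intro noncrossing_arcs_Un [of A B a l l b]) (auto simp: arc_graphs_def)
  moreover have "A \<union> B \<subseteq> arc_pairs a b"
    using arc_graphs_sub [OF assms(1)] arc_graphs_sub [OF assms(2)] arc_pairs_mono [of a a l b]
      arc_pairs_mono [of a l b b] assms(3,4) by blast
  moreover have "connected_arcs a b (A \<union> B)"
    using assms by (auto simp: arc_graphs_def intro: connected_arcs_glue)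
  ultimately show ?thesis by (simp add: arc_graphs_def)
qed

lemma finite_neighbours: "A \<in> arc_graphs a b \<Longrightarrow> finite {v. (c, v) \<in> A}"
  by (rule finite_subset [of _ "snd ` A"]) (force simp: arc_graphs_finite)+

text \<open>If \<open>a\<close> had no neighbour, the colouring that singles out \<open>a\<close>
  would refute connectedness. An arc passing over the farthest neighbour would either start at
  \<open>a\<close>, against maximality, or cross the arc from \<open>a\<close> to that
  neighbour.\<close>

lemma reach_props:
  assumes A: "A \<in> arc_graphs a b" and "a < b"
  shows "(a, reach a A) \<in> A" and "a < reach a A" and "reach a A \<le> b"
    and "\<And>u v. (u, v) \<in> A \<Longrightarrow> v \<le> reach a A \<or> reach a A \<le> u"
proof -
  have ne: "{v. (a, v) \<in> A} \<noteq> {}"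
  proof
    assume "{v. (a, v) \<in> A} = {}"
    then have "constant_on_arcs (\<lambda>w. w = a) A"
      using arc_graphs_arcD [OF A] unfolding constant_on_arcs_def
      by (metis (mono_tags, lifting) empty_iff linorder_not_less mem_Collect_eq)
    then have "(b = a) = (a = a)"
      using A \<open>a < b\<close> connected_arcsD [of a b A "\<lambda>w. w = a" b] by (auto simp: arc_graphs_def)
    then show False using \<open>a < b\<close> by simp
  qed
  show 1: "(a, reach a A) \<in> A"
    using Max_in [OF finite_neighbours [OF A] ne] by (simp add: reach_def)
  then show "a < reach a A" and "reach a A \<le> b"
    using arc_graphs_arcD [OF A] by blast+
  fix u v assume uv: "(u, v) \<in> A"
  show "v \<le> reach a A \<or> reach a A \<le> u"
  proof (cases "u = a")
    case True
    then show ?thesis using uv Max_ge [OF finite_neighbours [OF A], of v a] by (simp add: reach_def)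
  next
    case False
    then have "a < u" using arc_graphs_arcD [OF A uv] by simp
    moreover have "noncrossing_arcs A" using A by (simp add: arc_graphs_def)
    ultimately show ?thesis using noncrossing_arcsD [OF _ 1 uv] by (meson linorder_not_less)
  qed
qed

lemma reach_ge: "A \<in> arc_graphs a b \<Longrightarrow> (a, v) \<in> A \<Longrightarrow> v \<le> reach a A"
  by (simp add: reach_def finite_neighbours)

lemma reach_Un:
  assumes "A \<in> rooted_arc_graphs a l" and "B \<in> arc_graphs l b" and "a < l"
  shows "reach a (A \<union> B) = l"
  unfolding reach_def
proof (rule Max_eqI)
  have A: "A \<in> arc_graphs a l" using assms by (simp add: rooted_arc_graphs_def)
  show "finite {v. (a, v) \<in> A \<union> B}"
    using finite_neighbours [OF A, of a] finite_neighbours [OF assms(2), of a]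
    by (simp add: Collect_disj_eq)
  show "v \<le> l" if "v \<in> {v. (a, v) \<in> A \<union> B}" for v
    using that arc_graphs_arcD [OF A] arc_graphs_arcD [OF assms(2)] assms(3) by fastforce
  show "l \<in> {v. (a, v) \<in> A \<union> B}" using assms by (simp add: rooted_arc_graphs_def)
qed

text \<open>The combinatorial form of \<open>T = R (1 + T)\<close>: nothing passes over the farthest
  neighbour \<open>l\<close>, so the graph falls into a part containing \<open>(a, l)\<close> and a
  part from \<open>l\<close> on, which is a single vertex if \<open>l = b\<close>.\<close>

lemma bij_betw_split_at_reach:
  assumes "a < b"
  shows "bij_betw (\<lambda>(l, A, B). A \<union> B) (SIGMA l:{a<..b}. rooted_arc_graphs a l \<times> arc_graphs l b) (arc_graphs a b)"
proof (rule bij_betw_byWitness [where f' =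
    "\<lambda>A. (reach a A, A \<inter> arc_pairs a (reach a A), A \<inter> arc_pairs (reach a A) b)"])
  show "\<forall>p\<in>SIGMA l:{a<..b}. rooted_arc_graphs a l \<times> arc_graphs l b.
      (\<lambda>A. (reach a A, A \<inter> arc_pairs a (reach a A), A \<inter> arc_pairs (reach a A) b))
        ((\<lambda>(l, A, B). A \<union> B) p) = p"
  proof clarsimp
    fix l A B assume *: "a < l" "l \<le> b" "A \<in> rooted_arc_graphs a l" "B \<in> arc_graphs l b"
    then have A: "A \<in> arc_graphs a l" by (simp add: rooted_arc_graphs_def)
    have "(A \<union> B) \<inter> arc_pairs a l = A" "(A \<union> B) \<inter> arc_pairs l b = B"
      using arc_graphs_Un_Int [OF A *(4)] by auto
    then show "reach a (A \<union> B) = l \<and>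
        (A \<union> B) \<inter> arc_pairs a (reach a (A \<union> B)) = A \<and> (A \<union> B) \<inter> arc_pairs (reach a (A \<union> B)) b = B"
      using reach_Un [OF *(3,4,1)] by simp
  qed
  show "\<forall>A\<in>arc_graphs a b. (\<lambda>(l, A, B). A \<union> B)
      (reach a A, A \<inter> arc_pairs a (reach a A), A \<inter> arc_pairs (reach a A) b) = A"
  proof
    fix A assume A: "A \<in> arc_graphs a b"
    note r = reach_props [OF A \<open>a < b\<close>]
    show "(\<lambda>(l, A, B). A \<union> B)
      (reach a A, A \<inter> arc_pairs a (reach a A), A \<inter> arc_pairs (reach a A) b) = A"
      using arc_graphs_restrict(3) [OF A _ r(3,4)] r(2) by simp
  qed
  show "(\<lambda>(l, A, B). A \<union> B) ` (SIGMA l:{a<..b}. rooted_arc_graphs a l \<times> arc_graphs l b) \<subseteq> arc_graphs a b"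
    by (auto simp: rooted_arc_graphs_def intro!: arc_graphs_glue)
  show "(\<lambda>A. (reach a A, A \<inter> arc_pairs a (reach a A), A \<inter> arc_pairs (reach a A) b)) ` arc_graphs a b
      \<subseteq> (SIGMA l:{a<..b}. rooted_arc_graphs a l \<times> arc_graphs l b)"
  proof (rule image_subsetI)
    fix A assume A: "A \<in> arc_graphs a b"
    note r = reach_props [OF A \<open>a < b\<close>]
    show "(reach a A, A \<inter> arc_pairs a (reach a A), A \<inter> arc_pairs (reach a A) b)
        \<in> (SIGMA l:{a<..b}. rooted_arc_graphs a l \<times> arc_graphs l b)"
      using arc_graphs_restrict(1,2) [OF A _ r(3,4)] r(1,2,3) by (simp add: rooted_arc_graphs_def)
  qed
qed

lemma card_Un_arcs:
  assumes "A \<in> arc_graphs a l" and "B \<in> arc_graphs l' b" and "l \<le> l'"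
  shows "card (A \<union> B) = card A + card B"
proof (rule card_Un_disjoint)
  show "A \<inter> B = {}" by (rule arc_graphs_Un_Int [OF assms])
qed (use assms in \<open>auto simp: arc_graphs_finite\<close>)

lemma sum_arc_graphs_split_at_reach:
  fixes F :: "int \<Rightarrow> (int \<times> int) set \<Rightarrow> real"
  assumes "a < b"
  shows "(\<Sum>A\<in>arc_graphs a b. F (reach a A) A) = (\<Sum>l\<in>{a<..b}. \<Sum>A\<in>rooted_arc_graphs a l. \<Sum>B\<in>arc_graphs l b. F l (A \<union> B))"
proof -
  have "(\<Sum>A\<in>arc_graphs a b. F (reach a A) A)
      = (\<Sum>p\<in>(SIGMA l:{a<..b}. rooted_arc_graphs a l \<times> arc_graphs l b). case p of (l, A, B) \<Rightarrow> F (reach a (A \<union> B)) (A \<union> B))"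
    using sum.reindex_bij_betw [OF bij_betw_split_at_reach [OF assms], of "\<lambda>A. F (reach a A) A"]
    by (simp add: case_prod_unfold)
  also have "\<dots> = (\<Sum>p\<in>(SIGMA l:{a<..b}. rooted_arc_graphs a l \<times> arc_graphs l b). case p of (l, A, B) \<Rightarrow> F l (A \<union> B))"
    by (rule sum.cong) (auto simp: reach_Un)
  also have "\<dots> = (\<Sum>l\<in>{a<..b}. \<Sum>p\<in>rooted_arc_graphs a l \<times> arc_graphs l b. case p of (A, B) \<Rightarrow> F l (A \<union> B))"
    by (subst sum.Sigma) (auto simp: case_prod_unfold)
  also have "\<dots> = (\<Sum>l\<in>{a<..b}. \<Sum>A\<in>rooted_arc_graphs a l. \<Sum>B\<in>arc_graphs l b. F l (A \<union> B))"
    by (simp add: sum.cartesian_product)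
  finally show ?thesis .
qed

lemma insert_top_arc_rooted_arc_graphs:
  assumes "A \<in> arc_graphs a b" and "a < b"
  shows "insert (a, b) A \<in> rooted_arc_graphs a b"
proof -
  have "noncrossing_arcs (insert (a, b) A)"
    using assms by (auto simp: arc_graphs_def intro: noncrossing_arcs_insert_top_arc)
  moreover have "connected_arcs a b (insert (a, b) A)"
    using assms by (auto simp: arc_graphs_def intro: connected_arcs_mono)
  ultimately show ?thesis using assms by (auto simp: rooted_arc_graphs_def arc_graphs_def)
qed

text \<open>
  If every gap were covered, the longest arcs seen from outside would form a path from \<open>a\<close> to \<open>b\<close>.
\<close>
lemma uncovered_gap:
  assumes A: "A \<in> rooted_arc_graphs a b" and nconn: "\<not> connected_arcs a b (A - {(a, b)})" and "a < b"
  obtains i where "a \<le> i" and "i < b" and "\<And>u v. (u, v) \<in> A - {(a, b)} \<Longrightarrow> v \<le> i \<or> i < u"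
proof (rule ccontr)
  note gap = that
  assume "\<not> thesis"
  then have cov: "\<exists>u v. (u, v) \<in> A - {(a, b)} \<and> u \<le> i \<and> i < v" if "a \<le> i" "i < b" for i
    using gap [OF that] by (meson linorder_not_less)
  define A' where "A' = A - {(a, b)}"
  have AC: "A \<in> arc_graphs a b" using A by (simp add: rooted_arc_graphs_def)
  have A'sub: "A' \<subseteq> A" by (auto simp: A'_def)
  have nc': "noncrossing_arcs A'" using AC A'sub by (auto simp: arc_graphs_def intro: noncrossing_arcs_mono)
  have arcs: "a \<le> u \<and> u < v \<and> v \<le> b" if "(u, v) \<in> A'" for u v
    using that A'sub arc_graphs_arcD [OF AC] by blast
  \<comment> \<open>\<open>Z\<close> consists of the vertices that lie strictly under no remaining
    arc. From a vertex of \<open>Z\<close> other than \<open>b\<close>, the longest arc to the right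
    ends in \<open>Z\<close> again: an arc over its end would cross it, exceed it, or cover its
    start.\<close>
  define Z where "Z = {w. a \<le> w \<and> w \<le> b \<and> (\<forall>u v. (u, v) \<in> A' \<longrightarrow> \<not> (u < w \<and> w < v))}"
  have main: "f w = f b" if f: "constant_on_arcs f A'" and "w \<in> Z" for f w
    using \<open>w \<in> Z\<close>
  proof (induction "nat (b - w)" arbitrary: w rule: less_induct)
    case less
    show ?case
    proof (cases "w = b")
      case False
      with less.prems have w: "a \<le> w" "w < b" by (auto simp: Z_def)
      from cov [OF this] obtain u v where uv: "(u, v) \<in> A'" "u \<le> w" "w < v"
        by (auto simp: A'_def)
      with less.prems have "(w, v) \<in> A'" by (cases "u = w") (auto simp: Z_def)
      define N where "N = {v. (w, v) \<in> A'}"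
      have "finite N"
        using finite_neighbours [OF AC, of w] A'sub by (auto simp: N_def intro: rev_finite_subset)
      moreover have "N \<noteq> {}" using \<open>(w, v) \<in> A'\<close> by (auto simp: N_def)
      ultimately have M: "Max N \<in> N" "\<And>x. x \<in> N \<Longrightarrow> x \<le> Max N" by auto
      define x where "x = Max N"
      have wx: "(w, x) \<in> A'" using M(1) by (simp add: x_def N_def)
      then have "w < x" "x \<le> b" using arcs by auto
      have "x \<in> Z"
        unfolding Z_def
      proof (intro CollectI conjI allI impI notI)
        show "a \<le> x" "x \<le> b" using \<open>w < x\<close> \<open>x \<le> b\<close> w by auto
        fix p q assume pq: "(p, q) \<in> A'" and "p < x \<and> x < q"
        then have "p \<le> w" using noncrossing_arcsD [OF nc' wx pq] by (meson linorder_not_less)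
        moreover have "p \<noteq> w" using M(2) [of q] pq \<open>p < x \<and> x < q\<close> by (auto simp: N_def x_def)
        ultimately have "p < w \<and> w < q" using \<open>p < x \<and> x < q\<close> \<open>w < x\<close> by auto
        then show False using less.prems pq by (auto simp: Z_def)
      qed
      moreover have "nat (b - x) < nat (b - w)" using \<open>w < x\<close> \<open>x \<le> b\<close> by auto
      ultimately have "f x = f b" using less.hyps by blast
      then show ?thesis using f wx by (auto simp: constant_on_arcs_def)
    qed simp
  qed
  have "a \<in> Z" using arcs \<open>a < b\<close> by (force simp: Z_def)
  have "connected_arcs a b A'"
    unfolding connected_arcs_def
  proof (intro allI impI)
    fix f w assume f: "constant_on_arcs f A'" and w: "a \<le> w \<and> w \<le> b"
    then have "constant_on_arcs f A"
      using main [OF f \<open>a \<in> Z\<close>] by (auto simp: constant_on_arcs_def A'_def)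
    moreover have "connected_arcs a b A" using AC by (simp add: arc_graphs_def)
    ultimately show "f w = f a" using connected_arcsD [of a b A f w] w by blast
  qed
  then show False using nconn by (simp add: A'_def)
qed

text \<open>The term \<open>x y (1 + T)^2\<close>: if the outer arc is a bridge, its removal leaves
  exactly two connected parts, on \<open>a..i\<close> and \<open>i+1..b\<close>.\<close>

lemma bij_betw_split_at_gap:
  assumes "a < b"
  shows "bij_betw (\<lambda>(i, A, B). insert (a, b) (A \<union> B)) (SIGMA i:{a..<b}. arc_graphs a i \<times> arc_graphs (i + 1) b)
    {A \<in> rooted_arc_graphs a b. \<not> connected_arcs a b (A - {(a, b)})}"
proof (rule bij_betw_imageI)
  have diff: "insert (a, b) (A \<union> B) - {(a, b)} = A \<union> B"
    if "A \<in> arc_graphs a i" "B \<in> arc_graphs (i + 1) b" "a \<le> i" "i < b" for A B i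
  proof -
    have "(a, b) \<notin> A" "(a, b) \<notin> B"
      using arc_graphs_arcD [OF that(1), of a b] arc_graphs_arcD [OF that(2), of a b] that(3,4) by auto
    then show ?thesis by simp
  qed
  have col: "constant_on_arcs (\<lambda>w. w \<le> i) (A \<union> B)" if "A \<in> arc_graphs a i" "B \<in> arc_graphs (i + 1) b" for A B i
    unfolding constant_on_arcs_def
  proof (intro allI impI)
    fix u v assume "(u, v) \<in> A \<union> B"
    then consider "(u, v) \<in> A" | "(u, v) \<in> B" by blast
    then show "(u \<le> i) = (v \<le> i)"
      using arc_graphs_arcD [OF that(1), of u v] arc_graphs_arcD [OF that(2), of u v] by cases auto
  qed
  \<comment> \<open>Uniqueness of the gap: with a second gap \<open>i' > i\<close>, the colouring
    \<open>w \<le> i\<close> would be constant on the arcs of the connected left part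
    \<open>A'\<close> but not on its vertices.\<close>
  have less: False if *: "A \<in> arc_graphs a i" "B \<in> arc_graphs (i + 1) b" "A' \<in> arc_graphs a i'" "B' \<in> arc_graphs (i' + 1) b"
      "A \<union> B = A' \<union> B'" "i < i'" "a \<le> i" for A B i A' B' i'
  proof -
    have "constant_on_arcs (\<lambda>w. w \<le> i) A'" using col [OF *(1,2)] unfolding *(5) by simp
    moreover have "connected_arcs a i' A'" using *(3) by (simp add: arc_graphs_def)
    ultimately have "(i' \<le> i) = (a \<le> i)"
      using *(6,7) connected_arcsD [of a i' A' "\<lambda>w. w \<le> i" i'] by simp
    then show False using *(6,7) by simp
  qed
  show "inj_on (\<lambda>(i, A, B). insert (a, b) (A \<union> B)) (SIGMA i:{a..<b}. arc_graphs a i \<times> arc_graphs (i + 1) b)"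
  proof (rule inj_onI)
    fix p q
    assume p: "p \<in> (SIGMA i:{a..<b}. arc_graphs a i \<times> arc_graphs (i + 1) b)"
      and q: "q \<in> (SIGMA i:{a..<b}. arc_graphs a i \<times> arc_graphs (i + 1) b)"
      and pq: "(\<lambda>(i, A, B). insert (a, b) (A \<union> B)) p = (\<lambda>(i, A, B). insert (a, b) (A \<union> B)) q"
    obtain i A B where p': "p = (i, A, B)" by (cases p)
    obtain i' A' B' where q': "q = (i', A', B')" by (cases q)
    note pq' = p' q'
    have *: "i \<in> {a..<b}" "A \<in> arc_graphs a i" "B \<in> arc_graphs (i + 1) b" and
      **: "i' \<in> {a..<b}" "A' \<in> arc_graphs a i'" "B' \<in> arc_graphs (i' + 1) b" and
      ins: "insert (a, b) (A \<union> B) = insert (a, b) (A' \<union> B')"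
      using p q pq unfolding pq' by simp_all
    have eq: "A \<union> B = A' \<union> B'"
      using diff [OF *(2,3)] diff [OF **(2,3)] *(1) **(1) unfolding ins by simp
    have ii: "i = i'"
      using less [OF *(2,3) **(2,3) eq] less [OF **(2,3) *(2,3) eq [symmetric]] *(1) **(1)
      by (cases i i' rule: linorder_cases) auto
    have XY: "(X \<union> Y) \<inter> arc_pairs a i = X" "(X \<union> Y) \<inter> arc_pairs (i + 1) b = Y"
      if "X \<in> arc_graphs a i" "Y \<in> arc_graphs (i + 1) b" for X Y
      using arc_graphs_Un_Int [OF that] by auto
    have "A = A'" "B = B'"
      using XY [OF *(2,3)] XY [of A' B'] **(2,3) eq unfolding ii by auto
    with ii show "p = q" by (simp add: pq')
  qed
  show "(\<lambda>(i, A, B). insert (a, b) (A \<union> B)) ` (SIGMA i:{a..<b}. arc_graphs a i \<times> arc_graphs (i + 1) b)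
     = {A \<in> rooted_arc_graphs a b. \<not> connected_arcs a b (A - {(a, b)})}"
  proof (intro equalityI subsetI)
    fix X assume "X \<in> (\<lambda>(i, A, B). insert (a, b) (A \<union> B)) ` (SIGMA i:{a..<b}. arc_graphs a i \<times> arc_graphs (i + 1) b)"
    then obtain i A B where i: "a \<le> i" "i < b" and A: "A \<in> arc_graphs a i" and B: "B \<in> arc_graphs (i + 1) b"
      and X: "X = insert (a, b) (A \<union> B)" by auto
    have sub: "A \<subseteq> arc_pairs a i" "B \<subseteq> arc_pairs (i + 1) b" "A \<union> B \<subseteq> arc_pairs a b"
      using A B i by (auto simp: arc_graphs_def)
    have "noncrossing_arcs (A \<union> B)"
      using A B by (intro noncrossing_arcs_Un [OF _ _ sub(1,2)]) (auto simp: arc_graphs_def)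
    then have "noncrossing_arcs X" unfolding X by (rule noncrossing_arcs_insert_top_arc) fact
    moreover have "X \<subseteq> arc_pairs a b" using sub(3) i by (auto simp: X)
    moreover have "connected_arcs a b X"
      unfolding connected_arcs_def
    proof (intro allI impI)
      fix f w assume f: "constant_on_arcs f X" and w: "a \<le> w \<and> w \<le> b"
      then have "constant_on_arcs f A" "constant_on_arcs f B" "f a = f b" by (auto simp: X constant_on_arcs_def)
      moreover have "connected_arcs a i A" "connected_arcs (i + 1) b B" using A B by (auto simp: arc_graphs_def)
      ultimately show "f w = f a"
        using connected_arcsD [of a i A f w] connected_arcsD [of "i + 1" b B f w] connected_arcsD [of "i + 1" b B f b] w i
        by (cases "w \<le> i") simp_all
    qed
    moreover have "\<not> connected_arcs a b (A \<union> B)"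
    proof
      assume "connected_arcs a b (A \<union> B)"
      from connected_arcsD [OF this col [OF A B], of b] i show False by simp
    qed
    ultimately show "X \<in> {A \<in> rooted_arc_graphs a b. \<not> connected_arcs a b (A - {(a, b)})}"
      using diff [OF A B i] by (simp add: rooted_arc_graphs_def arc_graphs_def X)
  next
    fix X assume "X \<in> {A \<in> rooted_arc_graphs a b. \<not> connected_arcs a b (A - {(a, b)})}"
    then have X: "X \<in> rooted_arc_graphs a b" and nconn: "\<not> connected_arcs a b (X - {(a, b)})" by auto
    obtain i where i: "a \<le> i" "i < b"
      and cut: "\<And>u v. (u, v) \<in> X - {(a, b)} \<Longrightarrow> v \<le> i \<or> i < u"
      using uncovered_gap [OF X nconn assms] by blast
    have XC: "X \<in> arc_graphs a b" and connX: "connected_arcs a b X" and ab: "(a, b) \<in> X" using X by (auto simp: rooted_arc_graphs_def arc_graphs_def)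
    define A where "A = (X - {(a, b)}) \<inter> arc_pairs a i"
    define B where "B = (X - {(a, b)}) \<inter> arc_pairs (i + 1) b"
    have "X - {(a, b)} = A \<union> B"
    proof (rule equalityI)
      show "X - {(a, b)} \<subseteq> A \<union> B"
      proof
        fix e assume e: "e \<in> X - {(a, b)}"
        then have "a \<le> fst e" "fst e < snd e" "snd e \<le> b"
          using arc_graphs_arcD [OF XC, of "fst e" "snd e"] by auto
        then show "e \<in> A \<union> B"
          using e cut [of "fst e" "snd e"] by (cases e) (auto simp: A_def B_def)
      qed
    qed (auto simp: A_def B_def)
    then have XAB: "X = insert (a, b) (A \<union> B)" using ab insert_Diff [OF ab] by simp
    have "connected_arcs a i A"
      unfolding connected_arcs_def
    proof (intro allI impI)
      fix f w assume f: "constant_on_arcs f A" and w: "a \<le> w \<and> w \<le> i"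
      \<comment> \<open>Everything beyond the gap gets the colour of \<open>a\<close>, so the outer
        arc and all arcs on the right respect the extension. On the right-hand part below, the
        colour of \<open>b\<close> is used likewise.\<close>
      define g where "g = (\<lambda>w. if w \<le> i then f w else f a)"
      have "constant_on_arcs g X"
        unfolding constant_on_arcs_def
      proof (intro allI impI)
        fix u v assume "(u, v) \<in> X"
        then consider "(u, v) \<in> A" | "(u, v) = (a, b)" | "(u, v) \<in> B" unfolding XAB by auto
        then show "g u = g v"
        proof cases
          case 1
          then have "u \<le> i \<and> v \<le> i" by (auto simp: A_def)
          then show ?thesis using 1 f by (auto simp: g_def constant_on_arcs_def)
        next
          case 2
          then show ?thesis using i by (auto simp: g_def)
        next
          case 3
          then have "\<not> u \<le> i \<and> \<not> v \<le> i" by (auto simp: B_def)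
          then show ?thesis by (auto simp: g_def)
        qed
      qed
      then have "g w = g a" using connX connected_arcsD [of a b X g w] w i by simp
      then show "f w = f a" using w i by (simp add: g_def)
    qed
    moreover have "connected_arcs (i + 1) b B"
      unfolding connected_arcs_def
    proof (intro allI impI)
      fix f w assume f: "constant_on_arcs f B" and w: "i + 1 \<le> w \<and> w \<le> b"
      define g where "g = (\<lambda>w. if w \<le> i then f b else f w)"
      have "constant_on_arcs g X"
        unfolding constant_on_arcs_def
      proof (intro allI impI)
        fix u v assume "(u, v) \<in> X"
        then consider "(u, v) \<in> A" | "(u, v) = (a, b)" | "(u, v) \<in> B" unfolding XAB by auto
        then show "g u = g v"
        proof cases
          case 1
          then have "u \<le> i \<and> v \<le> i" by (auto simp: A_def)
          then show ?thesis by (auto simp: g_def)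
        next
          case 2
          then show ?thesis using i by (auto simp: g_def)
        next
          case 3
          then have "\<not> u \<le> i \<and> \<not> v \<le> i" by (auto simp: B_def)
          then show ?thesis using 3 f by (auto simp: g_def constant_on_arcs_def)
        qed
      qed
      then have "g w = g a" "g (i + 1) = g a"
        using connX connected_arcsD [of a b X g w] connected_arcsD [of a b X g "i + 1"] w i by simp_all
      then show "f w = f (i + 1)" using w i by (simp add: g_def)
    qed
    moreover have "noncrossing_arcs A" "noncrossing_arcs B"
      using XC noncrossing_arcs_mono [of X A] noncrossing_arcs_mono [of X B] by (auto simp: arc_graphs_def A_def B_def)
    ultimately have "A \<in> arc_graphs a i" "B \<in> arc_graphs (i + 1) b" by (auto simp: arc_graphs_def A_def B_def)
    with i have "(i, A, B) \<in> (SIGMA i:{a..<b}. arc_graphs a i \<times> arc_graphs (i + 1) b)" by simp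
    then show
      "X \<in> (\<lambda>(i, A, B). insert (a, b) (A \<union> B)) ` (SIGMA i:{a..<b}. arc_graphs a i \<times> arc_graphs (i + 1) b)"
      by (rule rev_image_eqI) (simp add: XAB)
  qed
qed

section \<open>Translation of arc graphs and the weighted counts\<close>

definition shift_arcs :: "int \<Rightarrow> (int \<times> int) set \<Rightarrow> (int \<times> int) set" where
  "shift_arcs t A = (\<lambda>(u, v). (u + t, v + t)) ` A"

lemma shift_arcs_iff [simp]: "(u, v) \<in> shift_arcs t A \<longleftrightarrow> (u - t, v - t) \<in> A"
  by (force simp: shift_arcs_def)

lemma shift_arcs_shift_arcs [simp]: "shift_arcs s (shift_arcs t A) = shift_arcs (s + t) A"
  by (auto simp: algebra_simps)

lemma shift_arcs_0 [simp]: "shift_arcs 0 A = A"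
  by auto

lemma card_shift_arcs [simp]: "card (shift_arcs t A) = card A"
  unfolding shift_arcs_def by (rule card_image) (auto simp: inj_on_def)

lemma shift_arcs_arc_graphs:
  assumes "A \<in> arc_graphs a b"
  shows "shift_arcs t A \<in> arc_graphs (a + t) (b + t)"
proof -
  have A: "A \<subseteq> arc_pairs a b" "noncrossing_arcs A" "connected_arcs a b A" using assms by (simp_all add: arc_graphs_def)
  have "shift_arcs t A \<subseteq> arc_pairs (a + t) (b + t)"
  proof
    fix e assume "e \<in> shift_arcs t A"
    then show "e \<in> arc_pairs (a + t) (b + t)"
      using arc_graphs_arcD [OF assms, of "fst e - t" "snd e - t"] by (cases e) auto
  qed
  moreover have "noncrossing_arcs (shift_arcs t A)"
    unfolding noncrossing_arcs_def
  proof (intro allI impI notI)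
    fix u v x y
    assume "(u, v) \<in> shift_arcs t A" "(x, y) \<in> shift_arcs t A" and *: "u < x \<and> x < v \<and> v < y"
    then have "(u - t, v - t) \<in> A" "(x - t, y - t) \<in> A" by simp_all
    from noncrossing_arcsD [OF A(2) this] * show False by simp
  qed
  moreover have "connected_arcs (a + t) (b + t) (shift_arcs t A)"
    unfolding connected_arcs_def
  proof (intro allI impI)
    fix f w assume f: "constant_on_arcs f (shift_arcs t A)" and w: "a + t \<le> w \<and> w \<le> b + t"
    have "constant_on_arcs (\<lambda>w. f (w + t)) A"
      unfolding constant_on_arcs_def
    proof (intro allI impI)
      fix u v assume "(u, v) \<in> A"
      then have "(u + t, v + t) \<in> shift_arcs t A" by simp
      then show "f (u + t) = f (v + t)" using f unfolding constant_on_arcs_def by blast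
    qed
    from connected_arcsD [OF A(3) this, of "w - t"] w show "f w = f (a + t)" by simp
  qed
  ultimately show ?thesis by (simp add: arc_graphs_def)
qed

lemma bij_betw_shift_arcs_arc_graphs: "bij_betw (shift_arcs t) (arc_graphs a b) (arc_graphs (a + t) (b + t))"
proof (rule bij_betw_byWitness [where f' = "shift_arcs (- t)"])
  show "shift_arcs (- t) ` arc_graphs (a + t) (b + t) \<subseteq> arc_graphs a b"
    using shift_arcs_arc_graphs [of _ "a + t" "b + t" "- t"] by auto
  show "shift_arcs t ` arc_graphs a b \<subseteq> arc_graphs (a + t) (b + t)" using shift_arcs_arc_graphs by auto
qed simp_all

lemma bij_betw_shift_arcs_rooted_arc_graphs: "bij_betw (shift_arcs t) (rooted_arc_graphs a b) (rooted_arc_graphs (a + t) (b + t))"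
proof (rule bij_betw_byWitness [where f' = "shift_arcs (- t)"])
  show "shift_arcs (- t) ` rooted_arc_graphs (a + t) (b + t) \<subseteq> rooted_arc_graphs a b"
    using shift_arcs_arc_graphs [of _ "a + t" "b + t" "- t"] by (auto simp: rooted_arc_graphs_def)
  show "shift_arcs t ` rooted_arc_graphs a b \<subseteq> rooted_arc_graphs (a + t) (b + t)"
    using shift_arcs_arc_graphs by (auto simp: rooted_arc_graphs_def)
qed simp_all

lemma reach_shift_arcs:
  assumes "A \<in> arc_graphs a b" and "a < b"
  shows "reach (a + t) (shift_arcs t A) = reach a A + t"
proof -
  have B: "shift_arcs t A \<in> arc_graphs (a + t) (b + t)" by (rule shift_arcs_arc_graphs) fact
  have "reach (a + t) (shift_arcs t A) - t \<le> reach a A"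
    using reach_props(1) [OF B] assms by (intro reach_ge [OF assms(1)]) simp
  moreover have "reach a A + t \<le> reach (a + t) (shift_arcs t A)"
    using reach_props(1) [OF assms] by (intro reach_ge [OF B]) simp
  ultimately show ?thesis by simp
qed

text \<open>The coefficient of \<open>x^s\<close> in \<open>1 + T\<close> for a fixed number
  \<open>y\<close>. The index \<open>s\<close> is one less than the number of vertices, so it is
  additive when graphs are glued at a vertex.\<close>

definition arc_graph_weight :: "real \<Rightarrow> nat \<Rightarrow> real" where
  "arc_graph_weight y s = (\<Sum>A\<in>arc_graphs 0 (int s). y ^ card A)"

definition rooted_weight :: "real \<Rightarrow> nat \<Rightarrow> real" where
  "rooted_weight y s = (\<Sum>A\<in>rooted_arc_graphs 0 (int s). y ^ card A)"

lemma sum_arc_graphs_eq_arc_graph_weight: "a \<le> b \<Longrightarrow> (\<Sum>A\<in>arc_graphs a b. y ^ card A) = arc_graph_weight y (nat (b - a))"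
  using sum.reindex_bij_betw [OF bij_betw_shift_arcs_arc_graphs [of a 0 "b - a"], of "\<lambda>A. y ^ card A"]
  by (simp add: arc_graph_weight_def)

lemma sum_rooted_arc_graphs_eq_rooted_weight: "a \<le> b \<Longrightarrow> (\<Sum>A\<in>rooted_arc_graphs a b. y ^ card A) = rooted_weight y (nat (b - a))"
  using sum.reindex_bij_betw [OF bij_betw_shift_arcs_rooted_arc_graphs [of a 0 "b - a"], of "\<lambda>A. y ^ card A"]
  by (simp add: rooted_weight_def)

lemma arc_graph_weight_0: "arc_graph_weight y 0 = 1"
proof -
  have "arc_graphs 0 0 = {{}}"
    by (auto simp: arc_graphs_def connected_arcs_def noncrossing_arcs_def arc_pairs_def)
  then show ?thesis by (simp add: arc_graph_weight_def)
qed

lemma rooted_weight_0: "rooted_weight y 0 = 0"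
proof -
  have "rooted_arc_graphs 0 0 = {}" using arc_graphs_arcD [of _ 0 0 0 0] by (auto simp: rooted_arc_graphs_def)
  then show ?thesis by (simp add: rooted_weight_def)
qed

text \<open>The weight \<open>g\<close> is kept general: \<open>g = 1\<close> gives the recursion
  for connected graphs, the identity gives the total reach, which counts rotation-invariant
  graphs.\<close>

lemma sum_weighted_reach:
  assumes "s \<ge> 1"
  shows "(\<Sum>A\<in>arc_graphs 0 (int s). g (nat (reach 0 A)) * y ^ card A)
    = (\<Sum>l=1..s. g l * rooted_weight y l * arc_graph_weight y (s - l))"
proof -
  have "(\<Sum>A\<in>arc_graphs 0 (int s). g (nat (reach 0 A)) * y ^ card A)
      = (\<Sum>l\<in>{0<..int s}. \<Sum>A\<in>rooted_arc_graphs 0 l. \<Sum>B\<in>arc_graphs l (int s). g (nat l) * y ^ card (A \<union> B))"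
    using sum_arc_graphs_split_at_reach [of 0 "int s" "\<lambda>l A. g (nat l) * y ^ card A"] assms by simp
  also have "\<dots> = (\<Sum>l\<in>{0<..int s}. g (nat l) * rooted_weight y (nat l) * arc_graph_weight y (s - nat l))"
  proof (rule sum.cong [OF refl])
    fix l assume l: "l \<in> {0<..int s}"
    have "(\<Sum>A\<in>rooted_arc_graphs 0 l. \<Sum>B\<in>arc_graphs l (int s). g (nat l) * y ^ card (A \<union> B))
        = (\<Sum>A\<in>rooted_arc_graphs 0 l. \<Sum>B\<in>arc_graphs l (int s). g (nat l) * (y ^ card A * y ^ card B))"
    proof (intro sum.cong refl)
      fix A B assume "A \<in> rooted_arc_graphs 0 l" "B \<in> arc_graphs l (int s)"
      then have "card (A \<union> B) = card A + card B"
        by (intro card_Un_arcs [of A 0 l B l "int s"]) (simp_all add: rooted_arc_graphs_def)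
      then show "g (nat l) * y ^ card (A \<union> B) = g (nat l) * (y ^ card A * y ^ card B)"
        by (simp add: power_add)
    qed
    also have "\<dots> = g (nat l) * (\<Sum>A\<in>rooted_arc_graphs 0 l. y ^ card A) * (\<Sum>B\<in>arc_graphs l (int s). y ^ card B)"
      by (simp only: mult.assoc sum_product) (simp only: sum_distrib_left)
    also have "\<dots> = g (nat l) * rooted_weight y (nat l) * arc_graph_weight y (s - nat l)"
      using l by (simp add: sum_rooted_arc_graphs_eq_rooted_weight sum_arc_graphs_eq_arc_graph_weight nat_diff_distrib)
    finally show "(\<Sum>A\<in>rooted_arc_graphs 0 l. \<Sum>B\<in>arc_graphs l (int s). g (nat l) * y ^ card (A \<union> B))
       = g (nat l) * rooted_weight y (nat l) * arc_graph_weight y (s - nat l)" .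
  qed
  also have "\<dots> = (\<Sum>l=1..s. g l * rooted_weight y l * arc_graph_weight y (s - l))"
    by (rule sum.reindex_bij_witness [of _ int nat]) auto
  finally show ?thesis .
qed

lemma arc_graph_weight_rec: "s \<ge> 1 \<Longrightarrow> arc_graph_weight y s = (\<Sum>l=1..s. rooted_weight y l * arc_graph_weight y (s - l))"
  using sum_weighted_reach [of s "\<lambda>_. 1" y] by (simp add: arc_graph_weight_def)

text \<open>The term \<open>y (T - R)\<close>: the outer arc is not a bridge and can be
  removed.\<close>

lemma bij_betw_insert_top_arc:
  assumes "a < b"
  shows "bij_betw (insert (a, b)) (arc_graphs a b - rooted_arc_graphs a b) {A \<in> rooted_arc_graphs a b. connected_arcs a b (A - {(a, b)})}"
proof (rule bij_betw_byWitness [where f' = "\<lambda>A. A - {(a, b)}"])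
  show "insert (a, b) ` (arc_graphs a b - rooted_arc_graphs a b) \<subseteq> {A \<in> rooted_arc_graphs a b. connected_arcs a b (A - {(a, b)})}"
  proof (rule image_subsetI)
    fix A assume A: "A \<in> arc_graphs a b - rooted_arc_graphs a b"
    then have "insert (a, b) A - {(a, b)} = A" "connected_arcs a b A" by (auto simp: rooted_arc_graphs_def arc_graphs_def)
    then show "insert (a, b) A \<in> {A \<in> rooted_arc_graphs a b. connected_arcs a b (A - {(a, b)})}"
      using insert_top_arc_rooted_arc_graphs [of A a b] A assms by simp
  qed
  show "(\<lambda>A. A - {(a, b)}) ` {A \<in> rooted_arc_graphs a b. connected_arcs a b (A - {(a, b)})} \<subseteq> arc_graphs a b - rooted_arc_graphs a b"
  proof (rule image_subsetI)
    fix A assume A: "A \<in> {A \<in> rooted_arc_graphs a b. connected_arcs a b (A - {(a, b)})}"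
    then have "A \<subseteq> arc_pairs a b" "noncrossing_arcs A" by (simp_all add: rooted_arc_graphs_def arc_graphs_def)
    moreover have "noncrossing_arcs (A - {(a, b)})" by (rule noncrossing_arcs_mono [OF \<open>noncrossing_arcs A\<close>]) auto
    ultimately show "A - {(a, b)} \<in> arc_graphs a b - rooted_arc_graphs a b" using A by (auto simp: rooted_arc_graphs_def arc_graphs_def)
  qed
qed (auto simp: rooted_arc_graphs_def)

text \<open>The outer arc either is redundant or is a bridge. In the second case the gap itself uses
  up one unit of length, hence \<open>s - 1 - i\<close> for the right part.\<close>

lemma rooted_weight_rec:
  assumes "s \<ge> 1"
  shows "rooted_weight y s = y * (arc_graph_weight y s - rooted_weight y s) + y * (\<Sum>i<s. arc_graph_weight y i * arc_graph_weight y (s - 1 - i))"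
proof -
  define n where "n = int s"
  have n: "0 < n" using assms by (simp add: n_def)
  have top: "(0, n) \<notin> A \<union> B" if "A \<in> arc_graphs 0 i" "B \<in> arc_graphs (i + 1) n" "0 \<le> i" "i < n" for A B i
    using arc_graphs_arcD [OF that(1), of 0 n] arc_graphs_arcD [OF that(2), of 0 n] that(3,4) by auto
  have "rooted_weight y s = (\<Sum>A\<in>{A \<in> rooted_arc_graphs 0 n. connected_arcs 0 n (A - {(0, n)})}. y ^ card A)
      + (\<Sum>A\<in>{A \<in> rooted_arc_graphs 0 n. \<not> connected_arcs 0 n (A - {(0, n)})}. y ^ card A)"
    unfolding rooted_weight_def n_def [symmetric]
    by (subst sum.union_disjoint [symmetric]) (auto intro!: sum.cong)
  also have "(\<Sum>A\<in>{A \<in> rooted_arc_graphs 0 n. connected_arcs 0 n (A - {(0, n)})}. y ^ card A)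
      = (\<Sum>A\<in>arc_graphs 0 n - rooted_arc_graphs 0 n. y ^ card (insert (0, n) A))"
    by (rule sum.reindex_bij_betw [OF bij_betw_insert_top_arc [OF n], symmetric])
  also have "\<dots> = (\<Sum>A\<in>arc_graphs 0 n - rooted_arc_graphs 0 n. y * y ^ card A)"
    by (intro sum.cong refl) (auto simp: rooted_arc_graphs_def card_insert_if arc_graphs_finite)
  also have "\<dots> = y * (arc_graph_weight y s - rooted_weight y s)"
    by (subst sum_diff) (auto simp: rooted_arc_graphs_def arc_graph_weight_def rooted_weight_def n_def sum_distrib_left right_diff_distrib)
  also have "(\<Sum>A\<in>{A \<in> rooted_arc_graphs 0 n. \<not> connected_arcs 0 n (A - {(0, n)})}. y ^ card A)
      = (\<Sum>p\<in>(SIGMA i:{0..<n}. arc_graphs 0 i \<times> arc_graphs (i + 1) n).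
          y ^ card (case p of (i, A, B) \<Rightarrow> insert (0, n) (A \<union> B)))"
    by (rule sum.reindex_bij_betw [OF bij_betw_split_at_gap [OF n], symmetric])
  also have "\<dots> = (\<Sum>p\<in>(SIGMA i:{0..<n}. arc_graphs 0 i \<times> arc_graphs (i + 1) n).
          case p of (i, A, B) \<Rightarrow> y * (y ^ card A * y ^ card B))"
  proof (rule sum.cong [OF refl])
    fix p assume p: "p \<in> (SIGMA i:{0..<n}. arc_graphs 0 i \<times> arc_graphs (i + 1) n)"
    obtain i A B where p': "p = (i, A, B)" by (cases p)
    have i: "0 \<le> i" "i < n" and AB: "A \<in> arc_graphs 0 i" "B \<in> arc_graphs (i + 1) n"
      using p unfolding p' by simp_all
    have "card (A \<union> B) = card A + card B" by (rule card_Un_arcs [OF AB]) simp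
    moreover have "finite (A \<union> B)" using AB by (simp add: arc_graphs_finite)
    ultimately have "card (insert (0, n) (A \<union> B)) = Suc (card A + card B)"
      using top [OF AB i] by simp
    then show "y ^ card (case p of (i, A, B) \<Rightarrow> insert (0, n) (A \<union> B))
        = (case p of (i, A, B) \<Rightarrow> y * (y ^ card A * y ^ card B))"
      by (simp add: p' power_add)
  qed
  also have "\<dots> = (\<Sum>i\<in>{0..<n}. \<Sum>p\<in>arc_graphs 0 i \<times> arc_graphs (i + 1) n.
          case p of (A, B) \<Rightarrow> y * (y ^ card A * y ^ card B))"
    by (subst sum.Sigma) (auto simp: case_prod_unfold)
  also have "\<dots> = (\<Sum>i\<in>{0..<n}. y * (arc_graph_weight y (nat i) * arc_graph_weight y (s - 1 - nat i)))"
  proof (rule sum.cong [OF refl])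
    fix i assume i: "i \<in> {0..<n}"
    have "(\<Sum>p\<in>arc_graphs 0 i \<times> arc_graphs (i + 1) n. case p of (A, B) \<Rightarrow> y * (y ^ card A * y ^ card B))
        = (\<Sum>A\<in>arc_graphs 0 i. \<Sum>B\<in>arc_graphs (i + 1) n. y * (y ^ card A * y ^ card B))"
      by (simp add: sum.cartesian_product)
    also have "\<dots> = y * ((\<Sum>A\<in>arc_graphs 0 i. y ^ card A) * (\<Sum>B\<in>arc_graphs (i + 1) n. y ^ card B))"
      by (simp only: sum_product) (simp only: sum_distrib_left)
    also have "nat (n - (i + 1)) = s - 1 - nat i"
      using i by (auto simp: n_def)
    then have "(\<Sum>B\<in>arc_graphs (i + 1) n. y ^ card B) = arc_graph_weight y (s - 1 - nat i)"
      using i by (simp add: sum_arc_graphs_eq_arc_graph_weight)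
    finally show "(\<Sum>p\<in>arc_graphs 0 i \<times> arc_graphs (i + 1) n. case p of (A, B) \<Rightarrow> y * (y ^ card A * y ^ card B))
       = y * (arc_graph_weight y (nat i) * arc_graph_weight y (s - 1 - nat i))"
      using i by (simp add: sum_arc_graphs_eq_arc_graph_weight)
  qed
  also have "\<dots> = (\<Sum>i<s. y * (arc_graph_weight y i * arc_graph_weight y (s - 1 - i)))"
    by (rule sum.reindex_bij_witness [of _ int nat]) (auto simp: n_def)
  finally show ?thesis by (simp add: sum_distrib_left)
qed

text \<open>Both sides of \<open>eq\<close> are polynomials in \<open>y\<close> agreeing on an
  infinite set, hence equal coefficientwise. The weight \<open>w\<close> is later the constant
  \<open>m\<close> or the reach.\<close>

lemma card_coefficients_lagrange_sum:
  fixes w :: "'a \<Rightarrow> nat" and e :: "'a \<Rightarrow> nat"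
  assumes S: "finite S"
    and eq: "\<And>y. y > 0 \<Longrightarrow> (\<Sum>A\<in>S. real (w A) * y ^ e A) = lagrange_sum N m y"
    and "j < m"
  shows "(\<Sum>A\<in>{A\<in>S. e A = m + j}. w A) = (N choose (m - 1 - j)) * ((m - 1 + j) choose j)"
proof -
  define P where "P = (\<Sum>A\<in>S. monom (real (w A)) (e A))"
  define Q where "Q = (\<Sum>j<m. monom (real (N choose (m - 1 - j)) * real ((m - 1 + j) choose j)) (m + j))"
  have "poly (P - Q) y = 0" if "y > 0" for y
    using eq [OF that] by (simp add: P_def Q_def poly_sum poly_monom lagrange_sum_def)
  then have "{0<..} \<subseteq> {y. poly (P - Q) y = 0}" by auto
  then have "infinite {y. poly (P - Q) y = 0}"
    using infinite_Ioi finite_subset by blast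
  then have "P = Q" using poly_roots_finite [of "P - Q"] by force
  then have "coeff P (m + j) = coeff Q (m + j)" by simp
  moreover have "coeff P (m + j) = real (\<Sum>A\<in>{A\<in>S. e A = m + j}. w A)"
    using S by (simp add: P_def coeff_sum sum.If_cases Int_def)
  moreover have "coeff Q (m + j) = real ((N choose (m - 1 - j)) * ((m - 1 + j) choose j))"
    using assms(3) by (simp add: Q_def coeff_sum)
  ultimately show ?thesis by linarith
qed

text \<open>The graphs have \<open>m + 1\<close> vertices; \<open>j < m\<close> covers the edge
  numbers from \<open>m\<close> (trees) to \<open>2m - 1\<close> (triangulated polygons, for
  \<open>m \<ge> 2\<close>). The factor \<open>m\<close> comes from the derivative in Lagrange
  inversion.\<close>

theorem card_connected_arcs:
  assumes "j < m"
  shows "m * card {A \<in> arc_graphs 0 (int m). card A = m + j}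
      = (3 * m choose (m - 1 - j)) * ((m - 1 + j) choose j)"
    and "m * card {A \<in> rooted_arc_graphs 0 (int m). card A = m + j}
      = (3 * m - 2 choose (m - 1 - j)) * ((m - 1 + j) choose j)"
    and "(\<Sum>A\<in>{A \<in> arc_graphs 0 (int m). card A = m + j}. nat (reach 0 A))
      = (3 * m - 1 choose (m - 1 - j)) * ((m - 1 + j) choose j)"
proof -
  have m: "m \<ge> 1" using assms by simp
  note sol = connected_rooted_recurrence_solution [of _ "arc_graph_weight _" "rooted_weight _", OF _ arc_graph_weight_0 rooted_weight_0 arc_graph_weight_rec rooted_weight_rec m]
  have "(\<Sum>A\<in>{A \<in> arc_graphs 0 (int m). card A = m + j}. m)
      = (3 * m choose (m - 1 - j)) * ((m - 1 + j) choose j)"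
    by (rule card_coefficients_lagrange_sum [OF finite_arc_graphs _ assms])
       (use sol(1) in \<open>simp add: arc_graph_weight_def sum_distrib_left\<close>)
  then show "m * card {A \<in> arc_graphs 0 (int m). card A = m + j}
      = (3 * m choose (m - 1 - j)) * ((m - 1 + j) choose j)" by (simp add: mult.commute)
  have "(\<Sum>A\<in>{A \<in> rooted_arc_graphs 0 (int m). card A = m + j}. m)
      = (3 * m - 2 choose (m - 1 - j)) * ((m - 1 + j) choose j)"
    by (rule card_coefficients_lagrange_sum [OF finite_rooted_arc_graphs _ assms])
       (use sol(2) in \<open>simp add: rooted_weight_def sum_distrib_left\<close>)
  then show "m * card {A \<in> rooted_arc_graphs 0 (int m). card A = m + j}
      = (3 * m - 2 choose (m - 1 - j)) * ((m - 1 + j) choose j)" by (simp add: mult.commute)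
  show "(\<Sum>A\<in>{A \<in> arc_graphs 0 (int m). card A = m + j}. nat (reach 0 A))
      = (3 * m - 1 choose (m - 1 - j)) * ((m - 1 + j) choose j)"
    by (rule card_coefficients_lagrange_sum [OF finite_arc_graphs _ assms])
       (use sol(3) sum_weighted_reach [OF m] in simp)
qed

section \<open>Chords of the circle\<close>

definition int_point :: "nat \<Rightarrow> int \<Rightarrow> complex" where
  "int_point n x = cis (2 * pi * real_of_int x / real n)"

text \<open>
  The signed distance of \<open>z\<close> from the line through the points \<open>a\<close> and \<open>b\<close>.
\<close>
definition side :: "nat \<Rightarrow> int \<Rightarrow> int \<Rightarrow> complex \<Rightarrow> real" where
  "side n a b z = Re (z * cis (- (pi * real_of_int (a + b) / real n))) - cos (pi * real_of_int (b - a) / real n)"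

lemma side_affine: "side n a b ((1 - u) *\<^sub>R x + u *\<^sub>R y) = (1 - u) * side n a b x + u * side n a b y"
  unfolding side_def by (simp add: algebra_simps)

text \<open>The product form makes signs visible: one factor changes sign at \<open>a\<close>, the
  other at \<open>b\<close>.\<close>

lemma side_int_point:
  assumes "n > 0"
  shows "side n a b (int_point n c) =
    2 * sin (pi * real_of_int (c - a) / real n) * sin (pi * real_of_int (b - c) / real n)"
proof -
  define x where "x = pi * real_of_int (c - a) / real n"
  define y where "y = pi * real_of_int (b - c) / real n"
  have "2 * pi * real_of_int c / real n + (- (pi * real_of_int (a + b) / real n)) = x - y"
    using assms by (simp add: x_def y_def field_simps)
  moreover have "pi * real_of_int (b - a) / real n = x + y"
    using assms by (simp add: x_def y_def field_simps)
  ultimately have "side n a b (int_point n c) = cos (x - y) - cos (x + y)"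
    by (simp add: side_def int_point_def cis_mult)
  also have "\<dots> = 2 * sin x * sin y" by (simp add: cos_add cos_diff)
  finally show ?thesis by (simp add: x_def y_def)
qed

lemma sin_int_pos: "n > 0 \<Longrightarrow> 0 < x \<Longrightarrow> x < int n \<Longrightarrow> sin (pi * real_of_int x / real n) > 0"
  by (rule sin_gt_zero) (simp_all add: field_simps)

lemma side_signs:
  assumes "n > 0" and "a < b" and "b < a + int n" and "a \<le> c" and "c < a + int n"
  shows "a < c \<Longrightarrow> c < b \<Longrightarrow> side n a b (int_point n c) > 0"
    and "b < c \<Longrightarrow> side n a b (int_point n c) < 0"
    and "c = a \<or> c = b \<Longrightarrow> side n a b (int_point n c) = 0"
proof -
  note s = side_int_point [OF assms(1)] sin_int_pos [OF assms(1)]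
  show "side n a b (int_point n c) > 0" if "a < c" "c < b"
    using that assms s(2) [of "c - a"] s(2) [of "b - c"] by (simp add: s(1) del: of_int_diff)
  show "side n a b (int_point n c) = 0" if "c = a \<or> c = b"
    using that by (auto simp: s(1))
  show "side n a b (int_point n c) < 0" if "b < c"
  proof -
    have "sin (pi * real_of_int (b - c) / real n) = - sin (pi * real_of_int (c - b) / real n)"
    proof -
      have "pi * real_of_int (b - c) / real n = - (pi * real_of_int (c - b) / real n)"
        using assms(1) by (simp add: field_simps)
      then show ?thesis by (simp only: sin_minus)
    qed
    then show ?thesis
      using that assms s(2) [of "c - a"] s(2) [of "c - b"]
      by (simp add: s(1) del: of_int_diff)
  qed
qed

lemma int_point_cong:
  assumes "n > 0" and "int n dvd x - y"
  shows "int_point n x = int_point n y"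
proof -
  obtain t where t: "x - y = int n * t" using assms(2) by (rule dvdE)
  then have "x = y + int n * t" by simp
  then have "2 * pi * real_of_int x / real n = 2 * pi * real_of_int y / real n + 2 * pi * real_of_int t"
    using assms(1) by (simp add: field_simps)
  then have "int_point n x = int_point n y * cis (2 * pi * real_of_int t)"
    by (simp only: int_point_def cis_mult)
  then show ?thesis by (simp add: cis_multiple_2pi)
qed

text \<open>Rotation by \<open>cis (- \<mu>)\<close> makes the chord vertical, with real part
  \<open>cos \<delta>\<close> and imaginary part from \<open>- sin \<delta>\<close> to
  \<open>sin \<delta>\<close>; the parameter \<open>t\<close> is read off from the imaginary
  part.\<close>

lemma on_line_of_side_eq_0:
  assumes "n > 0" and "a < b" and "b < a + int n" and z: "side n a b z = 0"
  obtains t where "z = (1 - t) *\<^sub>R int_point n a + t *\<^sub>R int_point n b"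
proof -
  define \<mu> where "\<mu> = pi * real_of_int (a + b) / real n"
  define \<delta> where "\<delta> = pi * real_of_int (b - a) / real n"
  have sd: "sin \<delta> > 0" unfolding \<delta>_def using assms by (intro sin_int_pos) auto
  have "2 * pi * real_of_int a / real n = \<mu> + (- \<delta>)" "2 * pi * real_of_int b / real n = \<mu> + \<delta>"
    using assms(1) by (simp_all add: \<mu>_def \<delta>_def field_simps)
  then have pa: "int_point n a = cis \<mu> * cis (- \<delta>)" and pb: "int_point n b = cis \<mu> * cis \<delta>"
    by (simp_all only: int_point_def cis_mult)
  define w where "w = z * cis (- \<mu>)"
  have Rw: "Re w = cos \<delta>" using z by (simp add: side_def w_def \<mu>_def \<delta>_def)
  have zw: "z = cis \<mu> * w" by (simp add: w_def cis_mult)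
  define t where "t = (Im w + sin \<delta>) / (2 * sin \<delta>)"
  have t: "t * (2 * sin \<delta>) = Im w + sin \<delta>" using sd by (simp add: t_def)
  have "w = (1 - t) *\<^sub>R cis (- \<delta>) + t *\<^sub>R cis \<delta>"
    using t by (auto simp: complex_eq_iff Rw algebra_simps)
  then have "z = cis \<mu> * ((1 - t) *\<^sub>R cis (- \<delta>) + t *\<^sub>R cis \<delta>)" using zw by simp
  then have "z = (1 - t) *\<^sub>R int_point n a + t *\<^sub>R int_point n b"
    unfolding pa pb by (simp add: distrib_left)
  then show ?thesis using that by blast
qed

text \<open>Since \<open>c\<close> and \<open>d\<close> lie on opposite sides of the line through
  \<open>a\<close> and \<open>b\<close>, their chord meets that line in a point \<open>z\<close>.
  The signs of \<open>a\<close> and \<open>b\<close> relative to the other line then force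
  \<open>z\<close> strictly between \<open>a\<close> and \<open>b\<close>.\<close>

lemma interleaved_chords_meet:
  assumes n: "n > 0" and "a < c" "c < b" "b < d" "d < a + int n"
  shows "open_segment (int_point n a) (int_point n b) \<inter>
    open_segment (int_point n c) (int_point n d) \<noteq> {}"
proof -
  define C where "C = side n a b (int_point n c)"
  define D where "D = side n a b (int_point n d)"
  have C: "C > 0" unfolding C_def using assms by (intro side_signs(1)) auto
  have D: "D < 0" unfolding D_def using assms by (intro side_signs(2)) auto
  define u where "u = C / (C - D)"
  have u: "0 < u" "u < 1" "u * (C - D) = C" using C D by (auto simp: u_def field_simps)
  define z where "z = (1 - u) *\<^sub>R int_point n c + u *\<^sub>R int_point n d"
  have "side n a b z = (1 - u) * C + u * D" by (simp add: z_def side_affine C_def D_def)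
  then have "side n a b z = 0" using u(3) by (simp add: algebra_simps)
  then obtain t where t: "z = (1 - t) *\<^sub>R int_point n a + t *\<^sub>R int_point n b"
    using on_line_of_side_eq_0 [of n a b z] assms by auto
  define A where "A = side n c d (int_point n a)"
  define B where "B = side n c d (int_point n b)"
  \<comment> \<open>\<open>a\<close> precedes \<open>c\<close> and so lies outside the window
    starting at \<open>c\<close> that \<open>side_signs\<close> requires; \<open>a + n\<close> is
    the same point and lies beyond \<open>d\<close>.\<close>
  have "A = side n c d (int_point n (a + int n))"
    unfolding A_def by (rule arg_cong [where f = "side n c d"], rule int_point_cong [OF n]) simp
  moreover have "\<dots> < 0" using assms by (intro side_signs(2)) auto
  ultimately have A: "A < 0" by simp
  have B: "B > 0" unfolding B_def using assms by (intro side_signs(1)) auto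
  have "side n c d (int_point n c) = 0" "side n c d (int_point n d) = 0"
    using assms by (auto intro!: side_signs(3))
  then have "side n c d z = 0" by (simp add: z_def side_affine)
  moreover have "side n c d z = (1 - t) * A + t * B" by (simp add: t side_affine A_def B_def)
  ultimately have eq: "t * (B - A) = - A" "(1 - t) * (B - A) = B" by (simp_all add: algebra_simps)
  have BA: "0 < B - A" using A B by simp
  have "0 < t * (B - A)" "0 < (1 - t) * (B - A)" unfolding eq using A B by simp_all
  then have "0 < t" "0 < 1 - t" using zero_less_mult_pos2 [OF _ BA] by blast+
  moreover have "int_point n a \<noteq> int_point n b" using A B by (auto simp: A_def B_def)
  ultimately have "z \<in> open_segment (int_point n a) (int_point n b)"
    using t by (auto simp: in_segment)
  moreover have "int_point n c \<noteq> int_point n d" using C D by (auto simp: C_def D_def)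
  then have "z \<in> open_segment (int_point n c) (int_point n d)"
    using u by (auto simp: in_segment z_def)
  ultimately show ?thesis by blast
qed

text \<open>At a common point a proper convex combination of two values of the same weak sign would
  vanish, so both values would. Hypothesis \<open>nz\<close> excludes this collinear case.\<close>

lemma open_segments_disjoint_if_same_side:
  assumes n: "n > 0" "a < b" "b < a + int n"
    and side: "(side n a b x \<ge> 0 \<and> side n a b y \<ge> 0) \<or> (side n a b x \<le> 0 \<and> side n a b y \<le> 0)"
    and nz: "side n a b x \<noteq> 0 \<or> side n a b y \<noteq> 0"
  shows "open_segment (int_point n a) (int_point n b) \<inter> open_segment x y = {}"
proof (rule ccontr)
  assume "\<not> ?thesis"
  then obtain z where "z \<in> open_segment (int_point n a) (int_point n b)" "z \<in> open_segment x y"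
    by blast
  then obtain t where t: "z = (1 - t) *\<^sub>R int_point n a + t *\<^sub>R int_point n b"
    by (auto simp: in_segment)
  obtain u where u: "0 < u" "u < 1" "z = (1 - u) *\<^sub>R x + u *\<^sub>R y"
    using \<open>z \<in> open_segment x y\<close> by (auto simp: in_segment)
  have "side n a b (int_point n a) = 0" "side n a b (int_point n b) = 0"
    using n by (auto intro!: side_signs(3))
  then have "side n a b z = 0" by (simp add: t side_affine)
  then have "(1 - u) * side n a b x + u * side n a b y = 0" by (simp add: u(3) side_affine)
  moreover have "(1 - u) * side n a b x \<ge> 0 \<and> u * side n a b y \<ge> 0
      \<or> (1 - u) * side n a b x \<le> 0 \<and> u * side n a b y \<le> 0"
    using side u by (auto simp: mult_nonneg_nonpos)
  ultimately have "(1 - u) * side n a b x = 0 \<and> u * side n a b y = 0" by linarith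
  then show False using nz u by simp
qed

text \<open>All end points are taken from one turn starting at \<open>a\<close>, so cyclic order is
  the order of integers. Without interleaving, \<open>c\<close> and \<open>d\<close> lie weakly on
  the same side of the line through \<open>a\<close> and \<open>b\<close>.\<close>

lemma chords_meet_iff:
  assumes n: "n > 0" and ab: "a < b" "b < a + int n"
    and c: "a \<le> c" "c < a + int n" and d: "a \<le> d" "d < a + int n" and "c \<noteq> d" and ne: "{a, b} \<noteq> {c, d}"
  shows "open_segment (int_point n a) (int_point n b) \<inter> open_segment (int_point n c) (int_point n d) \<noteq> {}
    \<longleftrightarrow> (a < c \<and> c < b \<and> b < d) \<or> (a < d \<and> d < b \<and> b < c)" (is "?L \<longleftrightarrow> ?R")
proof
  assume ?R
  then show ?L
    using interleaved_chords_meet [OF n, of a c b d] interleaved_chords_meet [OF n, of a d b c] c d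
    by (auto simp: open_segment_commute [of "int_point n c"])
next
  assume L: ?L
  show ?R
  proof (rule ccontr)
    assume nR: "\<not> ?R"
    have zero: "x = a \<or> x = b"
      if x: "a \<le> x" "x < a + int n" "side n a b (int_point n x) = 0" for x
    proof (rule ccontr)
      assume "\<not> ?thesis"
      then consider "a < x" "x < b" | "b < x" using x by linarith
      then show False
        using side_signs(1,2) [OF n ab x(1,2)] x(3) by cases simp_all
    qed
    have nonneg: "0 \<le> side n a b (int_point n x)" if "a \<le> x" "x \<le> b" for x
    proof (cases "x = a \<or> x = b")
      case True
      then show ?thesis using side_signs(3) [OF n ab, of x] that ab by simp
    next
      case False
      then show ?thesis using side_signs(1) [OF n ab, of x] that ab by simp
    qed
    have nonpos: "side n a b (int_point n x) \<le> 0" if "x = a \<or> b \<le> x" "a \<le> x" "x < a + int n" for x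
    proof (cases "x = a \<or> x = b")
      case True
      then show ?thesis using side_signs(3) [OF n ab, of x] that ab by simp
    next
      case False
      then show ?thesis using side_signs(2) [OF n ab, of x] that ab by simp
    qed
    have nz: "side n a b (int_point n c) \<noteq> 0 \<or> side n a b (int_point n d) \<noteq> 0"
    proof (rule ccontr)
      assume "\<not> ?thesis"
      then have "c = a \<or> c = b" "d = a \<or> d = b"
        using zero [OF c] zero [OF d] by simp_all
      with \<open>c \<noteq> d\<close> ne show False by (elim disjE) (simp_all add: insert_commute)
    qed
    \<comment> \<open>The end point \<open>a\<close> lies on the line and is compatible with either
      side, hence the extra alternatives in the second case.\<close>
    consider "c \<le> b" "d \<le> b" | "c = a \<or> c \<ge> b" "d = a \<or> d \<ge> b"
      using nR c d by linarith
    then have "(side n a b (int_point n c) \<ge> 0 \<and> side n a b (int_point n d) \<ge> 0)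
      \<or> (side n a b (int_point n c) \<le> 0 \<and> side n a b (int_point n d) \<le> 0)"
    proof cases
      case 1
      then show ?thesis using nonneg [of c] nonneg [of d] c d by simp
    next
      case 2
      then show ?thesis using nonpos [OF _ c] nonpos [OF _ d] by simp
    qed
    from open_segments_disjoint_if_same_side [OF n ab this nz] L show False by simp
  qed
qed

text \<open>The covering map from the integer line to the cycle, with representatives
  \<open>1..n\<close>; it allows arcs that wrap around past \<open>n\<close>.\<close>

definition vertex :: "nat \<Rightarrow> int \<Rightarrow> nat" where
  "vertex n x = nat ((x - 1) mod int n) + 1"

lemma vertex_range: "n > 0 \<Longrightarrow> vertex n x \<in> {1..n}"
  by (simp add: vertex_def Suc_le_eq nat_less_iff)

lemma vertex_eq_iff: "n > 0 \<Longrightarrow> vertex n x = vertex n y \<longleftrightarrow> int n dvd x - y"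
  by (simp add: vertex_def eq_nat_nat_iff mod_eq_dvd_iff)

lemma vertex_int: "1 \<le> x \<Longrightarrow> x \<le> int n \<Longrightarrow> vertex n x = nat x"
  by (simp add: vertex_def nat_diff_distrib)

lemma vertex_add: "n > 0 \<Longrightarrow> vertex n (x + int n * t) = vertex n x"
  by (simp add: vertex_eq_iff)

lemma circle_point_vertex: "n > 0 \<Longrightarrow> circle_point n (vertex n x) = int_point n x"
proof -
  assume n: "n > 0"
  have "circle_point n (vertex n x) = int_point n (int (vertex n x))"
    by (simp add: circle_point_def int_point_def)
  also have "\<dots> = int_point n x"
  proof (rule int_point_cong [OF n])
    have "int (vertex n x) - x = (x - 1) mod int n - (x - 1)" using n by (simp add: vertex_def)
    then show "int n dvd int (vertex n x) - x"
      by (metis dvd_minus_mod minus_diff_eq dvd_minus_iff)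
  qed
  finally show ?thesis .
qed

text \<open>The definition quantifies over all labellings of the end points, but an open segment
  does not depend on the order of its ends.\<close>

lemma edges_cross_doubletons:
  "edges_cross n {p, q} {r, s} \<longleftrightarrow> {p, q} \<noteq> {r, s} \<and>
    open_segment (circle_point n p) (circle_point n q) \<inter>
    open_segment (circle_point n r) (circle_point n s) \<noteq> {}" (is "?L \<longleftrightarrow> ?R")
proof
  assume ?L
  then obtain a b c d where *: "{p, q} \<noteq> {r, s}" "{p, q} = {a, b}" "{r, s} = {c, d}"
    and **: "open_segment (circle_point n a) (circle_point n b) \<inter>
        open_segment (circle_point n c) (circle_point n d) \<noteq> {}"
    unfolding edges_cross_def by blast
  have seg1: "open_segment (circle_point n a) (circle_point n b) = open_segment (circle_point n p) (circle_point n q)"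
    using *(2) unfolding doubleton_eq_iff
    by (elim disjE conjE) (simp_all add: open_segment_commute)
  have seg2: "open_segment (circle_point n c) (circle_point n d) = open_segment (circle_point n r) (circle_point n s)"
    using *(3) unfolding doubleton_eq_iff
    by (elim disjE conjE) (simp_all add: open_segment_commute)
  show ?R using *(1) ** unfolding seg1 seg2 by blast
next
  assume ?R
  then show ?L unfolding edges_cross_def by blast
qed

text \<open>Within one turn starting at \<open>a\<close> the covering map is injective, so equality
  of edges and order of end points can be read on the line.\<close>

lemma edges_cross_vertices:
  assumes n: "n > 0" and ab: "a < b" "b < a + int n"
    and c: "a \<le> c" "c < a + int n" and d: "a \<le> d" "d < a + int n" and cd: "c \<noteq> d"
  shows "edges_cross n {vertex n a, vertex n b} {vertex n c, vertex n d}
    \<longleftrightarrow> (a < c \<and> c < b \<and> b < d) \<or> (a < d \<and> d < b \<and> b < c)"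
proof -
  have inj: "vertex n x = vertex n y \<longleftrightarrow> x = y"
    if "a \<le> x" "x < a + int n" "a \<le> y" "y < a + int n" for x y
  proof
    assume "vertex n x = vertex n y"
    then have "int n dvd x - y" using n by (simp add: vertex_eq_iff)
    moreover from this have "int n dvd y - x" by (simp add: dvd_diff_commute)
    ultimately show "x = y"
    proof (cases x y rule: linorder_cases)
      case less
      then show ?thesis using zdvd_not_zless [of "y - x" "int n"] \<open>int n dvd y - x\<close> that by linarith
    next
      case greater
      then show ?thesis using zdvd_not_zless [of "x - y" "int n"] \<open>int n dvd x - y\<close> that by linarith
    qed simp
  qed simp
  have eqs: "vertex n a = vertex n c \<longleftrightarrow> a = c" "vertex n a = vertex n d \<longleftrightarrow> a = d"
    "vertex n b = vertex n c \<longleftrightarrow> b = c" "vertex n b = vertex n d \<longleftrightarrow> b = d"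
    by (rule inj; use ab c d in linarith)+
  have eq: "{vertex n a, vertex n b} = {vertex n c, vertex n d} \<longleftrightarrow> {a, b} = {c, d}"
    unfolding doubleton_eq_iff eqs ..
  show ?thesis
  proof (cases "{a, b} = {c, d}")
    case True
    then have "\<not> ((a < c \<and> c < b \<and> b < d) \<or> (a < d \<and> d < b \<and> b < c))"
      unfolding doubleton_eq_iff by (elim disjE conjE) simp_all
    then show ?thesis
      unfolding edges_cross_doubletons eq using True by simp
  next
    case False
    then show ?thesis
      unfolding edges_cross_doubletons circle_point_vertex [OF n] eq
        chords_meet_iff [OF n ab c d cd False] by simp
  qed
qed

lemma edges_cross_commute:
  assumes "edges_cross n e f"
  shows "edges_cross n f e"
proof -
  obtain a b c d where e: "e = {a, b}" and f: "f = {c, d}" and "e \<noteq> f"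
    and "open_segment (circle_point n a) (circle_point n b) \<inter>
        open_segment (circle_point n c) (circle_point n d) \<noteq> {}"
    using assms unfolding edges_cross_def by blast
  then show ?thesis
    unfolding e f edges_cross_doubletons by blast
qed

section \<open>Edges as images of arcs, and connectedness by colourings\<close>

definition edge :: "nat \<Rightarrow> int \<times> int \<Rightarrow> nat set" where
  "edge n = (\<lambda>(u, v). {vertex n u, vertex n v})"

lemma edge_simp [simp]: "edge n (u, v) = {vertex n u, vertex n v}"
  by (simp add: edge_def)

lemma connected_graph_colouring:
  assumes "connected_graph n E" and "\<And>p q. {p, q} \<in> E \<Longrightarrow> g p = g q"
    and "u \<in> {1..n}" and "v \<in> {1..n}"
  shows "(g u :: bool) = g v"
proof -
  have "(u, v) \<in> {(x, y). {x, y} \<in> E}\<^sup>*" using assms unfolding connected_graph_def by blast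
  then show ?thesis
  proof induction
    case (step p q)
    then have "{p, q} \<in> E" by simp
    with step.IH assms(2) show ?case by simp
  qed simp
qed

text \<open>Reachability from \<open>u\<close> is itself a colouring that is constant on
  edges.\<close>

lemma connected_graphI:
  assumes "\<And>g u v. (\<And>p q. {p, q} \<in> E \<Longrightarrow> g p = (g q :: bool)) \<Longrightarrow> u \<in> {1..n} \<Longrightarrow> v \<in> {1..n} \<Longrightarrow> g u = g v"
  shows "connected_graph n E"
  unfolding connected_graph_def
proof (intro ballI)
  fix u v assume uv: "u \<in> {1..n}" "v \<in> {1..n}"
  define R where "R = {(x, y). {x, y} \<in> E}"
  have "(u, p) \<in> R\<^sup>* \<longleftrightarrow> (u, q) \<in> R\<^sup>*" if "{p, q} \<in> E" for p q
  proof -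
    have "(p, q) \<in> R" "(q, p) \<in> R" using that by (simp_all add: R_def insert_commute)
    then show ?thesis by (meson rtrancl.rtrancl_into_rtrancl)
  qed
  from assms [of "\<lambda>p. (u, p) \<in> R\<^sup>*", OF this uv] show "(u, v) \<in> {(x, y). {x, y} \<in> E}\<^sup>*"
    by (simp add: R_def)
qed

lemma constant_on_edges_iff:
  "(\<forall>p q. {p, q} \<in> edge n ` A \<longrightarrow> g p = g q) \<longleftrightarrow> constant_on_arcs (\<lambda>w. g (vertex n w)) A"
proof
  assume L: "\<forall>p q. {p, q} \<in> edge n ` A \<longrightarrow> g p = g q"
  show "constant_on_arcs (\<lambda>w. g (vertex n w)) A"
    unfolding constant_on_arcs_def
  proof (intro allI impI)
    fix u v assume "(u, v) \<in> A"
    then have "edge n (u, v) \<in> edge n ` A" by (rule imageI)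
    then show "g (vertex n u) = g (vertex n v)" using L by simp
  qed
next
  assume R: "constant_on_arcs (\<lambda>w. g (vertex n w)) A"
  show "\<forall>p q. {p, q} \<in> edge n ` A \<longrightarrow> g p = g q"
  proof (intro allI impI)
    fix p q assume "{p, q} \<in> edge n ` A"
    then obtain u v where uv: "(u, v) \<in> A" "{p, q} = {vertex n u, vertex n v}" by auto
    then have "g (vertex n u) = g (vertex n v)" using R unfolding constant_on_arcs_def by blast
    then show "g p = g q" using uv(2) unfolding doubleton_eq_iff by (elim disjE conjE) simp_all
  qed
qed

section \<open>Graphs as sets of arcs\<close>

lemma edge_simple:
  assumes "n > 0" and "u < v" and "v < u + int n"
  shows "edge n (u, v) \<subseteq> {1..n}" and "card (edge n (u, v)) = 2"
proof -
  show "edge n (u, v) \<subseteq> {1..n}"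
    using vertex_range [OF assms(1), of u] vertex_range [OF assms(1), of v] by simp
  have "\<not> int n dvd v - u" using assms by (intro zdvd_not_zless) simp_all
  then have "vertex n u \<noteq> vertex n v"
    using assms(1) by (simp add: vertex_eq_iff dvd_diff_commute)
  then show "card (edge n (u, v)) = 2" by simp
qed

lemma edges_cross_same_interval:
  assumes n: "n > 0" and uv: "u < v" "v \<le> b" and xy: "x < y" "y \<le> b"
    and a: "a \<le> u" "a \<le> x" "b < a + int n"
  shows "edges_cross n (edge n (u, v)) (edge n (x, y)) \<longleftrightarrow>
    (u < x \<and> x < v \<and> v < y) \<or> (x < u \<and> u < y \<and> y < v)"
proof (cases "u \<le> x")
  case True
  then show ?thesis
    using edges_cross_vertices [of n u v x y] assms by auto
next
  case False
  have "edges_cross n (edge n (u, v)) (edge n (x, y)) \<longleftrightarrow>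
      edges_cross n (edge n (x, y)) (edge n (u, v))"
    using edges_cross_commute by blast
  then show ?thesis
    using edges_cross_vertices [of n x y u v] assms False by auto
qed

lemma bij_betw_edge:
  assumes "n > 0"
  shows "bij_betw (edge n) (arc_pairs 1 (int n)) {e. e \<subseteq> {1..n} \<and> card e = 2}"
proof (rule bij_betw_imageI)
  show "inj_on (edge n) (arc_pairs 1 (int n))"
  proof (rule inj_onI)
    fix p q assume p: "p \<in> arc_pairs 1 (int n)" and q: "q \<in> arc_pairs 1 (int n)"
      and eq: "edge n p = edge n q"
    obtain u v where p': "p = (u, v)" by (cases p)
    obtain x y where q': "q = (x, y)" by (cases q)
    have uv: "1 \<le> u" "u < v" "v \<le> int n" and xy: "1 \<le> x" "x < y" "y \<le> int n"
      using p q unfolding p' q' by simp_all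
    have "{nat u, nat v} = {nat x, nat y}"
      using eq uv xy unfolding p' q' by (simp add: vertex_int)
    then have "u = x \<and> v = y" using uv xy by (auto simp: doubleton_eq_iff)
    then show "p = q" by (simp add: p' q')
  qed
  show "edge n ` arc_pairs 1 (int n) = {e. e \<subseteq> {1..n} \<and> card e = 2}"
  proof (intro equalityI subsetI)
    fix e assume "e \<in> edge n ` arc_pairs 1 (int n)"
    then obtain u v where "e = edge n (u, v)" "1 \<le> u" "u < v" "v \<le> int n" by auto
    then show "e \<in> {e. e \<subseteq> {1..n} \<and> card e = 2}"
      using edge_simple [OF assms, of u v] by simp
  next
    fix e assume "e \<in> {e. e \<subseteq> {1..n} \<and> card e = 2}"
    then have e: "e \<subseteq> {1..n}" "card e = 2" by auto
    then obtain p q where pq: "e = {p, q}" "p \<noteq> q" by (auto simp: card_2_iff)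
    define u where "u = min p q"
    define v where "v = max p q"
    have uv: "e = {u, v}" "u < v" using pq by (auto simp: u_def v_def)
    then have "1 \<le> u" "v \<le> n" using e(1) by auto
    then have "e = edge n (int u, int v)" using uv by (simp add: vertex_int)
    moreover have "(int u, int v) \<in> arc_pairs 1 (int n)" using uv \<open>1 \<le> u\<close> \<open>v \<le> n\<close> by simp
    ultimately show "e \<in> edge n ` arc_pairs 1 (int n)" by blast
  qed
qed

lemma noncrossing_edges_iff:
  assumes n: "n > 0" and A: "A \<subseteq> arc_pairs 1 (int n)"
  shows "noncrossing_graph n (edge n ` A) \<longleftrightarrow> noncrossing_arcs A"
proof
  have cross: "edges_cross n (edge n (u, v)) (edge n (x, y)) \<longleftrightarrow>
    (u < x \<and> x < v \<and> v < y) \<or> (x < u \<and> u < y \<and> y < v)"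
    if "(u, v) \<in> A" "(x, y) \<in> A" for u v x y
  proof -
    have "1 \<le> u" "u < v" "v \<le> int n" "1 \<le> x" "x < y" "y \<le> int n" using that A by auto
    then show ?thesis using n by (intro edges_cross_same_interval [of n u v "int n" x y 1]) simp_all
  qed
  show "noncrossing_arcs A" if L: "noncrossing_graph n (edge n ` A)"
    unfolding noncrossing_arcs_def
  proof (intro allI impI notI)
    fix u v x y assume uv: "(u, v) \<in> A" "(x, y) \<in> A" and *: "u < x \<and> x < v \<and> v < y"
    have "\<not> edges_cross n (edge n (u, v)) (edge n (x, y))"
      using L uv unfolding noncrossing_graph_def by blast
    then show False using cross [OF uv] * by blast
  qed
  show "noncrossing_graph n (edge n ` A)" if "noncrossing_arcs A"
    unfolding noncrossing_graph_def
  proof (intro conjI ballI)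
    show "simple_graph n (edge n ` A)"
      unfolding simple_graph_def
    proof
      fix e assume "e \<in> edge n ` A"
      then obtain u v where "e = edge n (u, v)" "1 \<le> u" "u < v" "v \<le> int n" using A by auto
      then show "e \<subseteq> {1..n} \<and> card e = 2" using edge_simple [OF n, of u v] by simp
    qed
    fix e f assume "e \<in> edge n ` A" "f \<in> edge n ` A"
    then obtain u v x y where uv: "(u, v) \<in> A" "(x, y) \<in> A"
      and ef: "e = edge n (u, v)" "f = edge n (x, y)" by auto
    show "\<not> edges_cross n e f"
      unfolding ef cross [OF uv] using noncrossing_arcsD [OF \<open>noncrossing_arcs A\<close> uv] noncrossing_arcsD [OF \<open>noncrossing_arcs A\<close> uv(2,1)] by blast
  qed
qed

lemma connected_edges_iff:
  assumes n: "n > 0" and A: "A \<subseteq> arc_pairs 1 (int n)"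
  shows "connected_graph n (edge n ` A) \<longleftrightarrow> connected_arcs 1 (int n) A"
proof
  assume L: "connected_graph n (edge n ` A)"
  show "connected_arcs 1 (int n) A"
    unfolding connected_arcs_def
  proof (intro allI impI)
    fix f w assume f: "constant_on_arcs f A" and w: "1 \<le> w \<and> w \<le> int n"
    define g where "g = (\<lambda>p. f (int p))"
    have gv: "g (vertex n x) = f x" if "1 \<le> x" "x \<le> int n" for x
      using that by (simp add: g_def vertex_int)
    have "constant_on_arcs (\<lambda>w. g (vertex n w)) A"
      unfolding constant_on_arcs_def
    proof (intro allI impI)
      fix u v assume uv: "(u, v) \<in> A"
      then have "1 \<le> u" "u < v" "v \<le> int n" using A by auto
      then show "g (vertex n u) = g (vertex n v)"
        using f uv gv [of u] gv [of v] unfolding constant_on_arcs_def by simp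
    qed
    then have "g p = g q" if "{p, q} \<in> edge n ` A" for p q
      using that constant_on_edges_iff [of n A g] by blast
    from connected_graph_colouring [of n _ g, OF L this vertex_range [OF n, of w] vertex_range [OF n, of 1]]
    show "f w = f 1" using gv [of w] gv [of 1] w n by simp
  qed
next
  assume R: "connected_arcs 1 (int n) A"
  show "connected_graph n (edge n ` A)"
  proof (rule connected_graphI)
    fix g :: "nat \<Rightarrow> bool" and u v
    assume g: "\<And>p q. {p, q} \<in> edge n ` A \<Longrightarrow> g p = g q" and uv: "u \<in> {1..n}" "v \<in> {1..n}"
    have "constant_on_arcs (\<lambda>w. g (vertex n w)) A"
      using constant_on_edges_iff [of n A g] g by blast
    from connected_arcsD [OF R this, of "int u"] connected_arcsD [OF R this, of "int v"] uv
    show "g u = g v" by (simp add: vertex_int)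
  qed
qed

theorem card_noncrossing_connected_graphs:
  assumes n: "n > 0"
  shows "card (noncrossing_connected_graphs n k) = card {A \<in> arc_graphs 1 (int n). card A = k}"
proof -
  note bij = bij_betw_edge [OF n]
  have inj: "inj_on (edge n) A" if "A \<subseteq> arc_pairs 1 (int n)" for A
    using bij that by (auto simp: bij_betw_def intro: inj_on_subset)
  have mem: "edge n ` A \<in> noncrossing_connected_graphs n k \<longleftrightarrow> A \<in> arc_graphs 1 (int n) \<and> card A = k"
    if A: "A \<subseteq> arc_pairs 1 (int n)" for A
    using noncrossing_edges_iff [OF n A] connected_edges_iff [OF n A] A card_image [OF inj [OF A]]
    unfolding noncrossing_connected_graphs_def arc_graphs_def by simp
  have "noncrossing_connected_graphs n k = image (edge n) ` {A \<in> arc_graphs 1 (int n). card A = k}"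
  proof (intro equalityI subsetI)
    fix E assume E: "E \<in> noncrossing_connected_graphs n k"
    then have "E \<subseteq> {e. e \<subseteq> {1..n} \<and> card e = 2}"
      unfolding noncrossing_connected_graphs_def noncrossing_graph_def simple_graph_def by auto
    also have "\<dots> = edge n ` arc_pairs 1 (int n)" using bij by (simp add: bij_betw_def)
    finally obtain A where A: "A \<subseteq> arc_pairs 1 (int n)" "E = edge n ` A"
      by (auto simp: subset_image_iff)
    then have "A \<in> {A \<in> arc_graphs 1 (int n). card A = k}" using E mem by simp
    with A(2) show "E \<in> image (edge n) ` {A \<in> arc_graphs 1 (int n). card A = k}" by (rule image_eqI)
  next
    fix E assume "E \<in> image (edge n) ` {A \<in> arc_graphs 1 (int n). card A = k}"
    then obtain A where "E = edge n ` A" "A \<in> arc_graphs 1 (int n)" "card A = k" by auto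
    then show "E \<in> noncrossing_connected_graphs n k" using mem arc_graphs_sub by blast
  qed
  moreover have "inj_on (image (edge n)) {A \<in> arc_graphs 1 (int n). card A = k}"
  proof (rule inj_onI)
    fix A B assume "A \<in> {A \<in> arc_graphs 1 (int n). card A = k}" "B \<in> {A \<in> arc_graphs 1 (int n). card A = k}"
      and eq: "edge n ` A = edge n ` B"
    then have "A \<subseteq> arc_pairs 1 (int n)" "B \<subseteq> arc_pairs 1 (int n)" by (auto dest: arc_graphs_sub)
    then show "A = B" using eq inj_on_image_eq_iff [OF inj [OF subset_refl]] by blast
  qed
  ultimately show ?thesis by (simp add: card_image)
qed

lemma rotate_graph_1:
  assumes "simple_graph n E"
  shows "rotate_graph n 1 E = E"
proof -
  have "rotate_vertex n 1 i = i" if "i \<in> {1..n}" for i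
  proof -
    have "(i + n - 1) mod n = (i - 1) mod n" using that by (metis Nat.add_diff_assoc2 atLeastAtMost_iff mod_add_self2)
    also have "\<dots> = i - 1" using that by (intro mod_less) auto
    finally show ?thesis using that by (simp add: rotate_vertex_def)
  qed
  then have "rotate_vertex n 1 ` e = e" if "e \<in> E" for e
    using assms that unfolding simple_graph_def by force
  then show ?thesis by (simp add: rotate_graph_def)
qed

lemma num_fixed_1:
  assumes "n > 0"
  shows "num_fixed 1 n k = card {A \<in> arc_graphs 1 (int n). card A = k}"
proof -
  have "{E \<in> noncrossing_connected_graphs n k. rotate_graph n 1 E = E} = noncrossing_connected_graphs n k"
    using rotate_graph_1 by (auto simp: noncrossing_connected_graphs_def noncrossing_graph_def)
  then show ?thesis
    using card_noncrossing_connected_graphs [OF assms] by (simp add: num_fixed_def)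
qed

section \<open>Graphs invariant under rotation\<close>

definition periodic_closure :: "nat \<Rightarrow> (int \<times> int) set \<Rightarrow> (int \<times> int) set" where
  "periodic_closure m A = {(u, v). \<exists>t. (u + t * int m, v + t * int m) \<in> A}"

text \<open>The bound \<open>m\<close> selects, among the two arcs that represent an edge on a cycle
  of length \<open>n \<ge> 2m\<close>, the short one; both survive only if \<open>n = 2m\<close> and
  the edge is a diameter. For invariant graphs no edge is lost by this
  (\<open>edges_lift_arcs\<close>).\<close>

definition lift_arcs :: "nat \<Rightarrow> nat \<Rightarrow> nat set set \<Rightarrow> (int \<times> int) set" where
  "lift_arcs n m E = {(a, b). a < b \<and> b \<le> a + int m \<and> edge n (a, b) \<in> E}"

definition short_arcs :: "nat \<Rightarrow> (int \<times> int) set \<Rightarrow> bool" where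
  "short_arcs m L \<longleftrightarrow> (\<forall>a b. (a, b) \<in> L \<longrightarrow> a < b \<and> b \<le> a + int m)"

definition periodic :: "nat \<Rightarrow> (int \<times> int) set \<Rightarrow> bool" where
  "periodic m L \<longleftrightarrow> (\<forall>a b t. (a, b) \<in> L \<longrightarrow> (a + t * int m, b + t * int m) \<in> L)"

text \<open>
  A block is a graph on \<open>i, \<dots>, i + m\<close> whose translates by multiples of \<open>m\<close> make up an invariant
  graph; requiring its longest arc from \<open>i\<close> to cover the gap between \<open>m\<close> and \<open>m + 1\<close> selects one of its translates.
\<close>

definition marked_blocks :: "nat \<Rightarrow> (int \<times> (int \<times> int) set) set" where
  "marked_blocks m = (SIGMA i:{1..int m}. {A \<in> arc_graphs i (i + int m). int m < reach i A})"

lemma periodicD: "periodic m L \<Longrightarrow> (a, b) \<in> L \<Longrightarrow> (a + t * int m, b + t * int m) \<in> L"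
  unfolding periodic_def by blast

lemma periodic_mult: "periodic m L \<Longrightarrow> periodic (d * m) L"
  unfolding periodic_def
proof (intro allI impI)
  fix a b t assume *: "\<forall>a b t. (a, b) \<in> L \<longrightarrow> (a + t * int m, b + t * int m) \<in> L" and "(a, b) \<in> L"
  then have "(a + (t * int d) * int m, b + (t * int d) * int m) \<in> L" by blast
  then show "(a + t * int (d * m), b + t * int (d * m)) \<in> L" by (simp add: mult.assoc)
qed

lemma periodic_closure_iff [simp]:
  "(u, v) \<in> periodic_closure m A \<longleftrightarrow> (\<exists>t. (u + t * int m, v + t * int m) \<in> A)"
  by (simp add: periodic_closure_def)

lemma periodic_periodic_closure: "periodic m (periodic_closure m A)"
  unfolding periodic_def
proof (intro allI impI)
  fix a b t assume "(a, b) \<in> periodic_closure m A"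
  then obtain s where "(a + s * int m, b + s * int m) \<in> A" by auto
  then have "(a + t * int m + (s - t) * int m, b + t * int m + (s - t) * int m) \<in> A"
    by (simp add: algebra_simps)
  then show "(a + t * int m, b + t * int m) \<in> periodic_closure m A"
    unfolding periodic_closure_iff by blast
qed

lemma short_arcs_periodic_closure:
  assumes "A \<in> arc_graphs i (i + int m)"
  shows "short_arcs m (periodic_closure m A)"
  unfolding short_arcs_def
proof (intro allI impI)
  fix a b assume "(a, b) \<in> periodic_closure m A"
  then obtain t where "(a + t * int m, b + t * int m) \<in> A" by auto
  then show "a < b \<and> b \<le> a + int m" using arc_graphs_arcD [OF assms] by fastforce
qed

text \<open>Distinct translates of the interval \<open>i..i+m\<close> by multiples of
  \<open>m\<close> share at most an end point.\<close>

lemma block_separation: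
  fixes m :: nat and s t i :: int
  assumes "s < t" shows "i + int m - t * int m \<le> i - s * int m"
proof -
  have "(s + 1) * int m \<le> t * int m" using assms by (intro mult_right_mono) auto
  then show ?thesis by (simp add: algebra_simps)
qed

lemma noncrossing_arcs_periodic_closure:
  assumes A: "A \<in> arc_graphs i (i + int m)"
  shows "noncrossing_arcs (periodic_closure m A)"
  unfolding noncrossing_arcs_def
proof (intro allI impI notI)
  fix u v x y
  assume "(u, v) \<in> periodic_closure m A" "(x, y) \<in> periodic_closure m A"
    and *: "u < x \<and> x < v \<and> v < y"
  then obtain s t where st: "(u + s * int m, v + s * int m) \<in> A" "(x + t * int m, y + t * int m) \<in> A"
    by auto
  note r = arc_graphs_arcD [OF A st(1)] arc_graphs_arcD [OF A st(2)]
  show False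
  proof (cases s t rule: linorder_cases)
    case less
    then show ?thesis using r * block_separation [OF less, of i m] by linarith
  next
    case equal
    moreover have "noncrossing_arcs A" using A by (simp add: arc_graphs_def)
    ultimately show ?thesis using noncrossing_arcsD [OF _ st] * by simp
  next
    case greater
    then show ?thesis using r * block_separation [OF greater, of i m] by linarith
  qed
qed

section \<open>Periodic systems of arcs and the graphs they cover\<close>

locale rotation =
  fixes n d m :: nat
  assumes d: "d \<ge> 2" and m: "m \<ge> 1" and n_eq: "n = d * m"
begin

lemma n_pos: "n > 0"
  using d m by (simp add: n_eq)

lemma n_ge: "2 * int m \<le> int n"
proof -
  have "2 * m \<le> d * m" using d by (rule mult_le_mono1)
  then show ?thesis unfolding n_eq by linarith
qed

text \<open>If the end points match in order, the lengths differ by a multiple of \<open>n\<close>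
  smaller than \<open>n\<close>, hence not at all. If they match crosswise, the two lengths add up
  to a positive multiple of \<open>n\<close>; each is at most \<open>m\<close>, so
  \<open>n = 2m\<close> and the edge is a diameter.\<close>

lemma arcs_with_same_edge:
  assumes ab: "a < b" "b \<le> a + int m" and ab': "a' < b'" "b' \<le> a' + int m"
    and eq: "edge n (a, b) = edge n (a', b')"
  obtains t where "a' = a + t * int m" and "b' = b + t * int m"
    and "int d dvd t \<or> (d = 2 \<and> b = a + int m)"
proof -
  have cases: "(vertex n a' = vertex n a \<and> vertex n b' = vertex n b) \<or>
      (vertex n a' = vertex n b \<and> vertex n b' = vertex n a)"
    using eq by (auto simp: doubleton_eq_iff)
  then show ?thesis
  proof (elim disjE conjE)
    assume "vertex n a' = vertex n a" "vertex n b' = vertex n b"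
    then have dv: "int n dvd a' - a" "int n dvd b' - b" by (simp_all add: vertex_eq_iff [OF n_pos])
    then obtain s where s: "a' - a = int n * s" by (elim dvdE)
    have "int n dvd (b' - b) - (a' - a)" by (rule dvd_diff [OF dv(2,1)])
    moreover have "\<bar>(b' - b) - (a' - a)\<bar> < int n" using ab ab' n_ge by linarith
    ultimately have "(b' - b) - (a' - a) = 0"
      using dvd_imp_le_int [of "(b' - b) - (a' - a)" "int n"] by linarith
    then have "a' = a + (int d * s) * int m" "b' = b + (int d * s) * int m"
      using s by (simp_all add: n_eq algebra_simps)
    then show ?thesis using that [of "int d * s"] by simp
  next
    assume "vertex n a' = vertex n b" "vertex n b' = vertex n a"
    then have dv: "int n dvd a' - b" "int n dvd b' - a" by (simp_all add: vertex_eq_iff [OF n_pos])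
    then obtain s where s: "a' - b = int n * s" by (elim dvdE)
    have "int n dvd (b' - a) - (a' - b)" by (rule dvd_diff [OF dv(2,1)])
    moreover have "(b' - a) - (a' - b) > 0" using ab ab' by linarith
    ultimately have "int n \<le> (b' - a) - (a' - b)" by (intro zdvd_imp_le)
    then have eqs: "b = a + int m" "b' = a' + int m" "int n = 2 * int m"
      using ab ab' n_ge by linarith+
    then have "n = 2 * m" by linarith
    then have d2: "d = 2" using m by (simp add: n_eq)
    have "a' = a + (1 + 2 * s) * int m" using s eqs by (simp add: algebra_simps)
    moreover from this have "b' = b + (1 + 2 * s) * int m" using eqs by simp
    ultimately show ?thesis using that d2 eqs by blast
  qed
qed

text \<open>Any short arc with the same edge is a translate by a multiple of \<open>m\<close>, so a
  periodic system already contains it. Thus the graph determines the system.\<close>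

lemma lift_arcs_edges:
  assumes short: "short_arcs m L" and per: "periodic m L"
  shows "lift_arcs n m (edge n ` L) = L"
proof (intro equalityI subrelI)
  fix a b assume "(a, b) \<in> lift_arcs n m (edge n ` L)"
  then have ab: "a < b" "b \<le> a + int m" and "edge n (a, b) \<in> edge n ` L"
    by (simp_all add: lift_arcs_def del: edge_simp)
  then obtain a' b' where ab': "(a', b') \<in> L" and eq: "edge n (a', b') = edge n (a, b)" by force
  have "a' < b'" "b' \<le> a' + int m" using short ab' unfolding short_arcs_def by blast+
  then obtain t where "a = a' + t * int m" "b = b' + t * int m"
    using arcs_with_same_edge [OF _ _ ab eq] by metis
  then show "(a, b) \<in> L" using periodicD [OF per ab'] by simp
next
  fix a b assume ab: "(a, b) \<in> L"
  then have "a < b" "b \<le> a + int m" using short unfolding short_arcs_def by blast+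
  then show "(a, b) \<in> lift_arcs n m (edge n ` L)"
    using ab by (simp add: lift_arcs_def del: edge_simp)
qed

lemma edge_shift: "edge n (a + t * int n, b + t * int n) = edge n (a, b)"
  using vertex_add [OF n_pos, of a t] vertex_add [OF n_pos, of b t] by (simp add: mult.commute)

text \<open>Both arcs must be brought into one turn before chords can be compared with arcs; the
  difficulty is an arc that leaves this turn.\<close>

lemma noncrossing_edges_periodic:
  assumes short: "short_arcs m L" and per: "periodic n L" and nc: "noncrossing_arcs L"
  shows "noncrossing_graph n (edge n ` L)"
  unfolding noncrossing_graph_def
proof (intro conjI ballI)
  have arc: "a < b \<and> b \<le> a + int m" if "(a, b) \<in> L" for a b
    using short that unfolding short_arcs_def by blast
  show "simple_graph n (edge n ` L)"
    unfolding simple_graph_def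
  proof
    fix e assume "e \<in> edge n ` L"
    then obtain u v where "e = edge n (u, v)" "(u, v) \<in> L" by auto
    then show "e \<subseteq> {1..n} \<and> card e = 2"
      using edge_simple [OF n_pos, of u v] arc [of u v] n_ge m by simp
  qed
  fix e f assume "e \<in> edge n ` L" "f \<in> edge n ` L"
  then obtain a b c0 d0 where ab: "(a, b) \<in> L" "e = edge n (a, b)"
    and cd0: "(c0, d0) \<in> L" "f = edge n (c0, d0)" by auto
  \<comment> \<open>Translation by this multiple of \<open>n\<close> moves the start of the second
    arc into \<open>a..a+n-1\<close> without changing its edge.\<close>
  define t where "t = - ((c0 - a) div int n)"
  define c where "c = c0 + t * int n"
  define x where "x = d0 + t * int n"
  have cx: "(c, x) \<in> L" using periodicD [OF per cd0(1)] by (simp add: c_def x_def)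
  have f: "f = edge n (c, x)" using cd0(2) edge_shift by (simp add: c_def x_def del: edge_simp)
  have "c = a + (c0 - a) mod int n" by (simp add: c_def t_def minus_div_mult_eq_mod [symmetric] algebra_simps)
  then have c: "a \<le> c" "c < a + int n" using n_pos by simp_all
  have ab': "a < b" "b \<le> a + int m" "b < a + int n" using arc [OF ab(1)] n_ge m by linarith+
  have cx': "c < x" "x \<le> c + int m" using arc [OF cx] by auto
  show "\<not> edges_cross n e f"
  proof (cases "x < a + int n")
    case True
    have "\<not> (a < c \<and> c < b \<and> b < x)" using noncrossing_arcsD [OF nc ab(1) cx] by blast
    then show ?thesis
      using edges_cross_vertices [OF n_pos ab'(1,3) c, of x] True c cx' by (simp add: ab(2) f)
  next
    case False
    \<comment> \<open>The arc leaves the turn, so its end is moved back by \<open>n\<close>. A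
      crossing of the chords then makes the whole arc translated back, \<open>(c - n, x')\<close>,
      interleave with \<open>(a, b)\<close>.\<close>
    define x' where "x' = x + (- 1) * int n"
    have x': "a \<le> x'" "x' < a + int n" "x' < c" using False cx' c n_ge m by (simp_all add: x'_def)
    have "f = {vertex n c, vertex n x'}"
      using f vertex_add [OF n_pos, of x "- 1"] by (simp add: x'_def)
    moreover have "\<not> (a < x' \<and> x' < b \<and> b < c)"
    proof
      assume *: "a < x' \<and> x' < b \<and> b < c"
      have "(c + (- 1) * int n, x') \<in> L" using periodicD [OF per cx, of "- 1"] by (simp add: x'_def)
      from noncrossing_arcsD [OF nc this ab(1)] * c show False by simp
    qed
    ultimately show ?thesis
      using edges_cross_vertices [OF n_pos ab'(1,3) c x'(1,2)] x' by (simp add: ab(2))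
  qed
qed

text \<open>From \<open>u < x < v < y\<close> and lengths at most \<open>m\<close> follows
  \<open>y < u + 2m \<le> u + n\<close>, so interleaved arcs lie in one turn and their chords really
  cross.\<close>

lemma noncrossing_arcs_lift_arcs:
  assumes "noncrossing_graph n E"
  shows "noncrossing_arcs (lift_arcs n m E)"
  unfolding noncrossing_arcs_def
proof (intro allI impI notI)
  fix u v x y assume "(u, v) \<in> lift_arcs n m E" "(x, y) \<in> lift_arcs n m E"
    and *: "u < x \<and> x < v \<and> v < y"
  then have uv: "u < v" "v \<le> u + int m" "edge n (u, v) \<in> E"
    and xy: "x < y" "y \<le> x + int m" "edge n (x, y) \<in> E"
    by (simp_all add: lift_arcs_def del: edge_simp)
  have "\<not> edges_cross n (edge n (u, v)) (edge n (x, y))"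
    using assms uv xy unfolding noncrossing_graph_def by blast
  moreover have "edges_cross n (edge n (u, v)) (edge n (x, y))"
    unfolding edge_simp using edges_cross_vertices [OF n_pos, of u v x y] uv xy * n_ge by simp
  ultimately show False by blast
qed

lemma rotate_vertex_vertex: "rotate_vertex n d (vertex n x) = vertex n (x + int m)"
proof -
  have "n div d = m" using d by (simp add: n_eq)
  moreover have "int ((nat ((x - 1) mod int n) + m) mod n) = ((x - 1) mod int n + int m) mod int n"
    using n_pos by (simp add: zmod_int)
  moreover have "\<dots> = ((x - 1) + int m) mod int n" by (rule mod_add_left_eq)
  moreover have "(x - 1) + int m = x + int m - 1" by simp
  ultimately have "int ((vertex n x + n div d - 1) mod n) = (x + int m - 1) mod int n"
    by (simp add: vertex_def)
  then show ?thesis unfolding rotate_vertex_def vertex_def by linarith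
qed

lemma rotate_edge: "rotate_vertex n d ` edge n (u, v) = edge n (u + int m, v + int m)"
  by (simp add: rotate_vertex_vertex)

lemma rotate_graph_periodic:
  assumes "periodic m L"
  shows "rotate_graph n d (edge n ` L) = edge n ` L"
proof (intro equalityI subsetI)
  fix e assume "e \<in> rotate_graph n d (edge n ` L)"
  then obtain u v where uv: "(u, v) \<in> L" "e = edge n (u + int m, v + int m)"
    unfolding rotate_graph_def using rotate_edge by force
  then show "e \<in> edge n ` L" using periodicD [OF assms uv(1), of 1] by (auto simp del: edge_simp)
next
  fix e assume "e \<in> edge n ` L"
  then obtain u v where uv: "(u, v) \<in> L" "e = edge n (u, v)" by auto
  then have "(u - int m, v - int m) \<in> L" using periodicD [OF assms uv(1), of "- 1"] by simp
  moreover have "e = rotate_vertex n d ` edge n (u - int m, v - int m)"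
    using rotate_edge [of "u - int m" "v - int m"] uv(2) by simp
  ultimately show "e \<in> rotate_graph n d (edge n ` L)" unfolding rotate_graph_def by blast
qed

text \<open>Each translate of the block is connected, and consecutive translates share an end point,
  through which the colour propagates along the line.\<close>

lemma connected_edges_periodic_closure:
  assumes A: "A \<in> arc_graphs i (i + int m)"
  shows "connected_graph n (edge n ` periodic_closure m A)"
proof (rule connected_graphI)
  fix g :: "nat \<Rightarrow> bool" and u v
  assume g: "\<And>p q. {p, q} \<in> edge n ` periodic_closure m A \<Longrightarrow> g p = g q"
    and uv: "u \<in> {1..n}" "v \<in> {1..n}"
  define f where "f = (\<lambda>w. g (vertex n w))"
  have "constant_on_arcs (\<lambda>w. g (vertex n w)) (periodic_closure m A)"
    using constant_on_edges_iff [of n "periodic_closure m A" g] g by blast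
  then have f: "f a = f b" if "(a, b) \<in> periodic_closure m A" for a b
    using that unfolding f_def constant_on_arcs_def by blast
  have conn: "connected_arcs i (i + int m) A" using A by (simp add: arc_graphs_def)
  have block: "f (w + t * int m) = f (i + t * int m)" if w: "i \<le> w" "w \<le> i + int m" for w t
  proof -
    have "constant_on_arcs (\<lambda>w. f (w + t * int m)) A"
      unfolding constant_on_arcs_def
    proof (intro allI impI)
      fix a b assume "(a, b) \<in> A"
      then have "(a + t * int m, b + t * int m) \<in> periodic_closure m A"
        by (auto intro!: exI [of _ "- t"])
      then show "f (a + t * int m) = f (b + t * int m)" by (rule f)
    qed
    from connected_arcsD [OF conn this w] show ?thesis .
  qed
  have step: "f (i + (t + 1) * int m) = f (i + t * int m)" for t
    using block [of "i + int m" t] by (simp add: algebra_simps)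
  have base: "f (i + t * int m) = f i" for t
  proof (induction t rule: int_induct [where k = 0])
    case (step1 t)
    then show ?case using step [of t] by simp
  next
    case (step2 t)
    then show ?case using step [of "t - 1"] by simp
  qed simp
  have all: "f w = f i" for w
  proof -
    define t where "t = (w - i) div int m"
    define r where "r = (w - i) mod int m"
    have "w = (i + r) + t * int m" by (simp add: t_def r_def)
    moreover have "0 \<le> r" "r < int m" using m by (simp_all add: r_def)
    ultimately show ?thesis using block [of "i + r" t] base [of t] by simp
  qed
  have "g u = f (int u)" "g v = f (int v)" using uv by (simp_all add: f_def vertex_int)
  then show "g u = g v" using all [of "int u"] all [of "int v"] by simp
qed

end

section \<open>Recovering a marked block from its periodic closure\<close>

lemma subset_periodic_closure: "A \<subseteq> periodic_closure m A"
proof (rule subrelI)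
  fix a b assume "(a, b) \<in> A"
  then have "(a + 0 * int m, b + 0 * int m) \<in> A" by simp
  then show "(a, b) \<in> periodic_closure m A" unfolding periodic_closure_iff by blast
qed

lemma periodic_closure_block:
  assumes A: "A \<in> arc_graphs i (i + int m)"
  shows "periodic_closure m A \<inter> arc_pairs i (i + int m) = A"
proof (intro equalityI subrelI)
  fix a b assume ab: "(a, b) \<in> A"
  then show "(a, b) \<in> periodic_closure m A \<inter> arc_pairs i (i + int m)"
    using arc_graphs_arcD [OF A ab] subsetD [OF subset_periodic_closure ab] by simp
next
  fix a b assume "(a, b) \<in> periodic_closure m A \<inter> arc_pairs i (i + int m)"
  then obtain t where t: "(a + t * int m, b + t * int m) \<in> A" and ab: "i \<le> a" "a < b" "b \<le> i + int m"
    by auto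
  note r = arc_graphs_arcD [OF A t]
  have "t = 0"
  proof (cases t "0 :: int" rule: linorder_cases)
    case less
    then show ?thesis using r ab block_separation [OF less, of i m] by linarith
  next
    case greater
    then show ?thesis using r ab block_separation [OF greater, of i m] by linarith
  qed simp
  then show "(a, b) \<in> A" using t by simp
qed

text \<open>Arcs in translates to the left of the block end at or before \<open>i \<le> m\<close>.
  Hence \<open>i\<close> is the least start of an arc ending beyond \<open>m\<close>, a description
  by the closure alone, which gives injectivity.\<close>

lemma block_start_least:
  assumes A: "A \<in> arc_graphs i (i + int m)" and i: "i \<le> int m"
    and ab: "(a, b) \<in> periodic_closure m A" "int m < b"
  shows "i \<le> a"
proof -
  obtain t where t: "(a + t * int m, b + t * int m) \<in> A" using ab by auto
  note r = arc_graphs_arcD [OF A t]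
  show ?thesis
  proof (cases "t \<le> 0")
    case True
    then have "t * int m \<le> 0" by (simp add: mult_nonpos_nonneg)
    then show ?thesis using r by linarith
  next
    case False
    then have "0 < t" by simp
    from block_separation [OF this, of i m] show ?thesis using r ab i by linarith
  qed
qed

context rotation
begin

definition block_graph :: "int \<times> (int \<times> int) set \<Rightarrow> nat set set" where
  "block_graph = (\<lambda>(i, A). edge n ` periodic_closure m A)"

lemma marked_blocksD:
  assumes "(i, A) \<in> marked_blocks m"
  shows "1 \<le> i" "i \<le> int m" "A \<in> arc_graphs i (i + int m)" "int m < reach i A" "(i, reach i A) \<in> A"
  using assms m reach_props(1) [of A i "i + int m"] by (simp_all add: marked_blocks_def)

lemma inj_on_block_graph: "inj_on block_graph (marked_blocks m)"
proof (rule inj_onI)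
  fix p q assume p: "p \<in> marked_blocks m" and q: "q \<in> marked_blocks m"
    and eq: "block_graph p = block_graph q"
  obtain i A where p': "p = (i, A)" by (cases p)
  obtain j B where q': "q = (j, B)" by (cases q)
  note iA = marked_blocksD [OF p [unfolded p']] and jB = marked_blocksD [OF q [unfolded q']]
  have lift: "lift_arcs n m (edge n ` periodic_closure m X) = periodic_closure m X"
    if "X \<in> arc_graphs k (k + int m)" for X k
    by (rule lift_arcs_edges [OF short_arcs_periodic_closure [OF that] periodic_periodic_closure])
  have eq': "edge n ` periodic_closure m A = edge n ` periodic_closure m B"
    using eq unfolding block_graph_def p' q' by simp
  have L: "periodic_closure m A = periodic_closure m B"
    using lift [OF iA(3)] unfolding eq' lift [OF jB(3)] by (rule sym)
  have A: "(i, reach i A) \<in> periodic_closure m A" and B: "(j, reach j B) \<in> periodic_closure m B"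
    by (rule subsetD [OF subset_periodic_closure iA(5)], rule subsetD [OF subset_periodic_closure jB(5)])
  have "i = j"
  proof (rule order_antisym)
    show "i \<le> j" by (rule block_start_least [OF iA(3,2) B [folded L] jB(4)])
    show "j \<le> i" by (rule block_start_least [OF jB(3,2) A [unfolded L] iA(4)])
  qed
  moreover have "A = B"
    using periodic_closure_block [OF iA(3)] periodic_closure_block [OF jB(3)]
    unfolding L \<open>i = j\<close> by (rule trans [OF sym])
  ultimately show "p = q" by (simp add: p' q')
qed

definition symmetric_graphs :: "nat set set set" where
  "symmetric_graphs = {E. noncrossing_graph n E \<and> connected_graph n E \<and> rotate_graph n d E = E}"

lemma block_graph_symmetric:
  assumes "p \<in> marked_blocks m"
  shows "block_graph p \<in> symmetric_graphs"
proof -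
  obtain i A where p: "p = (i, A)" by (cases p)
  note A = marked_blocksD(3) [OF assms [unfolded p]]
  have "periodic n (periodic_closure m A)"
    unfolding n_eq by (rule periodic_mult [OF periodic_periodic_closure])
  then show ?thesis
    using noncrossing_edges_periodic [OF short_arcs_periodic_closure [OF A] _ noncrossing_arcs_periodic_closure [OF A]]
      connected_edges_periodic_closure [OF A] rotate_graph_periodic [OF periodic_periodic_closure]
    by (simp add: symmetric_graphs_def block_graph_def p)
qed

section \<open>From an invariant graph back to its block\<close>

lemma periodic_lift_arcs:
  assumes "rotate_graph n d E = E"
  shows "periodic m (lift_arcs n m E)"
  unfolding periodic_def
proof (intro allI impI)
  fix a b t assume ab: "(a, b) \<in> lift_arcs n m E"
  then have E: "edge n (a, b) \<in> E" by (simp add: lift_arcs_def del: edge_simp)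
  have step: "edge n (a + int j * int m, b + int j * int m) \<in> E" for j
  proof (induction j)
    case 0
    then show ?case using E by simp
  next
    case (Suc j)
    then have "rotate_vertex n d ` edge n (a + int j * int m, b + int j * int m) \<in> rotate_graph n d E"
      unfolding rotate_graph_def by (rule imageI)
    then have "edge n (a + int j * int m + int m, b + int j * int m + int m) \<in> E"
      unfolding rotate_edge assms .
    moreover have "x + int j * int m + int m = x + int (Suc j) * int m" for x
      by (simp add: algebra_simps)
    ultimately show ?case by (simp only:)
  qed
  \<comment> \<open>Iterating the rotation yields only non-negative multiples of \<open>m\<close>;
    an arbitrary \<open>t\<close> is reduced modulo \<open>d\<close>, and the rest is a multiple of
    \<open>n\<close>, which \<open>edge\<close> ignores.\<close>
  define j where "j = nat (t mod int d)"
  have "int j = t mod int d" using d by (simp add: j_def)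
  then have t: "t = int j + (t div int d) * int d" by simp
  have shift: "x + t * int m = (x + int j * int m) + (t div int d) * int n" for x
  proof -
    have "t * int m = (int j + (t div int d) * int d) * int m" by (subst t) (rule refl)
    then show ?thesis by (simp add: n_eq distrib_right mult.assoc)
  qed
  have "edge n (a + t * int m, b + t * int m) \<in> E"
    unfolding shift [of a] shift [of b] edge_shift by (rule step)
  then show "(a + t * int m, b + t * int m) \<in> lift_arcs n m E"
    using ab by (simp add: lift_arcs_def del: edge_simp)
qed

text \<open>
  An edge that is longer than \<open>m\<close> in both directions crosses its own rotation.
\<close>
lemma edges_lift_arcs:
  assumes nc: "noncrossing_graph n E" and rot: "rotate_graph n d E = E"
  shows "edge n ` lift_arcs n m E = E"
proof (intro equalityI subsetI)
  fix e assume "e \<in> edge n ` lift_arcs n m E"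
  then show "e \<in> E" by (auto simp: lift_arcs_def simp del: edge_simp)
next
  fix e assume e: "e \<in> E"
  then have "e \<subseteq> {1..n}" "card e = 2"
    using nc unfolding noncrossing_graph_def simple_graph_def by blast+
  then have "e \<in> edge n ` arc_pairs 1 (int n)"
    using bij_betw_edge [OF n_pos] by (auto simp: bij_betw_def)
  then obtain u v where uv: "1 \<le> u" "u < v" "v \<le> int n" "e = edge n (u, v)" by auto
  have "v \<le> u + int m \<or> u + int n \<le> v + int m"
  proof (rule ccontr)
    assume *: "\<not> ?thesis"
    have "rotate_vertex n d ` e \<in> rotate_graph n d E" unfolding rotate_graph_def using e by (rule imageI)
    then have "edge n (u + int m, v + int m) \<in> E" unfolding rot uv(4) rotate_edge .
    then have "\<not> edges_cross n (edge n (u, v)) (edge n (u + int m, v + int m))"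
      using nc e uv(4) unfolding noncrossing_graph_def by blast
    moreover have "edges_cross n (edge n (u, v)) (edge n (u + int m, v + int m))"
      unfolding edge_simp
      using edges_cross_vertices [OF n_pos, of u v "u + int m" "v + int m"] uv * m by simp
    ultimately show False by blast
  qed
  then show "e \<in> edge n ` lift_arcs n m E"
  proof
    assume "v \<le> u + int m"
    then have "(u, v) \<in> lift_arcs n m E" using uv e by (simp add: lift_arcs_def del: edge_simp)
    then show ?thesis unfolding uv(4) by (rule imageI)
  next
    assume *: "u + int n \<le> v + int m"
    have eq: "edge n (v, u + int n) = e"
      using vertex_add [OF n_pos, of u 1] by (simp add: uv(4) insert_commute)
    then have "(v, u + int n) \<in> lift_arcs n m E"
      using uv e * by (simp add: lift_arcs_def del: edge_simp)
    then have "edge n (v, u + int n) \<in> edge n ` lift_arcs n m E" by (rule imageI)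
    then show ?thesis unfolding eq .
  qed
qed

text \<open>A colouring of the line with period \<open>n\<close> descends to the vertices, so
  connectedness can be tested upstairs.\<close>

lemma connected_edges_colouring:
  assumes conn: "connected_graph n (edge n ` L)" and per: "\<And>w t. h (w + t * int n) = h w"
    and h: "\<And>a b. (a, b) \<in> L \<Longrightarrow> h a = h b"
  shows "(h w :: bool) = h w'"
proof -
  define g where "g = (\<lambda>p. h (int p))"
  have gv: "g (vertex n x) = h x" for x
  proof -
    have "int n dvd int (vertex n x) - x"
      using vertex_int [of "int (vertex n x)" n] vertex_range [OF n_pos, of x]
      by (simp flip: vertex_eq_iff [OF n_pos])
    then obtain t where "int (vertex n x) - x = int n * t" by (elim dvdE)
    then have "int (vertex n x) = x + t * int n" by (simp add: algebra_simps)
    then show ?thesis using per [of x t] by (simp add: g_def)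
  qed
  have "constant_on_arcs (\<lambda>w. g (vertex n w)) L"
    unfolding constant_on_arcs_def gv using h by blast
  then have "g p = g q" if "{p, q} \<in> edge n ` L" for p q
    using that constant_on_edges_iff [of n L g] by blast
  from connected_graph_colouring [of n _ g, OF conn this vertex_range [OF n_pos, of w] vertex_range [OF n_pos, of w']]
  show ?thesis unfolding gv .
qed

text \<open>Otherwise, by periodicity, no arc passes over any gap between \<open>s m\<close> and
  \<open>s m + 1\<close>. Colouring the stretch \<open>s m + 1..(s+1) m\<close> by whether
  \<open>d\<close> divides \<open>s\<close> then separates 1 from \<open>1 + m\<close>.\<close>

lemma exists_arc_over_gap:
  assumes conn: "connected_graph n (edge n ` L)" and per: "periodic m L" and short: "short_arcs m L"
  obtains a b where "(a, b) \<in> L" and "a \<le> int m" and "int m < b"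
proof (rule ccontr)
  note gap = that
  assume no: "\<not> thesis"
  define h where "h = (\<lambda>w. int d dvd (w - 1) div int m)"
  have same: "(a - 1) div int m = (b - 1) div int m" if ab: "(a, b) \<in> L" for a b
  proof (rule ccontr)
    assume ne: "(a - 1) div int m \<noteq> (b - 1) div int m"
    have "a < b" using short ab unfolding short_arcs_def by blast
    then have "(a - 1) div int m \<le> (b - 1) div int m" using m by (intro zdiv_mono1) auto
    then have lt: "(a - 1) div int m < (b - 1) div int m" using ne by simp
    \<comment> \<open>The arc passes over the gap after \<open>s m\<close>; translation by
      \<open>(1 - s) m\<close> moves it over the gap after \<open>m\<close>.\<close>
    define s where "s = (b - 1) div int m"
    have "s * int m \<le> b - 1"
      unfolding s_def using m by (metis div_mult_mod_eq le_add_same_cancel1 of_nat_0_less_iff pos_mod_sign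
          less_le_trans zero_less_one)
    moreover have "a - 1 < s * int m"
    proof -
      have "(a - 1) div int m + 1 \<le> s" using lt by (simp add: s_def)
      then have "((a - 1) div int m + 1) * int m \<le> s * int m" by (intro mult_right_mono) auto
      moreover have "a - 1 < ((a - 1) div int m + 1) * int m"
      proof -
        have "(a - 1) mod int m < int m" using m by simp
        moreover have "a - 1 = (a - 1) div int m * int m + (a - 1) mod int m" by simp
        ultimately show ?thesis unfolding distrib_right by linarith
      qed
      ultimately show ?thesis by linarith
    qed
    ultimately have "a + (1 - s) * int m \<le> int m" "int m < b + (1 - s) * int m"
      by (simp_all add: algebra_simps)
    then show False using gap [OF periodicD [OF per ab, of "1 - s"]] no by blast
  qed
  have "h w = h w'" for w w'
  proof (rule connected_edges_colouring [OF conn])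
    show "h (w + t * int n) = h w" for w t
    proof -
      have "(w + t * int n - 1) div int m = ((w - 1) + (t * int d) * int m) div int m"
        by (simp add: n_eq algebra_simps)
      also have "\<dots> = (w - 1) div int m + t * int d" using m by simp
      finally show ?thesis by (simp add: h_def)
    qed
    show "h a = h b" if "(a, b) \<in> L" for a b using same [OF that] by (simp add: h_def)
  qed
  then have "h 1 = h (1 + int m)" .
  then show False using d m by (simp add: h_def)
qed

text \<open>A colouring \<open>f\<close> of the block can be copied periodically only if it agrees
  at the two ends \<open>i\<close> and \<open>i + m\<close>, which are identified. Agreement is
  therefore proved first, by a different colouring of the whole graph. Here \<open>q\<close> is the
  number of the translate containing a point and \<open>r\<close> its position in the block; the
  right end counts as the start of the next translate.\<close>

lemma block_connected:
  assumes conn: "connected_graph n (edge n ` L)"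
    and L: "\<And>a b. (a, b) \<in> L \<Longrightarrow> \<exists>t. (a - t * int m, b - t * int m) \<in> A"
    and A: "A \<subseteq> arc_pairs i (i + int m)"
  shows "connected_arcs i (i + int m) A"
  unfolding connected_arcs_def
proof (intro allI impI)
  fix f w assume f: "constant_on_arcs f A" and w: "i \<le> w \<and> w \<le> i + int m"
  define q where "q = (\<lambda>w. (w - i) div int m)"
  define r where "r = (\<lambda>w. i + (w - i) mod int m)"
  have qr: "q (x + t * int m) = t" "r (x + t * int m) = x" if "i \<le> x" "x < i + int m" for x t
  proof -
    have eq: "x + t * int m - i = (x - i) + t * int m" by simp
    show "q (x + t * int m) = t" unfolding q_def eq using that by simp
    show "r (x + t * int m) = x" unfolding r_def eq using that by simp
  qed
  have qr': "q (i + int m + t * int m) = t + 1" "r (i + int m + t * int m) = i" for t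
    using qr [of i "t + 1"] m by (simp_all add: algebra_simps)
  have qn: "q (x + t * int n) = q x + t * int d" "r (x + t * int n) = r x" for x t
  proof -
    have eq: "x + t * int n - i = (x - i) + (t * int d) * int m" by (simp add: n_eq)
    show "q (x + t * int n) = q x + t * int d" unfolding q_def eq using m by simp
    show "r (x + t * int n) = r x" unfolding r_def eq using m by simp
  qed
  have arc: "\<exists>u v t. a = u + t * int m \<and> b = v + t * int m \<and> f u = f v \<and> i \<le> u \<and> u < v \<and> v \<le> i + int m"
    if ab: "(a, b) \<in> L" for a b
  proof -
    obtain t where t: "(a - t * int m, b - t * int m) \<in> A" using L [OF ab] by blast
    then have "f (a - t * int m) = f (b - t * int m)" using f unfolding constant_on_arcs_def by blast
    then show ?thesis using t A by (intro exI [of _ "a - t * int m"] exI [of _ "b - t * int m"] exI [of _ t]) auto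
  qed
  have ends: "f i = f (i + int m)"
  proof (rule ccontr)
    assume ne: "f i \<noteq> f (i + int m)"
    \<comment> \<open>If the ends differ, \<open>h\<close> follows \<open>f\<close> in translate 0,
      where it drops from true to false, and follows \<open>f\<close> compared with the other end in
      translate -1, where it rises back; all other translates modulo \<open>d\<close> are false. The
      values fit at every common end point.\<close>
    define h where "h = (\<lambda>w. if int d dvd q w then f (r w) = f i
        else if int d dvd q w + 1 then f (r w) = f (i + int m) else False)"
    have "h x = h x'" for x x'
    proof (rule connected_edges_colouring [OF conn])
      show "h (x + t * int n) = h x" for x t
      proof -
        have "int d dvd q x + t * int d + 1 \<longleftrightarrow> int d dvd (q x + 1) + t * int d"
          by (simp add: algebra_simps)
        then show ?thesis by (simp add: h_def qn)
      qed
      show "h a = h b" if ab: "(a, b) \<in> L" for a b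
      proof -
        obtain u v t where uv: "a = u + t * int m" "b = v + t * int m" "f u = f v"
            "i \<le> u" "u < v" "v \<le> i + int m"
          using arc [OF ab] by blast
        have a: "q a = t" "r a = u" using qr [of u t] uv by simp_all
        show ?thesis
        proof (cases "v = i + int m")
          case False
          then have "q b = t" "r b = v" using qr [of v t] uv by simp_all
          then show ?thesis using a uv(3) by (simp add: h_def)
        next
          case True
          then have b: "q b = t + 1" "r b = i" using qr' [of t] uv(2) by simp_all
          have nd: "\<not> int d dvd 1" using d by simp
          consider "int d dvd t" | "int d dvd t + 1" "\<not> int d dvd t" | "\<not> int d dvd t" "\<not> int d dvd t + 1"
            by blast
          then show ?thesis
          proof cases
            case 1
            then have "\<not> int d dvd t + 1" using nd by (simp add: dvd_add_right_iff)
            then show ?thesis using 1 a b uv(3) True ne by (simp add: h_def)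
          next
            case 2
            then show ?thesis using a b uv(3) True by (simp add: h_def)
          next
            case 3
            then show ?thesis using a b ne by (simp add: h_def)
          qed
        qed
      qed
    qed
    then have hh: "h i = h (i + int m)" .
    have "q i = 0" "r i = i" using qr [of i 0] m by simp_all
    then have "h i" by (simp add: h_def)
    moreover have "q (i + int m) = 1" "r (i + int m) = i" using qr' [of 0] by simp_all
    then have "\<not> h (i + int m)" using ne d by (simp add: h_def)
    ultimately show False using hh by simp
  qed
  \<comment> \<open>Now that the ends agree, copying \<open>f\<close> to all translates gives a
    well-defined colouring constant on all arcs.\<close>
  have "f (r x) = f (r x')" for x x'
  proof (rule connected_edges_colouring [OF conn, where h = "\<lambda>x. f (r x)"])
    show "f (r (x + t * int n)) = f (r x)" for x t by (simp add: qn)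
    show "f (r a) = f (r b)" if ab: "(a, b) \<in> L" for a b
    proof -
      obtain u v t where uv: "a = u + t * int m" "b = v + t * int m" "f u = f v"
          "i \<le> u" "u < v" "v \<le> i + int m"
        using arc [OF ab] by blast
      have a: "r a = u" using qr(2) [of u t] uv by simp
      show ?thesis
      proof (cases "v = i + int m")
        case False
        then have "r b = v" using qr(2) [of v t] uv by simp
        then show ?thesis using a uv(3) by simp
      next
        case True
        then have "r b = i" using qr'(2) [of t] uv(2) by simp
        then show ?thesis using a uv(3) True ends by simp
      qed
    qed
  qed
  then have *: "f (r w) = f (r i)" .
  have "r i = i" using qr(2) [of i 0] m by simp
  moreover have "r w = w \<or> (w = i + int m)" using qr(2) [of w 0] w by force
  ultimately show "f w = f i" using * ends by auto
qed

end

context rotation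
begin

text \<open>The block starts at the least \<open>i\<close> that begins an arc over the gap after
  \<open>m\<close>. The point is that no arc of the lift passes over a translate of
  \<open>i\<close>, so the lift is cut into copies of one block.\<close>

lemma block_graph_surj:
  assumes E: "E \<in> symmetric_graphs"
  shows "E \<in> block_graph ` marked_blocks m"
proof -
  have nc: "noncrossing_graph n E" and connE: "connected_graph n E" and rot: "rotate_graph n d E = E"
    using E by (simp_all add: symmetric_graphs_def)
  define L where "L = lift_arcs n m E"
  have per: "periodic m L" unfolding L_def by (rule periodic_lift_arcs [OF rot])
  have ncL: "noncrossing_arcs L" unfolding L_def by (rule noncrossing_arcs_lift_arcs [OF nc])
  have EL: "edge n ` L = E" unfolding L_def by (rule edges_lift_arcs [OF nc rot])
  have short: "short_arcs m L" unfolding L_def short_arcs_def by (simp add: lift_arcs_def)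
  have arc: "a < b" "b \<le> a + int m" if "(a, b) \<in> L" for a b
    using short that unfolding short_arcs_def by blast+
  have conn: "connected_graph n (edge n ` L)" unfolding EL by (rule connE)
  define S where "S = {a. \<exists>b. (a, b) \<in> L \<and> a \<le> int m \<and> int m < b}"
  have "S \<subseteq> {1..int m}"
  proof
    fix a assume "a \<in> S"
    then obtain b where "(a, b) \<in> L" "a \<le> int m" "int m < b" by (auto simp: S_def)
    then show "a \<in> {1..int m}" using arc [of a b] by simp
  qed
  then have finS: "finite S" by (rule finite_subset) simp
  obtain a0 b0 where "(a0, b0) \<in> L" "a0 \<le> int m" "int m < b0"
    by (rule exists_arc_over_gap [OF conn per short])
  then have "a0 \<in> S" unfolding S_def by blast
  then have "S \<noteq> {}" by blast
  define i where "i = Min S"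
  have iS: "i \<in> S" unfolding i_def using finS \<open>S \<noteq> {}\<close> by (rule Min_in)
  have imin: "i \<le> a" if "a \<in> S" for a unfolding i_def using finS that by (rule Min_le)
  have i: "1 \<le> i" "i \<le> int m" using iS \<open>S \<subseteq> {1..int m}\<close> by auto
  obtain l where l: "(i, l) \<in> L" "int m < l" using iS by (auto simp: S_def)
  define A where "A = L \<inter> arc_pairs i (i + int m)"
  have cut: "\<exists>t. (a - t * int m, b - t * int m) \<in> A" if ab: "(a, b) \<in> L" for a b
  proof -
    define t where "t = (a - i) div int m"
    define u where "u = a - t * int m"
    define v where "v = b - t * int m"
    have uv: "(u, v) \<in> L" using periodicD [OF per ab, of "- t"] by (simp add: u_def v_def)
    have "u = i + (a - i) mod int m" by (simp add: u_def t_def minus_div_mult_eq_mod [symmetric])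
    then have u: "i \<le> u" "u < i + int m" using m by simp_all
    have "v \<le> i + int m"
    proof (rule ccontr)
      assume "\<not> v \<le> i + int m"
      \<comment> \<open>Moved back by \<open>m\<close>, the arc passes over \<open>i\<close>. If it
        ends beyond \<open>m\<close>, its start contradicts the minimality of \<open>i\<close>;
        otherwise it crosses the arc \<open>(i, l)\<close>.\<close>
      define x where "x = u - int m"
      define y where "y = v - int m"
      have xy: "(x, y) \<in> L" using periodicD [OF per uv, of "- 1"] by (simp add: x_def y_def)
      have *: "x < i" "i < y" using u \<open>\<not> v \<le> i + int m\<close> by (simp_all add: x_def y_def)
      show False
      proof (cases "int m < y")
        case True
        then have "x \<in> S" using xy * i by (auto simp: S_def)
        then show False using imin [of x] * by simp
      next
        case False
        then show False using noncrossing_arcsD [OF ncL xy l(1)] * l(2) by simp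
      qed
    qed
    then have "(u, v) \<in> A" using uv u arc [OF uv] by (simp add: A_def)
    then show ?thesis unfolding u_def v_def by blast
  qed
  have "connected_arcs i (i + int m) A"
    by (rule block_connected [OF conn cut]) (simp_all add: A_def)
  moreover have "noncrossing_arcs A" by (rule noncrossing_arcs_mono [OF ncL]) (simp add: A_def)
  ultimately have A: "A \<in> arc_graphs i (i + int m)" by (simp add: arc_graphs_def A_def)
  have "periodic_closure m A = L"
  proof (intro equalityI subrelI)
    fix a b assume "(a, b) \<in> periodic_closure m A"
    then obtain t where "(a + t * int m, b + t * int m) \<in> L" by (auto simp: A_def)
    from periodicD [OF per this, of "- t"] show "(a, b) \<in> L" by simp
  next
    fix a b assume "(a, b) \<in> L"
    from cut [OF this] obtain t where "(a - t * int m, b - t * int m) \<in> A" by blast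
    then have "(a + (- t) * int m, b + (- t) * int m) \<in> A" by simp
    then show "(a, b) \<in> periodic_closure m A" unfolding periodic_closure_iff by blast
  qed
  then have "E = block_graph (i, A)" by (simp add: block_graph_def EL)
  moreover have "(i, l) \<in> A" using l arc [OF l(1)] by (simp add: A_def)
  then have "int m < reach i A" using reach_ge [OF A, of l] l(2) by simp
  then have "(i, A) \<in> marked_blocks m" using A i by (simp add: marked_blocks_def)
  ultimately show ?thesis by (rule image_eqI)
qed

lemma bij_betw_block_graph: "bij_betw block_graph (marked_blocks m) symmetric_graphs"
proof (rule bij_betw_imageI [OF inj_on_block_graph])
  show "block_graph ` marked_blocks m = symmetric_graphs"
    using block_graph_symmetric block_graph_surj by blast
qed

text \<open>Arcs with the same edge differ by a multiple of \<open>m\<close>, but two arcs of one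
  block start less than \<open>m\<close> apart, so they are equal; only the translate may still
  differ, and only for a diameter.\<close>

lemma edge_block_cases:
  assumes A: "A \<in> arc_graphs i (i + int m)" and uv: "(u, v) \<in> A" and uv': "(u', v') \<in> A"
    and j: "j < d" "j' < d"
    and eq: "edge n (u + int j * int m, v + int j * int m) = edge n (u' + int j' * int m, v' + int j' * int m)"
  shows "u' = u \<and> v' = v \<and> (j' = j \<or> (d = 2 \<and> u = i \<and> v = i + int m))"
proof -
  note r = arc_graphs_arcD [OF A uv] arc_graphs_arcD [OF A uv']
  obtain t where t: "u' + int j' * int m = u + int j * int m + t * int m"
      "v' + int j' * int m = v + int j * int m + t * int m"
      "int d dvd t \<or> (d = 2 \<and> v + int j * int m = u + int j * int m + int m)"
    using arcs_with_same_edge [OF _ _ _ _ eq] r by auto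
  define s where "s = int j + t - int j'"
  have su: "u' - u = int m * s" and sv: "v' - v = int m * s"
    using t(1,2) by (simp_all add: s_def algebra_simps)
  have "\<bar>u' - u\<bar> < int m" using r by linarith
  moreover have "int m dvd u' - u" unfolding su by simp
  ultimately have "u' - u = 0" using dvd_imp_le_int [of "u' - u" "int m"] by linarith
  then have "s = 0" using su m by simp
  then have "u' = u" "v' = v" "t = int j' - int j" using su sv by (simp_all add: s_def)
  moreover have "j' = j \<or> (d = 2 \<and> u = i \<and> v = i + int m)"
    using t(3)
  proof
    assume "int d dvd t"
    moreover have "\<bar>t\<bar> < int d" using \<open>t = int j' - int j\<close> j by linarith
    ultimately have "t = 0" using dvd_imp_le_int [of t "int d"] by linarith
    then show ?thesis using \<open>t = int j' - int j\<close> by simp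
  next
    assume "d = 2 \<and> v + int j * int m = u + int j * int m + int m"
    then show ?thesis using r by simp
  qed
  ultimately show ?thesis by simp
qed

text \<open>The \<open>d\<close> copies of the block share no edge, except that for
  \<open>d = 2\<close> both copies of the arc joining its ends give the same diameter. The
  correction is added on the left to avoid truncated subtraction.\<close>

lemma card_block_graph:
  assumes p: "(i, A) \<in> marked_blocks m"
  shows "card (block_graph (i, A)) + (if d = 2 \<and> (i, i + int m) \<in> A then 1 else 0) = d * card A"
proof -
  note A = marked_blocksD(3) [OF p]
  have finA: "finite A" by (rule arc_graphs_finite [OF A])
  define g where "g = (\<lambda>((u, v), j). edge n (u + int j * int m, v + int j * int m))"
  have image: "block_graph (i, A) = g ` (A \<times> {..<d})"
  proof (intro equalityI subsetI)
    fix e assume "e \<in> block_graph (i, A)"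
    then obtain a b where ab: "(a, b) \<in> periodic_closure m A" "e = edge n (a, b)"
      by (auto simp: block_graph_def simp del: edge_simp)
    then obtain t where t: "(a + t * int m, b + t * int m) \<in> A" by auto
    define j where "j = nat ((- t) mod int d)"
    define s where "s = (- t) div int d"
    have j: "int j = (- t) mod int d" using d by (simp add: j_def)
    have "- t = s * int d + int j" unfolding j s_def by simp
    then have zero: "t + int j + s * int d = 0" by linarith
    have eq: "(x + t * int m + int j * int m) + s * int n = x" for x
    proof -
      have "(x + t * int m + int j * int m) + s * int n = x + (t + int j + s * int d) * int m"
        by (simp add: n_eq algebra_simps)
      then show ?thesis unfolding zero by simp
    qed
    have "e = g ((a + t * int m, b + t * int m), j)"
      unfolding g_def prod.case ab(2)
      using edge_shift [of "a + t * int m + int j * int m" s "b + t * int m + int j * int m"]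
      unfolding eq .
    moreover have "(- t) mod int d < int d" using d by simp
    then have "j < d" using j by linarith
    ultimately show "e \<in> g ` (A \<times> {..<d})" using t by blast
  next
    fix e assume "e \<in> g ` (A \<times> {..<d})"
    then obtain u v j where uv: "(u, v) \<in> A" "e = edge n (u + int j * int m, v + int j * int m)"
      by (auto simp: g_def simp del: edge_simp)
    have "(u + int j * int m + (- int j) * int m, v + int j * int m + (- int j) * int m) \<in> A"
      using uv(1) by simp
    then have "(u + int j * int m, v + int j * int m) \<in> periodic_closure m A"
      unfolding periodic_closure_iff by blast
    then show "e \<in> block_graph (i, A)" unfolding uv(2) block_graph_def prod.case by (rule imageI)
  qed
  have inj: "inj_on g (B \<times> {..<d})" if B: "B \<subseteq> A" "d = 2 \<Longrightarrow> (i, i + int m) \<notin> B" for B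
  proof (rule inj_onI)
    fix x y assume x: "x \<in> B \<times> {..<d}" and y: "y \<in> B \<times> {..<d}" and eq: "g x = g y"
    obtain u v j where x': "x = ((u, v), j)" by (metis prod.collapse)
    obtain u' v' j' where y': "y = ((u', v'), j')" by (metis prod.collapse)
    have uv: "(u, v) \<in> B" "j < d" "(u', v') \<in> B" "j' < d" using x y by (simp_all add: x' y')
    have "edge n (u + int j * int m, v + int j * int m) = edge n (u' + int j' * int m, v' + int j' * int m)"
      using eq unfolding g_def x' y' prod.case .
    from edge_block_cases [OF A _ _ uv(2,4) this] uv B show "x = y" by (auto simp: x' y')
  qed
  show ?thesis
  proof (cases "d = 2 \<and> (i, i + int m) \<in> A")
    case False
    then have "card (block_graph (i, A)) = card (A \<times> {..<d})"
      unfolding image by (intro card_image inj) auto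
    then show ?thesis using False by (simp add: card_cartesian_product)
  next
    case True
    \<comment> \<open>Without the diameter the map from arcs and copies to edges is injective again;
      the diameter contributes a single further edge.\<close>
    define B where "B = A - {(i, i + int m)}"
    have AB: "A = insert (i, i + int m) B" using True by (auto simp: B_def)
    have d2: "d = 2" using True by simp
    have g: "g ((i, i + int m), j) = edge n (i, i + int m)" if "j < d" for j
    proof -
      have "j = 0 \<or> j = 1" using that d2 by auto
      moreover have "vertex n (i + int m + int m) = vertex n i"
        using vertex_add [OF n_pos, of i 1] by (simp add: n_eq d2 algebra_simps)
      ultimately show ?thesis by (auto simp: g_def)
    qed
    have "block_graph (i, A) = insert (edge n (i, i + int m)) (g ` (B \<times> {..<d}))"
    proof (intro equalityI subsetI)
      fix e assume "e \<in> block_graph (i, A)"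
      then obtain x j where x: "e = g (x, j)" "x \<in> A" "j < d" unfolding image by auto
      show "e \<in> insert (edge n (i, i + int m)) (g ` (B \<times> {..<d}))"
      proof (cases "x = (i, i + int m)")
        case True
        then show ?thesis using g [OF x(3)] x(1) by simp
      next
        case False
        then have "(x, j) \<in> B \<times> {..<d}" using x by (simp add: B_def)
        then show ?thesis unfolding x(1) by blast
      qed
    next
      fix e assume e: "e \<in> insert (edge n (i, i + int m)) (g ` (B \<times> {..<d}))"
      have "g ((i, i + int m), 0) \<in> g ` (A \<times> {..<d})" using True d by (intro imageI) simp
      moreover have "g ((i, i + int m), 0) = edge n (i, i + int m)" using g d by simp
      moreover have "g ` (B \<times> {..<d}) \<subseteq> g ` (A \<times> {..<d})" by (intro image_mono) (auto simp: B_def)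
      ultimately show "e \<in> block_graph (i, A)" using e unfolding image by (auto simp del: edge_simp)
    qed
    moreover have "edge n (i, i + int m) \<notin> g ` (B \<times> {..<d})"
    proof
      assume "edge n (i, i + int m) \<in> g ` (B \<times> {..<d})"
      then obtain u v j where uv: "(u, v) \<in> B" "j < d"
        and eq: "edge n (i, i + int m) = edge n (u + int j * int m, v + int j * int m)"
        by (auto simp: g_def simp del: edge_simp)
      have "edge n (i + int 0 * int m, i + int m + int 0 * int m) = edge n (u + int j * int m, v + int j * int m)"
        using eq by simp
      from edge_block_cases [OF A _ _ _ uv(2) this] True uv(1) d show False by (simp add: B_def)
    qed
    moreover have "finite (g ` (B \<times> {..<d}))" using finA by (simp add: B_def)
    moreover have "card (g ` (B \<times> {..<d})) = card B * d"
    proof -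
      have "card (g ` (B \<times> {..<d})) = card (B \<times> {..<d})" by (intro card_image inj) (auto simp: B_def)
      then show ?thesis by (simp add: card_cartesian_product)
    qed
    moreover have "card A = Suc (card B)"
    proof -
      have "finite B" "(i, i + int m) \<notin> B" using finA by (simp_all add: B_def)
      then show ?thesis unfolding AB by simp
    qed
    ultimately show ?thesis using True by (simp add: d2)
  qed
qed

lemma num_fixed_marked_blocks:
  "num_fixed d n k = card {p \<in> marked_blocks m. card (block_graph p) = k}"
proof -
  have "{E \<in> noncrossing_connected_graphs n k. rotate_graph n d E = E} = {E \<in> symmetric_graphs. card E = k}"
    unfolding noncrossing_connected_graphs_def symmetric_graphs_def by blast
  also have "symmetric_graphs = block_graph ` marked_blocks m"
    using bij_betw_block_graph unfolding bij_betw_def by simp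
  also have "{E \<in> block_graph ` marked_blocks m. card E = k}
      = block_graph ` {p \<in> marked_blocks m. card (block_graph p) = k}" by auto
  finally have "num_fixed d n k = card (block_graph ` {p \<in> marked_blocks m. card (block_graph p) = k})"
    unfolding num_fixed_def by (rule arg_cong)
  also have "\<dots> = card {p \<in> marked_blocks m. card (block_graph p) = k}"
    by (rule card_image, rule inj_on_subset [OF inj_on_block_graph]) simp
  finally show ?thesis .
qed

end

text \<open>Double counting over pairs of a graph on \<open>0..m\<close> and a shift
  \<open>i\<close>: the marking condition becomes \<open>m < reach 0 A + i\<close>, and exactly
  \<open>reach 0 A\<close> shifts in \<open>1..m\<close> satisfy it.\<close>

lemma card_marked_blocks:
  assumes "m \<ge> 1"
  shows "card {(i, A). (i, A) \<in> marked_blocks m \<and> card A = \<kappa>}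
    = (\<Sum>A\<in>{A \<in> arc_graphs 0 (int m). card A = \<kappa>}. nat (reach 0 A))"
proof -
  define S where "S = {A \<in> arc_graphs 0 (int m). card A = \<kappa>}"
  have fin: "finite S" by (simp add: S_def)
  have m: "0 < int m" using assms by simp
  have "{(i, A). (i, A) \<in> marked_blocks m \<and> card A = \<kappa>}
      = (SIGMA i:{1..int m}. {A \<in> arc_graphs i (i + int m). int m < reach i A \<and> card A = \<kappa>})"
    by (auto simp: marked_blocks_def)
  then have "card {(i, A). (i, A) \<in> marked_blocks m \<and> card A = \<kappa>}
      = (\<Sum>i\<in>{1..int m}. card {A \<in> arc_graphs i (i + int m). int m < reach i A \<and> card A = \<kappa>})"
    by simp
  also have "\<dots> = (\<Sum>i\<in>{1..int m}. card {A \<in> S. int m < reach 0 A + i})"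
  proof (rule sum.cong [OF refl])
    fix i
    have "bij_betw (shift_arcs i) {A \<in> arc_graphs 0 (int m). int m < reach 0 A + i \<and> card A = \<kappa>}
       {A \<in> arc_graphs i (i + int m). int m < reach i A \<and> card A = \<kappa>}"
    proof (rule bij_betw_byWitness [where f' = "shift_arcs (- i)"])
      show "shift_arcs i ` {A \<in> arc_graphs 0 (int m). int m < reach 0 A + i \<and> card A = \<kappa>}
          \<subseteq> {A \<in> arc_graphs i (i + int m). int m < reach i A \<and> card A = \<kappa>}"
      proof (rule image_subsetI)
        fix A assume A: "A \<in> {A \<in> arc_graphs 0 (int m). int m < reach 0 A + i \<and> card A = \<kappa>}"
        then show "shift_arcs i A \<in> {A \<in> arc_graphs i (i + int m). int m < reach i A \<and> card A = \<kappa>}"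
          using shift_arcs_arc_graphs [of A 0 "int m" i] reach_shift_arcs [of A 0 "int m" i] m
          by (simp add: add.commute)
      qed
      show "shift_arcs (- i) ` {A \<in> arc_graphs i (i + int m). int m < reach i A \<and> card A = \<kappa>}
          \<subseteq> {A \<in> arc_graphs 0 (int m). int m < reach 0 A + i \<and> card A = \<kappa>}"
      proof (rule image_subsetI)
        fix A assume A: "A \<in> {A \<in> arc_graphs i (i + int m). int m < reach i A \<and> card A = \<kappa>}"
        then show "shift_arcs (- i) A \<in> {A \<in> arc_graphs 0 (int m). int m < reach 0 A + i \<and> card A = \<kappa>}"
          using shift_arcs_arc_graphs [of A i "i + int m" "- i"] reach_shift_arcs [of A i "i + int m" "- i"] m
          by simp
      qed
    qed simp_all
    from bij_betw_same_card [OF this]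
    show "card {A \<in> arc_graphs i (i + int m). int m < reach i A \<and> card A = \<kappa>} = card {A \<in> S. int m < reach 0 A + i}"
      by (simp add: S_def conj_ac)
  qed
  also have "\<dots> = (\<Sum>i\<in>{1..int m}. \<Sum>A\<in>S. if int m < reach 0 A + i then 1 else 0)"
    using fin by (simp add: sum.If_cases Int_def)
  also have "\<dots> = (\<Sum>A\<in>S. \<Sum>i\<in>{1..int m}. if int m < reach 0 A + i then 1 else 0)"
    by (rule sum.swap)
  also have "\<dots> = (\<Sum>A\<in>S. nat (reach 0 A))"
  proof (rule sum.cong [OF refl])
    fix A assume "A \<in> S"
    then have "0 < reach 0 A" "reach 0 A \<le> int m"
      using reach_props(2,3) [of A 0 "int m"] m by (simp_all add: S_def)
    then have "{1..int m} \<inter> {i. int m < reach 0 A + i} = {int m - reach 0 A + 1..int m}"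
      by auto
    then show "(\<Sum>i\<in>{1..int m}. if int m < reach 0 A + i then 1 else 0) = nat (reach 0 A)"
      by (simp add: sum.If_cases)
  qed
  finally show ?thesis by (simp add: S_def)
qed

text \<open>An arc joining the ends of the block has reach \<open>i + m > m\<close>, so the marking
  condition is automatic and every \<open>i\<close> in \<open>1..m\<close> is allowed.\<close>

lemma card_marked_blocks_top:
  assumes "m \<ge> 1"
  shows "card {(i, A). (i, A) \<in> marked_blocks m \<and> (i, i + int m) \<in> A \<and> card A = \<kappa>}
    = m * card {A \<in> rooted_arc_graphs 0 (int m). card A = \<kappa>}"
proof -
  have top: "int m < reach i A" if "A \<in> arc_graphs i (i + int m)" "(i, i + int m) \<in> A" "1 \<le> i" for i A
    using reach_ge [OF that(1,2)] that(3) by simp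
  have "{(i, A). (i, A) \<in> marked_blocks m \<and> (i, i + int m) \<in> A \<and> card A = \<kappa>}
      = (SIGMA i:{1..int m}. {A \<in> rooted_arc_graphs i (i + int m). card A = \<kappa>})"
    using top by (auto simp: marked_blocks_def rooted_arc_graphs_def)
  then have "card {(i, A). (i, A) \<in> marked_blocks m \<and> (i, i + int m) \<in> A \<and> card A = \<kappa>}
      = (\<Sum>i\<in>{1..int m}. card {A \<in> rooted_arc_graphs i (i + int m). card A = \<kappa>})"
    by simp
  also have "\<dots> = (\<Sum>i\<in>{1..int m}. card {A \<in> rooted_arc_graphs 0 (int m). card A = \<kappa>})"
  proof (rule sum.cong [OF refl])
    fix i
    have *: "bij_betw (shift_arcs i) (rooted_arc_graphs 0 (int m)) (rooted_arc_graphs i (i + int m))"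
      using bij_betw_shift_arcs_rooted_arc_graphs [of i 0 "int m"] by (simp add: add.commute)
    have count: "card {A \<in> rooted_arc_graphs a b. card A = \<kappa>} = (\<Sum>A\<in>rooted_arc_graphs a b. if card A = \<kappa> then 1 else 0)" for a b
      by (simp add: sum.If_cases Int_def)
    show "card {A \<in> rooted_arc_graphs i (i + int m). card A = \<kappa>} = card {A \<in> rooted_arc_graphs 0 (int m). card A = \<kappa>}"
      unfolding count
      using sum.reindex_bij_betw [OF *, of "\<lambda>A. if card A = \<kappa> then 1 else 0 :: nat"] by simp
  qed
  finally show ?thesis by simp
qed

section \<open>Comparison with the values at roots of unity\<close>

lemma (in rotation) num_fixed_ge_3:
  assumes "d \<noteq> 2"
  shows "num_fixed d n (d * \<kappa>) = card {(i, A). (i, A) \<in> marked_blocks m \<and> card A = \<kappa>}"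
    and "\<not> d dvd k \<Longrightarrow> num_fixed d n k = 0"
proof -
  have card: "card (block_graph p) = d * card (snd p)" if "p \<in> marked_blocks m" for p
    using card_block_graph [of "fst p" "snd p"] that assms by simp
  have "{p \<in> marked_blocks m. card (block_graph p) = d * \<kappa>}
      = {(i, A). (i, A) \<in> marked_blocks m \<and> card A = \<kappa>}"
    using card d by force
  then show "num_fixed d n (d * \<kappa>) = card {(i, A). (i, A) \<in> marked_blocks m \<and> card A = \<kappa>}"
    by (simp add: num_fixed_marked_blocks)
  assume "\<not> d dvd k"
  then have empty: "{p \<in> marked_blocks m. card (block_graph p) = k} = {}" using card by auto
  show "num_fixed d n k = 0" unfolding num_fixed_marked_blocks empty by simp
qed

lemma finite_marked_blocks: "finite (marked_blocks m)"
  unfolding marked_blocks_def by (rule finite_SigmaI) auto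

text \<open>A block with \<open>\<kappa>\<close> arcs gives \<open>2\<kappa>\<close> edges, or
  \<open>2\<kappa> - 1\<close> if it contains a diameter; the parity of the edge number thus tells
  whether there is one.\<close>

lemma (in rotation) num_fixed_2_even:
  assumes d2: "d = 2"
  shows "num_fixed d n (2 * \<kappa>)
      + card {(i, A). (i, A) \<in> marked_blocks m \<and> (i, i + int m) \<in> A \<and> card A = \<kappa>}
    = card {(i, A). (i, A) \<in> marked_blocks m \<and> card A = \<kappa>}"
proof -
  have card: "card (block_graph (i, A)) + (if (i, i + int m) \<in> A then 1 else 0) = 2 * card A"
    if "(i, A) \<in> marked_blocks m" for i A
    using card_block_graph [OF that] d2 by simp
  let ?X = "{p \<in> marked_blocks m. card (block_graph p) = 2 * \<kappa>}"
  let ?Y = "{(i, A). (i, A) \<in> marked_blocks m \<and> (i, i + int m) \<in> A \<and> card A = \<kappa>}"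
  have X: "(i, A) \<in> ?X \<longleftrightarrow> (i, A) \<in> marked_blocks m \<and> (i, i + int m) \<notin> A \<and> card A = \<kappa>" for i A
  proof (cases "(i, A) \<in> marked_blocks m")
    case True
    then show ?thesis using card [OF True] by (cases "(i, i + int m) \<in> A") (simp_all, presburger)
  qed simp
  have "?X \<union> ?Y = {(i, A). (i, A) \<in> marked_blocks m \<and> card A = \<kappa>}"
    using X by (intro set_eqI) (auto simp del: mem_Collect_eq simp: split_paired_all Collect_case_prod_Sigma)
  moreover have "?X \<inter> ?Y = {}" using X by auto
  moreover have "finite ?X" using finite_marked_blocks by simp
  moreover have "finite ?Y" by (rule finite_subset [OF _ finite_marked_blocks]) auto
  ultimately show ?thesis
    unfolding num_fixed_marked_blocks using card_Un_disjoint [of ?X ?Y] by simp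
qed

lemma (in rotation) num_fixed_2_odd:
  assumes d2: "d = 2"
  shows "num_fixed d n (2 * \<kappa> + 1)
    = card {(i, A). (i, A) \<in> marked_blocks m \<and> (i, i + int m) \<in> A \<and> card A = \<kappa> + 1}"
proof -
  have card: "card (block_graph (i, A)) + (if (i, i + int m) \<in> A then 1 else 0) = 2 * card A"
    if "(i, A) \<in> marked_blocks m" for i A
    using card_block_graph [OF that] d2 by simp
  have X: "(i, A) \<in> marked_blocks m \<and> card (block_graph (i, A)) = 2 * \<kappa> + 1
      \<longleftrightarrow> (i, A) \<in> marked_blocks m \<and> (i, i + int m) \<in> A \<and> card A = \<kappa> + 1" for i A
  proof (cases "(i, A) \<in> marked_blocks m")
    case True
    then show ?thesis using card [OF True] by (cases "(i, i + int m) \<in> A") (simp_all add: double_not_eq_Suc_double, presburger)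
  qed simp
  then have "{p \<in> marked_blocks m. card (block_graph p) = 2 * \<kappa> + 1}
      = {(i, A). (i, A) \<in> marked_blocks m \<and> (i, i + int m) \<in> A \<and> card A = \<kappa> + 1}"
    by auto
  then show ?thesis by (simp add: num_fixed_marked_blocks)
qed

lemma binomial_complement: "a + b = N \<Longrightarrow> N choose a = N choose b"
  using binomial_symmetric [of a N] by auto

text \<open>With \<open>\<kappa> = m + j\<close>, lower entries are replaced by their complements to
  obtain the shape that \<open>gauss_binomial_lucas\<close> produces from
  \<open>c(n,k;q)\<close>.\<close>

lemma marked_blocks_closed_forms:
  assumes m: "m \<le> \<kappa>" "\<kappa> < 2 * m"
  shows "card {(i, A). (i, A) \<in> marked_blocks m \<and> card A = \<kappa>}
      = (3 * m - 1 choose (m + \<kappa>)) * (\<kappa> - 1 choose (m - 1))"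
    and "card {(i, A). (i, A) \<in> marked_blocks m \<and> (i, i + int m) \<in> A \<and> card A = \<kappa>}
      = (3 * m - 2 choose (m + \<kappa> - 1)) * (\<kappa> - 1 choose (m - 1))"
    and "m * card {A \<in> arc_graphs 0 (int m). card A = \<kappa>}
      = (3 * m choose (m + \<kappa> + 1)) * (\<kappa> - 1 choose (m - 1))"
proof -
  obtain j where j: "\<kappa> = m + j" using m(1) le_Suc_ex by blast
  have jm: "j < m" and m1: "m \<ge> 1" using m(2) j by simp_all
  have c: "m - 1 + j choose j = \<kappa> - 1 choose (m - 1)"
  proof -
    have "\<kappa> - 1 = m - 1 + j" using j m1 by simp
    then show ?thesis using binomial_complement [of j "m - 1" "m - 1 + j"] by simp
  qed
  have "3 * m - 1 choose (m - 1 - j) = 3 * m - 1 choose (m + \<kappa>)"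
    by (rule binomial_complement) (use j jm in simp)
  then show "card {(i, A). (i, A) \<in> marked_blocks m \<and> card A = \<kappa>}
      = (3 * m - 1 choose (m + \<kappa>)) * (\<kappa> - 1 choose (m - 1))"
    using card_marked_blocks [OF m1, of \<kappa>] card_connected_arcs(3) [OF jm] c j by simp
  have "3 * m - 2 choose (m - 1 - j) = 3 * m - 2 choose (m + \<kappa> - 1)"
    by (rule binomial_complement) (use j jm in simp)
  then show "card {(i, A). (i, A) \<in> marked_blocks m \<and> (i, i + int m) \<in> A \<and> card A = \<kappa>}
      = (3 * m - 2 choose (m + \<kappa> - 1)) * (\<kappa> - 1 choose (m - 1))"
    using card_marked_blocks_top [OF m1, of \<kappa>] card_connected_arcs(2) [OF jm] c j by simp
  have "3 * m choose (m - 1 - j) = 3 * m choose (m + \<kappa> + 1)"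
    by (rule binomial_complement) (use j jm in simp)
  then show "m * card {A \<in> arc_graphs 0 (int m). card A = \<kappa>}
      = (3 * m choose (m + \<kappa> + 1)) * (\<kappa> - 1 choose (m - 1))"
    using card_connected_arcs(1) [OF jm] c j by simp
qed

lemma gauss_binomial_Suc_self: "gauss_binomial (Suc n) n q = q_number (Suc n) q"
proof (induction n)
  case (Suc n)
  then show ?case
    by (subst gauss_binomial.simps(3)) (simp add: q_number_Suc [of "Suc n"] del: gauss_binomial.simps(3))
qed (simp add: q_number_Suc)

lemma q_number_primitive_root_mod:
  assumes "primitive_root_of_unity d w" and "d \<ge> 2"
  shows "q_number (d * a + r) w = q_number r w"
  using q_number_primitive_root [OF assms] primitive_root_power_mod [OF assms(1), of a r]
  by (metis eq_iff_diff_eq_0 mult_left_cancel)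

lemma num_fixed_1_closed_form:
  assumes "n \<ge> 2" and "n - 1 \<le> k" and "k < 2 * (n - 1)"
  shows "(n - 1) * num_fixed 1 n k = (3 * n - 3 choose (n + k)) * (k - 1 choose (n - 2))"
proof -
  define m where "m = n - 1"
  have "bij_betw (shift_arcs 1) (arc_graphs 0 (int m)) (arc_graphs 1 (int n))"
    using bij_betw_shift_arcs_arc_graphs [of 1 0 "int m"] assms(1) by (simp add: m_def of_nat_diff)
  from sum.reindex_bij_betw [OF this, of "\<lambda>A. if card A = k then 1 else 0 :: nat"]
  have "card {A \<in> arc_graphs 1 (int n). card A = k} = card {A \<in> arc_graphs 0 (int m). card A = k}"
    by (simp add: sum.If_cases Int_def)
  then have "(n - 1) * num_fixed 1 n k = m * card {A \<in> arc_graphs 0 (int m). card A = k}"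
    using num_fixed_1 [of n k] assms(1) by (simp add: m_def)
  also have "\<dots> = (3 * m choose (m + k + 1)) * (k - 1 choose (m - 1))"
    by (rule marked_blocks_closed_forms(3)) (use assms in \<open>simp_all add: m_def\<close>)
  finally show ?thesis
    using assms(1) by (simp add: m_def diff_mult_distrib2 numeral_2_eq_2)
qed

text \<open>Modulo \<open>d\<close>, the entries \<open>n - 1\<close>, \<open>n - 2\<close> and
  \<open>3n - 3\<close> leave remainders \<open>d - 1\<close>, \<open>d - 2\<close> and, for
  \<open>d \<ge> 3\<close>, \<open>d - 3\<close>; for \<open>d = 2\<close> the last one is 1. This
  different carry is why \<open>d = 2\<close> is treated separately.\<close>

lemma num_fixed_eq_value:
  fixes v :: complex
  assumes n: "n \<ge> 2" and k: "n - 1 \<le> k" "k < 2 * (n - 1)"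
    and d: "d \<ge> 2" "d dvd n" and w: "primitive_root_of_unity d w"
    and v: "q_number (n - 1) w * v
        = gauss_binomial (3 * n - 3) (n + k) w * gauss_binomial (k - 1) (n - 2) w"
  shows "v = of_nat (num_fixed d n k)"
proof -
  obtain m where nm: "n = d * m" using d(2) by (elim dvdE)
  have m: "m \<ge> 1" using nm n by (cases m) auto
  interpret rotation n d m by unfold_locales (use d m nm in auto)
  obtain m' where m': "m = Suc m'" using m by (cases m) auto
  note lucas = gauss_binomial_lucas [OF w d(1)]
  have "n - 1 = d * m' + (d - 1)" using nm m' d(1) by simp
  then have q: "q_number (n - 1) w = q_number (d - 1) w"
    using q_number_primitive_root_mod [OF w d(1)] by simp
  then have q0: "q_number (n - 1) w \<noteq> 0"
    using q_number_primitive_root_eq_0_iff(1) [OF w d(1), of "d - 1"] d(1) by simp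
  define \<kappa> where "\<kappa> = k div d"
  define r where "r = k mod d"
  have kr: "k = d * \<kappa> + r" "r < d" using d(1) by (simp_all add: \<kappa>_def r_def)
  have n2: "n - 2 = d * (m - 1) + (d - 2)" using nm m' d(1) by simp
  have nk: "n + k = d * (m + \<kappa>) + r" using kr nm by (simp add: algebra_simps)
  have k_up: "k < d * (2 * m)" using k nm by simp
  have \<kappa>_up: "\<kappa> < 2 * m"
  proof (rule ccontr)
    assume "\<not> \<kappa> < 2 * m"
    then have "d * (2 * m) \<le> d * \<kappa>" by (intro mult_le_mono2) simp
    then show False using k_up kr by linarith
  qed
  \<comment> \<open>The restriction on \<open>r\<close> is needed: the tree case
    \<open>k = n - 1\<close> has \<open>r = d - 1\<close> and
    \<open>\<kappa> = m - 1\<close>.\<close>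
  have \<kappa>_low: "m \<le> \<kappa>" if "r < d - 1"
  proof (rule ccontr)
    assume "\<not> m \<le> \<kappa>"
    then have "d * (\<kappa> + 1) \<le> d * m" by (intro mult_le_mono2) simp
    then have "k + 1 < n" using kr nm that d(1) by (simp add: algebra_simps)
    then show False using k by linarith
  qed
  show ?thesis
  proof (cases "d = 2")
    case d2: True
    have n3: "3 * n - 3 = d * (3 * m - 2) + 1" using nm m d2 by simp
    have q1: "q_number (n - 1) w = 1" using q d2 by (simp add: q_number_Suc numeral_2_eq_2)
    have n2': "n - 2 = d * (m - 1) + 0" using n2 d2 by simp
    show ?thesis
    proof (cases "r = 0")
      case True
      then have mk: "m \<le> \<kappa>" using \<kappa>_low d2 by simp
      have k1: "k - 1 = d * (\<kappa> - 1) + 1" using kr True mk m d2 by simp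
      have "gauss_binomial (3 * n - 3) (n + k) w = of_nat (3 * m - 2 choose (m + \<kappa>))"
        unfolding n3 nk True using lucas [of 1 0 "3 * m - 2" "m + \<kappa>"] d2 by simp
      moreover have "gauss_binomial (k - 1) (n - 2) w = of_nat (\<kappa> - 1 choose (m - 1))"
        unfolding k1 n2' using lucas [of 1 0 "\<kappa> - 1" "m - 1"] d2 by simp
      ultimately have "v = of_nat ((3 * m - 2 choose (m + \<kappa>)) * (\<kappa> - 1 choose (m - 1)))"
        using v q1 by simp
      moreover have "num_fixed d n k + (3 * m - 2 choose (m + \<kappa> - 1)) * (\<kappa> - 1 choose (m - 1))
          = (3 * m - 1 choose (m + \<kappa>)) * (\<kappa> - 1 choose (m - 1))"
        using num_fixed_2_even [OF d2, of \<kappa>] marked_blocks_closed_forms(1,2) [OF mk \<kappa>_up]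
          kr True d2 by simp
      \<comment> \<open>Pascal's rule carries out the subtraction of the blocks that contain a
        diameter.\<close>
      moreover have "3 * m - 1 choose (m + \<kappa>)
          = (3 * m - 2 choose (m + \<kappa> - 1)) + (3 * m - 2 choose (m + \<kappa>))"
        using m choose_reduce_nat [of "3 * m - 1" "m + \<kappa>"] by (simp add: numeral_2_eq_2)
      ultimately show ?thesis by (simp add: distrib_right)
    next
      case False
      then have r: "r = 1" using kr d2 by simp
      \<comment> \<open>An odd edge number comes from a block with \<open>\<kappa> + 1\<close> arcs,
        one of them the diameter, so the closed form is applied at
        \<open>\<kappa> + 1\<close>.\<close>
      have mk: "m \<le> \<kappa> + 1" "\<kappa> + 1 < 2 * m" using k kr r nm d2 m by simp_all
      have k1: "k - 1 = d * \<kappa> + 0" using kr r by simp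
      have "gauss_binomial (3 * n - 3) (n + k) w = of_nat (3 * m - 2 choose (m + \<kappa>))"
        unfolding n3 nk r using lucas [of 1 1 "3 * m - 2" "m + \<kappa>"] d2 by simp
      moreover have "gauss_binomial (k - 1) (n - 2) w = of_nat (\<kappa> choose (m - 1))"
        unfolding k1 n2' using lucas [of 0 0 "\<kappa>" "m - 1"] d2 by simp
      moreover have "num_fixed d n k = (3 * m - 2 choose (m + \<kappa>)) * (\<kappa> choose (m - 1))"
        using num_fixed_2_odd [OF d2, of \<kappa>] marked_blocks_closed_forms(2) [OF mk] kr r d2 by simp
      ultimately show ?thesis using v q1 by simp
    qed
  next
    case d3: False
    then have d3': "d \<ge> 3" using d(1) by simp
    have n3: "3 * n - 3 = d * (3 * m - 1) + (d - 3)"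
      using nm m' d3' by (simp add: algebra_simps)
    have A: "gauss_binomial (3 * n - 3) (n + k) w
        = of_nat (3 * m - 1 choose (m + \<kappa>)) * gauss_binomial (d - 3) r w"
      unfolding n3 nk using lucas [of "d - 3" r] kr d3' by simp
    show ?thesis
    proof (cases "r = 0")
      case True
      then have mk: "m \<le> \<kappa>" using \<kappa>_low d3' by simp
      obtain \<kappa>' where \<kappa>': "\<kappa> = Suc \<kappa>'" using mk m by (cases \<kappa>) auto
      have k1: "k - 1 = d * (\<kappa> - 1) + (d - 1)" using kr True d3' \<kappa>' by simp
      have "gauss_binomial (k - 1) (n - 2) w
          = of_nat (\<kappa> - 1 choose (m - 1)) * gauss_binomial (d - 1) (d - 2) w"
        unfolding k1 n2 using lucas [of "d - 1" "d - 2"] d3' by simp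
      \<comment> \<open>The remainder factor left by Lucas is \<open>[d-1]\<close>, which is exactly
        \<open>[n-1]\<close> at \<open>w\<close> and cancels.\<close>
      moreover have "gauss_binomial (d - 1) (d - 2) w = q_number (n - 1) w"
        using gauss_binomial_Suc_self [of "d - 2" w] d3' q by (simp add: Suc_diff_le numeral_2_eq_2 Suc_diff_Suc)
      ultimately have "q_number (n - 1) w * v = q_number (n - 1) w *
          of_nat ((3 * m - 1 choose (m + \<kappa>)) * (\<kappa> - 1 choose (m - 1)))"
        using v A True by simp
      then have "v = of_nat ((3 * m - 1 choose (m + \<kappa>)) * (\<kappa> - 1 choose (m - 1)))"
        using q0 mult_left_cancel by blast
      then show ?thesis
        using num_fixed_ge_3(1) [OF d3, of \<kappa>] marked_blocks_closed_forms(1) [OF mk \<kappa>_up] kr True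
        by simp
    next
      case False
      \<comment> \<open>For \<open>0 < r\<close> one factor always vanishes: the first if
        \<open>r > d - 3\<close>, the second if \<open>r - 1 < d - 2\<close>. On the other side,
        \<open>d\<close> does not divide \<open>k\<close> and there are no invariant graphs.\<close>
      have zero: "gauss_binomial (3 * n - 3) (n + k) w * gauss_binomial (k - 1) (n - 2) w = 0"
      proof (cases "d - 3 < r")
        case True
        then show ?thesis using A by (simp add: gauss_binomial_eq_0)
      next
        case False
        have k1: "k - 1 = d * \<kappa> + (r - 1)" using kr \<open>r \<noteq> 0\<close> by simp
        have "r - 1 < d - 2" using False d3' by linarith
        then have "gauss_binomial (k - 1) (n - 2) w = 0"
          unfolding k1 n2 using lucas [of "r - 1" "d - 2"] d3' by (simp add: gauss_binomial_eq_0)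
        then show ?thesis by simp
      qed
      have "v = 0" using v q0 unfolding zero by simp
      moreover have "\<not> d dvd k" using False by (simp add: r_def dvd_eq_mod_eq_0)
      ultimately show ?thesis using num_fixed_ge_3(2) [OF d3] by simp
    qed
  qed
qed

theorem theorem1p1:
  fixes n k :: nat
  assumes "n \<ge> 1" and "n - 1 \<le> k" and "int k \<le> 2 * int n - 3"
  shows "\<exists>c :: int poly. to_fract c = c_rat n k \<and>
    (\<forall>d \<omega>. d \<ge> 1 \<and> d dvd n \<and> primitive_root_of_unity d \<omega> \<longrightarrow>
       poly (map_poly of_int c) \<omega> = of_nat (num_fixed d n k))"
proof -
  \<comment> \<open>For \<open>n = 1\<close> the integer bound reads \<open>k \<le> -1\<close> and
    is unsatisfiable.\<close>
  have n: "n \<ge> 2" and k: "k \<ge> 1" "k < 2 * (n - 1)" using assms by linarith+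
  obtain c where c: "to_fract c = c_rat n k"
    "\<And>w. q_number (n - 1) w * eval_int_poly c w
          = gauss_binomial (3 * n - 3) (n + k) w * gauss_binomial (k - 1) (n - 2) w"
    using c_rat_polynomial [OF n k(1)] by blast
  have "eval_int_poly c w = of_nat (num_fixed d n k)"
    if d: "d \<ge> 1" "d dvd n" and w: "primitive_root_of_unity d w" for d w
  proof (cases "d = 1")
    case True
    \<comment> \<open>At 1 all q-quantities become ordinary integers, and the nonzero factor
      \<open>n - 1\<close> is cancelled.\<close>
    then have "w = 1" using w by (simp add: primitive_root_of_unity_def)
    then have "of_nat (n - 1) * eval_int_poly c w = of_nat ((n - 1) * num_fixed d n k)"
      using c(2) [of 1] num_fixed_1_closed_form [OF n assms(2) k(2)] True
      by (simp only: q_number_one gauss_binomial_one of_nat_mult)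
    then have "of_nat (n - 1) * eval_int_poly c w = of_nat (n - 1) * of_nat (num_fixed d n k)"
      by simp
    moreover have "of_nat (n - 1) \<noteq> (0 :: complex)" using n by simp
    ultimately show ?thesis using mult_left_cancel by blast
  next
    case False
    then have "d \<ge> 2" using d(1) by simp
    from num_fixed_eq_value [OF n assms(2) k(2) this d(2) w c(2)] show ?thesis .
  qed
  then show ?thesis using c(1) by (auto simp: eval_int_poly_def)
qed

end
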